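(* Let $T>0$, $\varepsilon>0$. Let $f,g\in H^1(0,T;L^2(\mathcal E))$, $h\in H^2(0,T;\mathbb R^{n_D})$, $r\in H^2(0,T;\mathbb R^{n_N})$. Let $p(0)\in H^1(\bar{\mathcal E})$ with $\mathcal Bp(0)=h(0)$ and $m(0)\in L^2(\mathcal E)$, and assume there exists $m_*\in L^2(\mathcal E)$ with $$(m_*,q)=\langle\mathcal K^*m(0),q\rangle-\langle\mathcal C^*r(0),q\rangle\qquad\text{for all }q\in H^1_0(\bar{\mathcal E}).$$ Then there exists a unique classical solution $(p,m,\lambda)$ of $$\dot p+ap-\mathcal K^*m+\mathcal B^*\lambda=g-\mathcal C^*r\ \text{ in }[H^1(\bar{\mathcal E})]^*,\quad \varepsilon\dot m+\mathcal Kp+dm=f\ \text{ in }[L^2(\mathcal E)]^*,\quad \mathcal Bp=h\ \text{ in }\mathbb R^{n_D}$$ with initial values $p(0),m(0)$, and $$p\in C([0,T],H^1(\bar{\mathcal E}))\cap C^1([0,T],L^2(\mathcal E)),\qquad m\in C^1([0,T],L^2(\mathcal E)),\qquad\lambda\in C([0,T],\mathbb R^{n_D}).$$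
   Context: Network: $\mathcal G=(\mathcal V,\mathcal E)$ is a finite connected directed graph whose edges are identified with bounded intervals of positive length. $\mathcal V$ is the disjoint union of $\mathcal V_D$ (boundary vertices where the potential is prescribed) and $\mathcal V_N$ (all other vertices); $n_D=|\mathcal V_D|\ge1$, $n_N=|\mathcal V_N|$, and vectors in $\mathbb R^{n_D},\mathbb R^{n_N}$ are indexed by these vertices. Spaces: $L^2(\mathcal E)$ = functions edgewise in $L^2(e)$, with inner product $(\cdot,\cdot)=\sum_e(\cdot,\cdot)_{L^2(e)}$ and norm $\|\cdot\|$. $H^1(\bar{\mathcal E})$ = functions edgewise in $H^1(e)$ that are globally continuous on the network (usual $H^1$ norm); $H^1_0(\bar{\mathcal E})$ = those vanishing at $\mathcal V_D$. $L^2(\mathcal E)$ is identified with its dual and embedded in $[H^1(\bar{\mathcal E})]^*$. Coefficients: measurable, time-independent $a,d$ on $\mathcal E$ with $0\le a\le\overline a$ and $0<\underline d\le d\le\overline d<\infty$ a.e. Operators: $\mathcal K:H^1(\bar{\mathcal E})\to[L^2(\mathcal E)]^*$, $\langle\mathcal Kq,m\rangle=(\partial_xq,m)$ (edgewise derivative); $\mathcal B:H^1(\bar{\mathcal E})\to\mathbb R^{n_D}$ and $\mathcal C:H^1(\bar{\mathcal E})\to\mathbb R^{n_N}$ are point evaluation at $\mathcal V_D$ and $\mathcal V_N$. A classical solution is a triple with the stated regularity satisfying all equations pointwise in time and the initial conditions. *)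

theory Defs
  imports "Graph_Theory.Digraph_Component" "HOL-Analysis.Analysis"
begin

text \<open>\<open>L2\<close> is the space of classes modulo equality almost everywhere;
  \<open>rep_L2 u\<close> is an arbitrary representative of the class \<open>u\<close>.\<close>

definition square_integrable :: "(real \<Rightarrow> real) \<Rightarrow> bool" where
  "square_integrable f \<longleftrightarrow> f \<in> borel_measurable lebesgue \<and> integrable lebesgue (\<lambda>x. (f x)\<^sup>2)"

lemma square_integrable_measurable: "square_integrable f \<Longrightarrow> f \<in> borel_measurable lebesgue"
  by (simp add: square_integrable_def)

lemma square_integrable_zero: "square_integrable (\<lambda>x. 0)"
  by (simp add: square_integrable_def)

lemma square_integrable_mult:
  assumes "square_integrable f" "square_integrable g"
  shows "integrable lebesgue (\<lambda>x. f x * g x)"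
proof (rule Bochner_Integration.integrable_bound)
  show "integrable lebesgue (\<lambda>x. (f x)\<^sup>2 + (g x)\<^sup>2)"
    using assms by (simp add: square_integrable_def)
  show "(\<lambda>x. f x * g x) \<in> borel_measurable lebesgue"
    using assms by (auto simp: square_integrable_def)
  have "\<bar>f x * g x\<bar> \<le> (f x)\<^sup>2 + (g x)\<^sup>2" for x
  proof -
    have "2 * (f x * g x) \<le> (f x)\<^sup>2 + (g x)\<^sup>2" "- 2 * (f x * g x) \<le> (f x)\<^sup>2 + (g x)\<^sup>2"
      using zero_le_power2[of "f x - g x"] zero_le_power2[of "f x + g x"]
      by (auto simp: power2_eq_square algebra_simps)
    then show ?thesis
      using zero_le_power2[of "f x"] zero_le_power2[of "g x"] by linarith
  qed
  then show "AE x in lebesgue. norm (f x * g x) \<le> norm ((f x)\<^sup>2 + (g x)\<^sup>2)"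
    by simp
qed

lemma square_integrable_add:
  assumes "square_integrable f" "square_integrable g"
  shows "square_integrable (\<lambda>x. f x + g x)"
proof -
  have "integrable lebesgue (\<lambda>x. (f x)\<^sup>2 + (g x)\<^sup>2 + 2 * (f x * g x))"
    using assms square_integrable_mult[OF assms] by (simp add: square_integrable_def)
  also have "(\<lambda>x. (f x)\<^sup>2 + (g x)\<^sup>2 + 2 * (f x * g x)) = (\<lambda>x. (f x + g x)\<^sup>2)"
    by (auto simp: power2_eq_square algebra_simps)
  finally show ?thesis
    using assms by (auto simp: square_integrable_def)
qed

lemma square_integrable_scale:
  assumes "square_integrable f"
  shows "square_integrable (\<lambda>x. c * f x)"
  using assms by (auto simp: square_integrable_def power_mult_distrib)

lemma square_integrable_minus: "square_integrable f \<Longrightarrow> square_integrable (\<lambda>x. - f x)"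
  by (auto simp: square_integrable_def)

lemma square_integrable_diff:
  "square_integrable f \<Longrightarrow> square_integrable g \<Longrightarrow> square_integrable (\<lambda>x. f x - g x)"
  using square_integrable_add[of f "\<lambda>x. - g x"] square_integrable_minus[of g] by simp

quotient_type L2 = "real \<Rightarrow> real" / partial:
  "\<lambda>f g. square_integrable f \<and> square_integrable g \<and> (AE x in lebesgue. f x = g x)"
proof (rule part_equivpI)
  show "\<exists>f. square_integrable f \<and> square_integrable f \<and> (AE x in lebesgue. f x = f x)"
    using square_integrable_zero by auto
  show "symp (\<lambda>f g. square_integrable f \<and> square_integrable g \<and> (AE x in lebesgue. f x = g x))"
    by (auto simp: symp_def elim: AE_mp)
  show "transp (\<lambda>f g. square_integrable f \<and> square_integrable g \<and> (AE x in lebesgue. f x = g x))"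
  proof (rule transpI, elim conjE, intro conjI)
    fix f g h :: "real \<Rightarrow> real"
    assume "AE x in lebesgue. f x = g x" "AE x in lebesgue. g x = h x"
    then show "AE x in lebesgue. f x = h x" by eventually_elim simp
  qed auto
qed

instantiation L2 :: real_vector
begin

lift_definition zero_L2 :: L2 is "\<lambda>x. 0"
  by (simp add: square_integrable_zero)

lift_definition plus_L2 :: "L2 \<Rightarrow> L2 \<Rightarrow> L2" is "\<lambda>f g x. f x + g x"
  by (auto simp: square_integrable_add elim: AE_mp)

lift_definition minus_L2 :: "L2 \<Rightarrow> L2 \<Rightarrow> L2" is "\<lambda>f g x. f x - g x"
  by (auto simp: square_integrable_diff elim: AE_mp)

lift_definition uminus_L2 :: "L2 \<Rightarrow> L2" is "\<lambda>f x. - f x"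
  by (auto simp: square_integrable_minus elim: AE_mp)

lift_definition scaleR_L2 :: "real \<Rightarrow> L2 \<Rightarrow> L2" is "\<lambda>c f x. c * f x"
  by (auto simp: square_integrable_scale elim: AE_mp)

instance
  by standard (transfer; auto simp: square_integrable_add square_integrable_scale square_integrable_diff
     square_integrable_minus square_integrable_zero algebra_simps)+

end

instantiation L2 :: real_inner
begin

lift_definition inner_L2 :: "L2 \<Rightarrow> L2 \<Rightarrow> real" is "\<lambda>f g. \<integral>x. f x * g x \<partial>lebesgue"
proof (elim conjE)
  fix f f' g g' :: "real \<Rightarrow> real"
  assume "square_integrable f" "square_integrable f'" "AE x in lebesgue. f x = f' x"
    "square_integrable g" "square_integrable g'" "AE x in lebesgue. g x = g' x"
  then show "(\<integral>x. f x * g x \<partial>lebesgue) = (\<integral>x. f' x * g' x \<partial>lebesgue)"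
    by (intro integral_cong_AE) (auto simp: square_integrable_def elim: AE_mp)
qed

definition norm_L2 :: "L2 \<Rightarrow> real" where "norm_L2 u = sqrt (inner u u)"
definition dist_L2 :: "L2 \<Rightarrow> L2 \<Rightarrow> real" where "dist_L2 u v = norm (u - v)"
definition sgn_L2 :: "L2 \<Rightarrow> L2" where "sgn_L2 u = u /\<^sub>R norm u"
definition uniformity_L2 :: "(L2 \<times> L2) filter" where
  "uniformity_L2 = (INF e\<in>{0<..}. principal {(u, v). dist u v < e})"
definition open_L2 :: "L2 set \<Rightarrow> bool" where
  "open_L2 U \<longleftrightarrow> (\<forall>x\<in>U. \<forall>\<^sub>F (x', y) in uniformity. x' = x \<longrightarrow> y \<in> U)"

instance
proof
  fix u v w :: L2 and c :: real and U :: "L2 set"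
  show "dist u v = norm (u - v)" by (rule dist_L2_def)
  show "sgn u = u /\<^sub>R norm u" by (rule sgn_L2_def)
  show "uniformity = (INF e\<in>{0<..}. principal {(u::L2, v). dist u v < e})" by (rule uniformity_L2_def)
  show "open U \<longleftrightarrow> (\<forall>x\<in>U. \<forall>\<^sub>F (x', y) in uniformity. x' = x \<longrightarrow> y \<in> U)" by (rule open_L2_def)
  show "inner u v = inner v u" by transfer (simp add: mult.commute)
  show "inner (u + v) w = inner u w + inner v w"
    by transfer (auto simp: algebra_simps square_integrable_mult)
  show "inner (c *\<^sub>R u) v = c * inner u v"
    by transfer (auto simp: algebra_simps square_integrable_mult)
  show "0 \<le> inner u u"
    by transfer auto
  show "inner u u = 0 \<longleftrightarrow> u = 0"
  proof transfer
    fix f :: "real \<Rightarrow> real"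
    assume "square_integrable f \<and> square_integrable f \<and> (AE x in lebesgue. f x = f x)"
    then have "square_integrable f" by auto
    then have "(\<integral>x. f x * f x \<partial>lebesgue) = 0 \<longleftrightarrow> (AE x in lebesgue. f x * f x = 0)"
      by (intro integral_nonneg_eq_0_iff_AE square_integrable_mult) auto
    with \<open>square_integrable f\<close> show "((\<integral>x. f x * f x \<partial>lebesgue) = 0) \<longleftrightarrow>
        (square_integrable f \<and> square_integrable (\<lambda>x. 0) \<and> (AE x in lebesgue. f x = 0))"
      by (auto simp: square_integrable_zero)
  qed
  show "norm u = sqrt (inner u u)" by (rule norm_L2_def)
qed

end

lemma square_integrable_rep_L2: "square_integrable (rep_L2 u)"
  using Quotient3_rep_reflp[OF Quotient3_L2] by blast

lemma rep_abs_L2: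
  assumes "square_integrable f"
  shows "AE x in lebesgue. rep_L2 (abs_L2 f) x = f x"
  using assms Quotient3_rep_abs[OF Quotient3_L2, of f] by auto

lemma abs_L2_rep: "abs_L2 (rep_L2 u) = u"
  using Quotient3_abs_rep[OF Quotient3_L2] .

lemma abs_L2_eqI:
  "square_integrable f \<Longrightarrow> square_integrable g \<Longrightarrow> AE x in lebesgue. f x = g x \<Longrightarrow> abs_L2 f = abs_L2 g"
  using Quotient3_rel[OF Quotient3_L2, of f g] by auto

lemma L2_eqI: "AE x in lebesgue. rep_L2 u x = rep_L2 v x \<Longrightarrow> u = v"
  using abs_L2_eqI[OF square_integrable_rep_L2 square_integrable_rep_L2, of u v] by (simp add: abs_L2_rep)

lemma plus_abs_L2: "square_integrable f \<Longrightarrow> square_integrable g \<Longrightarrow>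
   abs_L2 f + abs_L2 g = abs_L2 (\<lambda>x. f x + g x)"
  by (simp add: plus_L2.abs_eq)

lemma minus_abs_L2: "square_integrable f \<Longrightarrow> square_integrable g \<Longrightarrow>
   abs_L2 f - abs_L2 g = abs_L2 (\<lambda>x. f x - g x)"
  by (simp add: minus_L2.abs_eq)

lemma scaleR_abs_L2: "square_integrable f \<Longrightarrow> c *\<^sub>R abs_L2 f = abs_L2 (\<lambda>x. c * f x)"
  by (simp add: scaleR_L2.abs_eq)

lemma norm_abs_L2: "square_integrable f \<Longrightarrow> (norm (abs_L2 f))\<^sup>2 = (\<integral>x. (f x)\<^sup>2 \<partial>lebesgue)"
  by (simp add: norm_L2_def inner_L2.abs_eq power2_eq_square)

lemma nn_integral_norm_abs_L2:
  assumes "square_integrable f"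
  shows "(\<integral>\<^sup>+x. ennreal ((f x)\<^sup>2) \<partial>lebesgue) = ennreal ((norm (abs_L2 f))\<^sup>2)"
  using assms unfolding norm_abs_L2[OF assms]
  by (intro nn_integral_eq_integral) (auto simp: square_integrable_def)

instance L2 :: complete_space
proof
  fix X :: "nat \<Rightarrow> L2"
  assume C: "Cauchy X"
  define f where "f n = rep_L2 (X n)" for n
  have f: "square_integrable (f n)" for n
    by (simp add: f_def square_integrable_rep_L2)
  have [measurable]: "f n \<in> borel_measurable lebesgue" for n
    using f square_integrable_measurable by blast
  have X: "X n = abs_L2 (f n)" for n
    by (simp add: f_def abs_L2_rep)
  have nd: "(\<integral>\<^sup>+x. ennreal ((f m x - f n x)\<^sup>2) \<partial>lebesgue) = ennreal ((dist (X m) (X n))\<^sup>2)" for m n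
    using f by (simp add: X dist_norm minus_abs_L2 nn_integral_norm_abs_L2 square_integrable_diff)
  have "\<exists>N. \<forall>m\<ge>N. \<forall>n\<ge>N. dist (X m) (X n) < (1/8::real)^k" for k
    using C by (simp add: Cauchy_def)
  then obtain N where N: "\<And>k m n. m \<ge> N k \<Longrightarrow> n \<ge> N k \<Longrightarrow> dist (X m) (X n) < (1/8::real)^k"
    by metis
  define r where "r k = (\<Sum>i\<le>k. N i) + k" for k
  have rN: "r k \<ge> N k" "r k \<ge> k" "r (Suc k) \<ge> r k" for k
    by (auto simp: r_def intro: member_le_sum trans_le_add1)
  define g where "g k x = 4^k * (f (r (Suc k)) x - f (r k) x)\<^sup>2" for k x
  have [measurable]: "g k \<in> borel_measurable lebesgue" for k
    unfolding g_def by measurable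
  have gn: "g k x \<ge> 0" for k x by (simp add: g_def)
  have "(\<integral>\<^sup>+x. ennreal (g k x) \<partial>lebesgue) \<le> ennreal ((1/2)^k)" for k
  proof -
    have "(\<integral>\<^sup>+x. ennreal (g k x) \<partial>lebesgue) = ennreal (4^k) * ennreal ((dist (X (r (Suc k))) (X (r k)))\<^sup>2)"
      unfolding g_def nd[symmetric] by (subst nn_integral_cmult[symmetric]) (auto simp: ennreal_mult)
    also have "\<dots> = ennreal (4^k * (dist (X (r (Suc k))) (X (r k)))\<^sup>2)"
      by (simp add: ennreal_mult)
    also have "\<dots> \<le> ennreal ((1/2)^k)"
    proof (rule ennreal_leI)
      have d: "dist (X (r (Suc k))) (X (r k)) < (1/8::real)^k"
        using rN[of k] by (intro N) auto
      have "(dist (X (r (Suc k))) (X (r k)))\<^sup>2 \<le> (1/8)^k * 1"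
        unfolding power2_eq_square
        using d order.trans[OF less_imp_le[OF d] power_le_one[of "1/8::real" k]]
        by (intro mult_mono) auto
      then have "4^k * (dist (X (r (Suc k))) (X (r k)))\<^sup>2 \<le> 4^k * (1/8)^k"
        by (intro mult_left_mono) auto
      also have "\<dots> = (1/2::real)^k" by (simp flip: power_mult_distrib)
      finally show "4^k * (dist (X (r (Suc k))) (X (r k)))\<^sup>2 \<le> (1/2::real)^k" .
    qed
    finally show ?thesis .
  qed
  then have "(\<Sum>k. \<integral>\<^sup>+x. ennreal (g k x) \<partial>lebesgue) \<le> (\<Sum>k. ennreal ((1/2)^k))"
    by (intro suminf_le summableI)
  also have "\<dots> = ennreal (\<Sum>k. (1/2)^k)"
    by (intro suminf_ennreal2 summable_geometric) auto
  also have "\<dots> < \<infinity>" by simp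
  finally have "(\<integral>\<^sup>+x. (\<Sum>k. ennreal (g k x)) \<partial>lebesgue) < \<infinity>"
    by (subst nn_integral_suminf) auto
  then have "AE x in lebesgue. (\<Sum>k. ennreal (g k x)) \<noteq> \<infinity>"
    by (intro nn_integral_PInf_AE) auto
  then have "AE x in lebesgue. convergent (\<lambda>k. f (r k) x)"
  proof eventually_elim
    case (elim x)
    then obtain c where c: "(\<Sum>k. ennreal (g k x)) = ennreal c" "c \<ge> 0"
      by (cases "\<Sum>k. ennreal (g k x)") auto
    have gc: "g k x \<le> c" for k
    proof -
      have "ennreal (g k x) = (\<Sum>i\<in>{k}. ennreal (g i x))" by simp
      also have "\<dots> \<le> (\<Sum>k. ennreal (g k x))" by (rule sum_le_suminf) auto
      finally show ?thesis using c by simp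
    qed
    have "norm (f (r (Suc k)) x - f (r k) x) \<le> sqrt c * (1/2)^k" for k
    proof -
      have "(2^k * \<bar>f (r (Suc k)) x - f (r k) x\<bar>)\<^sup>2 = g k x"
        by (simp add: g_def power_mult_distrib flip: power_mult) (simp add: power_mult mult.commute[of k])
      then have "2^k * \<bar>f (r (Suc k)) x - f (r k) x\<bar> \<le> sqrt c"
        using gc[of k] by (intro real_le_rsqrt) simp
      then show ?thesis by (simp add: field_simps power_one_over)
    qed
    then have "summable (\<lambda>k. f (r (Suc k)) x - f (r k) x)"
      using summable_comparison_test'[OF summable_mult[OF summable_geometric[of "1/2::real"], of "sqrt c"],
        of 0 "\<lambda>k. f (r (Suc k)) x - f (r k) x"] by simp
    then have "convergent (\<lambda>n. \<Sum>k<n. f (r (Suc k)) x - f (r k) x)"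
      by (simp add: summable_iff_convergent)
    then have "convergent (\<lambda>n. f (r n) x - f (r 0) x)"
      using sum_lessThan_telescope[of "\<lambda>k. f (r k) x"] by simp
    from convergent_add[OF this convergent_const[of "f (r 0) x"]] show ?case
      by simp
  qed
  note conv = this
  define F where "F x = lim (\<lambda>k. f (r k) x)" for x
  have [measurable]: "F \<in> borel_measurable lebesgue"
    unfolding F_def by measurable
  have F: "AE x in lebesgue. (\<lambda>k. f (r k) x) \<longlonglongrightarrow> F x"
    using conv by eventually_elim (auto simp: F_def convergent_LIMSEQ_iff)
  have fatou: "(\<integral>\<^sup>+x. ennreal ((F x - f n x)\<^sup>2) \<partial>lebesgue) \<le> ennreal (e\<^sup>2)"
    if e: "\<And>m. m \<ge> M \<Longrightarrow> dist (X m) (X n) < e" for n M e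
  proof -
    have "(\<integral>\<^sup>+x. ennreal ((F x - f n x)\<^sup>2) \<partial>lebesgue)
        = (\<integral>\<^sup>+x. liminf (\<lambda>k. ennreal ((f (r k) x - f n x)\<^sup>2)) \<partial>lebesgue)"
    proof (rule nn_integral_cong_AE)
      show "AE x in lebesgue. ennreal ((F x - f n x)\<^sup>2) = liminf (\<lambda>k. ennreal ((f (r k) x - f n x)\<^sup>2))"
        using F
      proof eventually_elim
        case (elim x)
        then have "(\<lambda>k. ennreal ((f (r k) x - f n x)\<^sup>2)) \<longlonglongrightarrow> ennreal ((F x - f n x)\<^sup>2)"
          by (intro tendsto_intros)
        then show ?case by (intro lim_imp_Liminf[symmetric]) auto
      qed
    qed
    also have "\<dots> \<le> liminf (\<lambda>k. \<integral>\<^sup>+x. ennreal ((f (r k) x - f n x)\<^sup>2) \<partial>lebesgue)"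
      by (rule nn_integral_liminf) measurable
    also have "\<dots> \<le> liminf (\<lambda>k. ennreal (e\<^sup>2))"
    proof (rule Liminf_mono)
      show "\<forall>\<^sub>F k in sequentially. (\<integral>\<^sup>+x. ennreal ((f (r k) x - f n x)\<^sup>2) \<partial>lebesgue) \<le> ennreal (e\<^sup>2)"
        using eventually_ge_at_top[of M]
      proof eventually_elim
        case (elim k)
        then have "dist (X (r k)) (X n) < e"
          using rN(2)[of k] by (intro e) auto
        then show ?case
          unfolding nd by (intro ennreal_leI power_mono) auto
      qed
    qed
    also have "\<dots> = ennreal (e\<^sup>2)" by (simp add: Liminf_const)
    finally show ?thesis .
  qed
  have sqd: "square_integrable (\<lambda>x. F x - f n x)"
    if e: "\<And>m. m \<ge> M \<Longrightarrow> dist (X m) (X n) < e" for n M e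
  proof -
    have "(\<integral>\<^sup>+x. ennreal ((F x - f n x)\<^sup>2) \<partial>lebesgue) < \<infinity>"
      using fatou[OF e] by (rule order.strict_trans1) auto
    then show ?thesis
      by (auto simp: square_integrable_def intro!: integrableI_bounded)
  qed
  obtain M0 where "\<forall>m\<ge>M0. \<forall>n\<ge>M0. dist (X m) (X n) < 1"
    using C by (metis Cauchy_def zero_less_one)
  then have "square_integrable (\<lambda>x. F x - f M0 x)"
    by (intro sqd[of M0 _ 1]) auto
  from square_integrable_add[OF this f[of M0]] have F2: "square_integrable F" by simp
  show "convergent X"
  proof (rule convergentI, rule metric_LIMSEQ_I)
    fix e :: real assume "e > 0"
    then obtain M where M: "\<forall>m\<ge>M. \<forall>n\<ge>M. dist (X m) (X n) < e/2"
      using C unfolding Cauchy_def by (meson half_gt_zero)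
    have "dist (X n) (abs_L2 F) < e" if "n \<ge> M" for n
    proof -
      have "ennreal ((dist (abs_L2 F) (X n))\<^sup>2) = (\<integral>\<^sup>+x. ennreal ((F x - f n x)\<^sup>2) \<partial>lebesgue)"
        using f F2 by (simp add: X dist_norm minus_abs_L2 nn_integral_norm_abs_L2 square_integrable_diff)
      also have "\<dots> \<le> ennreal ((e/2)\<^sup>2)"
        using M that by (intro fatou[of M]) auto
      finally have "(dist (abs_L2 F) (X n))\<^sup>2 \<le> (e/2)\<^sup>2" by (simp add: power2_eq_square)
      then have "dist (abs_L2 F) (X n) \<le> e/2"
        using \<open>e > 0\<close> by (meson half_gt_zero less_imp_le power2_le_imp_le)
      then show ?thesis using \<open>e > 0\<close> by (simp add: dist_commute)
    qed
    then show "\<exists>no. \<forall>n\<ge>no. dist (X n) (abs_L2 F) < e" by blast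
  qed
qed

instance L2 :: banach ..

lemma tendsto_abs_L2:
  assumes s: "\<And>i. square_integrable (s i)" and f: "square_integrable f" and w: "square_integrable w"
    and bound: "\<And>i x. \<bar>s i x\<bar> \<le> w x" and lim: "AE x in lebesgue. (\<lambda>i. s i x) \<longlonglongrightarrow> f x"
  shows "(\<lambda>i. abs_L2 (s i)) \<longlonglongrightarrow> abs_L2 f"
proof -
  have [measurable]: "s i \<in> borel_measurable lebesgue" "f \<in> borel_measurable lebesgue" for i
    using s f by (auto simp: square_integrable_def)
  have "(\<lambda>i. \<integral>x. (s i x - f x)\<^sup>2 \<partial>lebesgue) \<longlonglongrightarrow> (\<integral>x. 0 \<partial>(lebesgue :: real measure))"
  proof (rule integral_dominated_convergence)
    show "integrable lebesgue (\<lambda>x. (w x + \<bar>f x\<bar>)\<^sup>2)"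
    proof -
      have "square_integrable (\<lambda>x. \<bar>f x\<bar>)" using f by (auto simp: square_integrable_def)
      from square_integrable_add[OF w this] show ?thesis by (simp add: square_integrable_def)
    qed
    show "AE x in lebesgue. (\<lambda>i. (s i x - f x)\<^sup>2) \<longlonglongrightarrow> 0"
      using lim
    proof eventually_elim
      case (elim x)
      then have "(\<lambda>i. (s i x - f x)\<^sup>2) \<longlonglongrightarrow> (f x - f x)\<^sup>2" by (intro tendsto_intros)
      then show ?case by simp
    qed
    fix i
    have "norm ((s i x - f x)\<^sup>2) \<le> (w x + \<bar>f x\<bar>)\<^sup>2" for x
      using bound[of i x] by (auto simp: abs_le_square_iff[symmetric])
    then show "AE x in lebesgue. norm ((s i x - f x)\<^sup>2) \<le> (w x + \<bar>f x\<bar>)\<^sup>2" by simp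
  qed auto
  then have "(\<lambda>i. (norm (abs_L2 (s i) - abs_L2 f))\<^sup>2) \<longlonglongrightarrow> 0"
    using s f by (simp add: minus_abs_L2 norm_abs_L2 square_integrable_diff)
  then have "(\<lambda>i. sqrt ((norm (abs_L2 (s i) - abs_L2 f))\<^sup>2)) \<longlonglongrightarrow> sqrt 0"
    by (rule tendsto_real_sqrt)
  then show ?thesis
    by (simp add: LIM_zero_iff tendsto_norm_zero_iff)
qed

lemma square_integrable_indicator:
  "A \<in> sets lebesgue \<Longrightarrow> emeasure lebesgue A < \<infinity> \<Longrightarrow> square_integrable (indicator A)"
  by (auto simp: square_integrable_def power2_eq_square simp flip: indicator_inter_arith)

lemma borel_eq_rat_Ioo:
  "borel = sigma UNIV ((\<lambda>(a, b). {a<..<b::real}) ` (\<rat> \<times> \<rat>))" (is "_ = ?SIGMA")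
proof (rule borel_eq_sigmaI1[OF borel_def])
  fix M :: "real set" assume "M \<in> {S. open S}"
  then have "open M" by simp
  show "M \<in> ?SIGMA"
    apply (subst open_UNION_box[OF \<open>open M\<close>])
    apply (safe intro!: sets.countable_UN' countable_PiE countable_Collect)
    apply (auto intro: countable_rat simp: PiE_iff box_real intro!: sigma_sets.Basic)
    done
qed auto

lemma second_countable_if_dense:
  fixes D :: "'a::metric_space set"
  assumes "countable D" "closure D = UNIV"
  shows "\<exists>B::'a set set. countable B \<and> open = generate_topology B"
proof -
  have "topological_basis (case_prod ball ` (D \<times> (\<rat> \<inter> {0<..})))"
  proof (intro topological_basis_iff[THEN iffD2], fast, clarify)
    fix U and x :: 'a assume asm: "open U" "x \<in> U"
    obtain e where e: "e > 0" "ball x e \<subseteq> U" using asm openE by blast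
    have "x \<in> closure D" using assms by simp
    then obtain y where y: "y \<in> D" "dist y x < e/3"
      using e by (auto simp: closure_approachable dest: spec[of _ "e/3"])
    obtain r where r: "r \<in> \<rat>" "e/3 < r" "r < e/2"
      using Rats_dense_in_real[of "e/3" "e/2"] e by auto
    have "x \<in> ball y r" using r y by simp
    moreover have "ball y r \<subseteq> U"
    proof (rule order.trans[OF _ e(2)], rule subsetI)
      fix z assume "z \<in> ball y r"
      then show "z \<in> ball x e" using y r dist_triangle[of x z y] by (simp add: dist_commute)
    qed
    moreover have "ball y r \<in> case_prod ball ` (D \<times> (\<rat> \<inter> {0<..}))"
      using y(1) r e by (intro image_eqI[of _ _ "(y, r)"]) auto
    ultimately show "\<exists>B'\<in>case_prod ball ` (D \<times> (\<rat> \<inter> {0<..})). x \<in> B' \<and> B' \<subseteq> U" by meson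
  qed
  moreover have "countable (case_prod ball ` (D \<times> (\<rat> \<inter> {0<..})))"
    using assms countable_rat by (intro countable_image countable_SIGMA) auto
  ultimately show ?thesis
    using topological_basis_imp_subbasis by auto
qed

instance L2 :: second_countable_topology
proof
  define gen where "gen = (\<lambda>(q, a, b). q *\<^sub>R abs_L2 (indicator {a<..<b::real}))"
  define D where "D = (\<lambda>l. \<Sum>t\<leftarrow>l. gen t) ` lists (\<rat> \<times> \<rat> \<times> \<rat>)"
  define C where "C = closure D"
  have "countable D"
    unfolding D_def by (intro countable_image countable_lists countable_SIGMA countable_rat)
  have D0: "0 \<in> D"
    unfolding D_def by (rule image_eqI[of _ _ "[]"]) auto
  have Dadd: "u + v \<in> D" if "u \<in> D" "v \<in> D" for u v
  proof -
    from that obtain l k where "u = (\<Sum>t\<leftarrow>l. gen t)" "v = (\<Sum>t\<leftarrow>k. gen t)"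
      "l \<in> lists (\<rat> \<times> \<rat> \<times> \<rat>)" "k \<in> lists (\<rat> \<times> \<rat> \<times> \<rat>)"
      unfolding D_def by auto
    then show ?thesis
      unfolding D_def by (intro image_eqI[of _ _ "l @ k"]) auto
  qed
  have Dscale: "q *\<^sub>R u \<in> D" if "u \<in> D" "q \<in> \<rat>" for u q
  proof -
    from that obtain l where l: "u = (\<Sum>t\<leftarrow>l. gen t)" "l \<in> lists (\<rat> \<times> \<rat> \<times> \<rat>)"
      unfolding D_def by auto
    have "q *\<^sub>R (\<Sum>t\<leftarrow>l. gen t) = (\<Sum>t\<leftarrow>map (\<lambda>(p, a, b). (q * p, a, b)) l. gen t)"
      by (induction l) (auto simp: gen_def scaleR_add_right)
    moreover have "map (\<lambda>(p, a, b). (q * p, a, b)) l \<in> lists (\<rat> \<times> \<rat> \<times> \<rat>)"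
      using l that by (auto simp: in_lists_conv_set)
    ultimately show ?thesis
      unfolding D_def l by blast
  qed
  have C0: "0 \<in> C"
    using D0 closure_subset unfolding C_def by blast
  have Cadd: "u + v \<in> C" if "u \<in> C" "v \<in> C" for u v
  proof -
    have "(\<lambda>z. fst z + snd z) ` closure (D \<times> D) \<subseteq> C"
      unfolding C_def using Dadd closure_subset[of D]
      by (intro image_closure_subset continuous_intros) auto
    then show ?thesis
      using that unfolding C_def closure_Times by force
  qed
  have Cscale: "c *\<^sub>R u \<in> C" if "u \<in> C" for u c
  proof -
    have "(\<lambda>z. fst z *\<^sub>R snd z) ` closure (\<rat> \<times> D) \<subseteq> C"
      unfolding C_def using Dscale closure_subset[of D]
      by (intro image_closure_subset continuous_intros) auto
    then show ?thesis
      using that unfolding C_def closure_Times Rats_closure_real by force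
  qed
  have Cdiff: "u - v \<in> C" if "u \<in> C" "v \<in> C" for u v
    using Cadd[OF that(1) Cscale[OF that(2), of "-1"]] by simp
  have Clim: "l \<in> C" if "\<And>n. X n \<in> C" "X \<longlonglongrightarrow> l" for X l
    using that unfolding C_def by (rule closed_sequentially[OF closed_closure])
  define I where "I n = {- real n<..<real n}" for n
  have sqI: "square_integrable (indicator (A \<inter> I n))" if "A \<in> sets borel" for A n
  proof (rule square_integrable_indicator)
    show "A \<inter> I n \<in> sets lebesgue" using that by (auto simp: I_def)
    have "emeasure lebesgue (A \<inter> I n) \<le> emeasure lebesgue (I n)"
      by (rule emeasure_mono) (auto simp: I_def)
    also have "\<dots> < \<infinity>" by (simp add: I_def)
    finally show "emeasure lebesgue (A \<inter> I n) < \<infinity>" .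
  qed
  define G where "G = (\<lambda>(a, b). {a<..<b::real}) ` (\<rat> \<times> \<rat>)"
  have G: "sets borel = sigma_sets UNIV G"
    by (subst borel_eq_rat_Ioo) (simp add: G_def sets_measure_of)
  have GC: "abs_L2 (indicator S) \<in> C" if "S \<in> G" for S
  proof -
    from that obtain a b where ab: "a \<in> \<rat>" "b \<in> \<rat>" "S = {a<..<b}" by (auto simp: G_def)
    then have "abs_L2 (indicator S) \<in> D"
      unfolding D_def by (intro image_eqI[of _ _ "[(1, a, b)]"]) (auto simp: gen_def)
    then show ?thesis unfolding C_def using closure_subset by blast
  qed
  have IG: "I n \<in> G" for n
    unfolding G_def I_def by (intro image_eqI[of _ _ "(- real n, real n)"]) auto
  have Gint: "Int_stable G"
  proof (rule Int_stableI)
    fix A B assume "A \<in> G" "B \<in> G"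
    then obtain a b c d where "a \<in> \<rat>" "b \<in> \<rat>" "A = {a<..<b}" "c \<in> \<rat>" "d \<in> \<rat>" "B = {c<..<d}"
      by (auto simp: G_def)
    then show "A \<inter> B \<in> G"
      unfolding G_def by (intro image_eqI[of _ _ "(max a c, min b d)"]) (auto simp: max_def min_def)
  qed
  have ind: "abs_L2 (indicator (A \<inter> I n)) \<in> C" if "A \<in> sets borel" for A n
    using Gint subset_Pow_Union[of G, THEN order.trans, OF Pow_mono[OF subset_UNIV]] that[unfolded G]
  proof (induction rule: sigma_sets_induct_disjoint)
    case (basic A)
    then show ?case using GC IG Gint by (auto simp: Int_stable_def)
  next
    case empty
    then show ?case using C0 by (simp add: zero_L2_def)
  next
    case (compl A)
    have "A \<in> sets borel" using compl by (simp add: G)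
    with sqI[of UNIV n] sqI[of A n]
    have "abs_L2 (indicator ((UNIV - A) \<inter> I n)) = abs_L2 (indicator (I n)) - abs_L2 (indicator (A \<inter> I n))"
      by (subst minus_abs_L2) (auto simp: indicator_def fun_eq_iff intro!: arg_cong[of _ _ abs_L2])
    then show ?case using compl Cdiff GC IG by auto
  next
    case (union A)
    have AB: "A i \<in> sets borel" for i using union by (auto simp: G)
    define U where "U k = (\<Union>i<k. A i)" for k :: nat
    have UB: "U k \<in> sets borel" for k using AB by (auto simp: U_def)
    have "abs_L2 (indicator (U k \<inter> I n)) \<in> C" for k
    proof (induction k)
      case 0
      then show ?case using C0 by (simp add: U_def zero_L2_def)
    next
      case (Suc k)
      have "A i \<inter> A k = {}" if "i < k" for i
        using that by (intro disjoint_family_onD[OF union(1)]) auto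
      then have "U k \<inter> A k = {}" by (auto simp: U_def)
      moreover have "U (Suc k) = U k \<union> A k" by (auto simp: U_def lessThan_Suc)
      ultimately have "indicator (U (Suc k) \<inter> I n) = (\<lambda>x. indicator (U k \<inter> I n) x + indicator (A k \<inter> I n) x :: real)"
        by (auto simp: indicator_def fun_eq_iff)
      then have "abs_L2 (indicator (U (Suc k) \<inter> I n)) = abs_L2 (indicator (U k \<inter> I n)) + abs_L2 (indicator (A k \<inter> I n))"
        by (simp add: plus_abs_L2 sqI UB AB)
      then show ?case using Cadd[OF Suc union(3)] by simp
    qed
    moreover have "(\<lambda>k. abs_L2 (indicator (U k \<inter> I n))) \<longlonglongrightarrow> abs_L2 (indicator ((\<Union>i. A i) \<inter> I n))"
    proof (rule tendsto_abs_L2)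
      show "square_integrable (indicator (U k \<inter> I n))" for k by (rule sqI[OF UB])
      show "square_integrable (indicator ((\<Union>i. A i) \<inter> I n))" using AB by (intro sqI sets.countable_UN) auto
      show "square_integrable (indicator (UNIV \<inter> I n))" by (rule sqI) simp
      show "\<bar>indicator (U k \<inter> I n) x\<bar> \<le> (indicator (UNIV \<inter> I n) x :: real)" for k x
        by (auto simp: indicator_def)
      have "(\<lambda>k. indicator (U k \<inter> I n) x) \<longlonglongrightarrow> (indicator ((\<Union>i. A i) \<inter> I n) x :: real)" for x
      proof (cases "x \<in> (\<Union>i. A i) \<inter> I n")
        case True
        then obtain i where i: "x \<in> A i" by auto
        have "\<forall>\<^sub>F k in sequentially. indicator (U k \<inter> I n) x = (indicator ((\<Union>i. A i) \<inter> I n) x :: real)"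
          using eventually_gt_at_top[of i] by eventually_elim (use True i in \<open>auto simp: U_def indicator_def\<close>)
        then show ?thesis by (rule tendsto_eventually)
      next
        case False
        then have "indicator (U k \<inter> I n) x = (indicator ((\<Union>i. A i) \<inter> I n) x :: real)" for k
          by (auto simp: U_def indicator_def)
        then show ?thesis by simp
      qed
      then show "AE x in lebesgue. (\<lambda>k. indicator (U k \<inter> I n) x) \<longlonglongrightarrow> (indicator ((\<Union>i. A i) \<inter> I n) x :: real)"
        by simp
    qed
    ultimately show ?case by (rule Clim)
  qed
  have borelC: "abs_L2 f \<in> C" if f: "square_integrable f" and fb: "f \<in> borel_measurable borel" for f
  proof -
    obtain s where s: "\<And>i. simple_function borel (s i)" "\<And>x. (\<lambda>i. s i x) \<longlonglongrightarrow> f x"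
      "\<And>i x. \<bar>s i x\<bar> \<le> 2 * \<bar>f x\<bar>"
      using borel_measurable_implies_sequence_metric[OF fb, of 0] by auto
    have sets: "s i -` {y} \<in> sets borel" for i y
      using simple_functionD(2)[OF s(1)[of i], of "{y}"] by simp
    have fin: "square_integrable (\<lambda>x. \<Sum>y\<in>Y. y * indicator (s i -` {y} \<inter> I i) x) \<and>
      abs_L2 (\<lambda>x. \<Sum>y\<in>Y. y * indicator (s i -` {y} \<inter> I i) x) \<in> C" if "finite Y" for Y i
      using that
    proof (induction Y rule: finite_induct)
      case empty
      then show ?case using C0 square_integrable_zero by (simp add: zero_L2_def)
    next
      case (insert y Y)
      have y: "square_integrable (\<lambda>x. y * indicator (s i -` {y} \<inter> I i) x)"
        by (intro square_integrable_scale sqI sets)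
      have yC: "abs_L2 (\<lambda>x. y * indicator (s i -` {y} \<inter> I i) x) \<in> C"
        using Cscale[OF ind[OF sets]] scaleR_abs_L2[OF sqI[OF sets]] by metis
      show ?case
        unfolding sum.insert[OF insert.hyps]
        using square_integrable_add[OF y conjunct1[OF insert.IH]] Cadd[OF yC conjunct2[OF insert.IH]]
          plus_abs_L2[OF y conjunct1[OF insert.IH]] by metis
    qed
    define S where "S i x = (\<Sum>y\<in>range (s i). y * indicator (s i -` {y} \<inter> I i) x)" for i x
    have Seq: "S i x = s i x * indicator (I i) x" for i x
    proof -
      have "finite (range (s i))" using simple_functionD(1)[OF s(1)[of i]] by simp
      then have "S i x = (\<Sum>y\<in>{s i x}. y * indicator (s i -` {y} \<inter> I i) x)"
        unfolding S_def by (intro sum.mono_neutral_right) (auto simp: indicator_def)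
      then show ?thesis by (simp add: indicator_def)
    qed
    have S: "square_integrable (S i)" "abs_L2 (S i) \<in> C" for i
      using fin[of "range (s i)" i] simple_functionD(1)[OF s(1)[of i]] by (auto simp: S_def[abs_def])
    have "(\<lambda>i. abs_L2 (S i)) \<longlonglongrightarrow> abs_L2 f"
    proof (rule tendsto_abs_L2)
      show "square_integrable (\<lambda>x. 2 * \<bar>f x\<bar>)"
        using f by (intro square_integrable_scale) (auto simp: square_integrable_def)
      show "\<bar>S i x\<bar> \<le> 2 * \<bar>f x\<bar>" for i x
        using s(3)[of i x] by (auto simp: Seq indicator_def)
      have "(\<lambda>i. S i x) \<longlonglongrightarrow> f x" for x
      proof -
        obtain n :: nat where n: "\<bar>x\<bar> < real n" using reals_Archimedean2 by blast
        have "\<forall>\<^sub>F i in sequentially. s i x = S i x"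
          using eventually_ge_at_top[of n] by eventually_elim (use n in \<open>auto simp: Seq I_def indicator_def\<close>)
        with s(2)[of x] show ?thesis by (rule Lim_transform_eventually)
      qed
      then show "AE x in lebesgue. (\<lambda>i. S i x) \<longlonglongrightarrow> f x" by simp
    qed (use S f in auto)
    with S(2) show ?thesis by (rule Clim)
  qed
  have "u \<in> C" for u :: L2
  proof -
    have sq: "square_integrable (rep_L2 u)" by (rule square_integrable_rep_L2)
    then obtain f where f: "f \<in> borel_measurable lborel" "AE x in lborel. rep_L2 u x = f x"
      using completion_ex_borel_measurable_real[of "rep_L2 u" lborel] by (auto simp: square_integrable_def)
    have ae: "AE x in lebesgue. rep_L2 u x = f x" using f(2) by (rule AE_completion)
    have m: "f \<in> borel_measurable lebesgue" using f(1) by (rule measurable_completion)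
    have "integrable lebesgue (\<lambda>x. (rep_L2 u x)\<^sup>2) \<longleftrightarrow> integrable lebesgue (\<lambda>x. (f x)\<^sup>2)"
      using sq m ae by (intro integrable_cong_AE) (auto simp: square_integrable_def elim: AE_mp)
    then have "square_integrable f" using sq m by (simp add: square_integrable_def)
    moreover have "abs_L2 f = u"
      using abs_L2_eqI[OF sq \<open>square_integrable f\<close> ae] by (simp add: abs_L2_rep)
    ultimately show ?thesis using borelC[of f] f(1) by simp
  qed
  then have "closure D = UNIV" unfolding C_def by auto
  with \<open>countable D\<close> show "\<exists>B::L2 set set. countable B \<and> open = generate_topology B"
    by (rule second_countable_if_dense)
qed

instance vec :: ("{metric_space, second_countable_topology}", finite) second_countable_topology
proof
  obtain A :: "'a set set" where A: "countable A" "topological_basis A"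
    using ex_countable_basis by auto
  define B where "B = (\<lambda>S. {x::'a^'b. \<forall>i. x $ i \<in> S i}) ` (UNIV \<rightarrow>\<^sub>E A)"
  have "countable B"
    unfolding B_def using A by (intro countable_image countable_PiE) auto
  moreover have "topological_basis B"
  proof (rule topological_basisI)
    fix S assume "S \<in> B"
    then show "open S"
      using A by (auto simp: B_def PiE_iff intro!: open_vector_box topological_basis_open)
  next
    fix U and x :: "'a^'b" assume "open U" "x \<in> U"
    then obtain W where W: "\<And>i. open (W i)" "\<And>i. x $ i \<in> W i" "\<And>y. (\<forall>i. y $ i \<in> W i) \<Longrightarrow> y \<in> U"
      unfolding open_vec_def by metis
    have "\<exists>S\<in>A. x $ i \<in> S \<and> S \<subseteq> W i" for i
      using topological_basisE[OF A(2) W(1) W(2)] by metis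
    then obtain S where S: "\<And>i. S i \<in> A" "\<And>i. x $ i \<in> S i" "\<And>i. S i \<subseteq> W i"
      by metis
    show "\<exists>S\<in>B. x \<in> S \<and> S \<subseteq> U"
    proof (intro bexI conjI)
      show "{x. \<forall>i. x $ i \<in> S i} \<in> B" using S by (auto simp: B_def)
      show "{x. \<forall>i. x $ i \<in> S i} \<subseteq> U" using S W(3) by blast
    qed (use S in auto)
  qed
  ultimately show "\<exists>B::('a^'b) set set. countable B \<and> open = generate_topology B"
    using topological_basis_imp_subbasis by auto
qed

definition test_funs :: "real \<Rightarrow> real \<Rightarrow> (real \<Rightarrow> real) set" where
  "test_funs a b = {\<phi>. (\<forall>k x. (deriv ^^ k) \<phi> differentiable (at x)) \<and>
     (\<exists>c d. a < c \<and> c \<le> d \<and> d < b \<and> (\<forall>x. x \<notin> {c..d} \<longrightarrow> \<phi> x = 0))}"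

definition weak_deriv_on ::
    "real \<Rightarrow> real \<Rightarrow> (real \<Rightarrow> 'b::{banach, second_countable_topology}) \<Rightarrow> (real \<Rightarrow> 'b) \<Rightarrow> bool" where
  "weak_deriv_on a b f f' \<longleftrightarrow> (\<forall>\<phi>\<in>test_funs a b.
     (LINT t:{a<..<b}|lebesgue. deriv \<phi> t *\<^sub>R f t) = - (LINT t:{a<..<b}|lebesgue. \<phi> t *\<^sub>R f' t))"

text \<open>In the following three definitions \<open>X\<close> is a closed subspace of the ambient space.\<close>

definition L2_time :: "real \<Rightarrow> 'b::{banach, second_countable_topology} set \<Rightarrow> (real \<Rightarrow> 'b) set" where
  "L2_time T X = {f. (\<forall>t\<in>{0<..<T}. f t \<in> X) \<and> set_borel_measurable lebesgue {0<..<T} f \<and>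
     set_integrable lebesgue {0<..<T} (\<lambda>t. (norm (f t))\<^sup>2)}"

text \<open>Elements of the Sobolev spaces are represented by their continuous representatives
  on the closed interval, so that point values in time are meaningful.\<close>

definition H1_time :: "real \<Rightarrow> 'b::{banach, second_countable_topology} set \<Rightarrow> (real \<Rightarrow> 'b) set" where
  "H1_time T X = {f\<in>L2_time T X. continuous_on {0..T} f \<and> (\<forall>t\<in>{0..T}. f t \<in> X) \<and>
     (\<exists>f'\<in>L2_time T X. weak_deriv_on 0 T f f')}"

definition H2_time :: "real \<Rightarrow> 'b::{banach, second_countable_topology} set \<Rightarrow> (real \<Rightarrow> 'b) set" where
  "H2_time T X = {f\<in>L2_time T X. continuous_on {0..T} f \<and> (\<forall>t\<in>{0..T}. f t \<in> X) \<and>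
     (\<exists>f'\<in>H1_time T X. weak_deriv_on 0 T f f')}"

definition C0_time :: "real \<Rightarrow> 'b::real_normed_vector set \<Rightarrow> (real \<Rightarrow> 'b) set" where
  "C0_time T X = {f. (\<forall>t\<in>{0..T}. f t \<in> X) \<and> continuous_on {0..T} f}"

text \<open>Derivatives at the end points of the time interval are one-sided.\<close>

definition time_deriv :: "real \<Rightarrow> (real \<Rightarrow> 'b::real_normed_vector) \<Rightarrow> real \<Rightarrow> 'b" where
  "time_deriv T f t = vector_derivative f (at t within {0..T})"

definition C1_time :: "real \<Rightarrow> 'b::real_normed_vector set \<Rightarrow> (real \<Rightarrow> 'b) set" where
  "C1_time T X = {f. (\<forall>t\<in>{0..T}. f t \<in> X) \<and>
     (\<forall>t\<in>{0..T}. f differentiable (at t within {0..T})) \<and>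
     continuous_on {0..T} (time_deriv T f)}"

text \<open>The arc \<open>e\<close> is identified with the interval from \<open>0\<close> (at \<open>tail G e\<close>) to \<open>len e\<close>
  (at \<open>head G e\<close>). The notion of connectedness is the undirected one. At least one arc is
  required: on a single vertex without arcs the vertex value of a continuous function is not
  determined by its class in the (then trivial) space of square integrable functions.\<close>

definition network ::
    "('v, 'e) pre_digraph \<Rightarrow> ('e \<Rightarrow> real) \<Rightarrow> 'v set \<Rightarrow> 'v set \<Rightarrow> bool" where
  "network G len VD VN \<longleftrightarrow> fin_digraph G \<and> Digraph_Component.connected G \<and> arcs G \<noteq> {} \<and>
     (\<forall>e\<in>arcs G. 0 < len e) \<and> verts G = VD \<union> VN \<and> VD \<inter> VN = {} \<and> VD \<noteq> {}"

text \<open>The vectors indexed by a vertex set \<open>S\<close>, extended by zero.\<close>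

definition vertex_vecs :: "'v set \<Rightarrow> (real^'v::finite) set" where
  "vertex_vecs S = {c. \<forall>v. v \<notin> S \<longrightarrow> c $ v = 0}"

text \<open>The edgewise square integrable functions, extended by zero outside the edges. The inner
  product of \<open>L2^'e\<close> is the sum of the edgewise inner products.\<close>

definition L2_net :: "('v, 'e::finite) pre_digraph \<Rightarrow> ('e \<Rightarrow> real) \<Rightarrow> (L2^'e) set" where
  "L2_net G len = {u. (\<forall>e\<in>arcs G. AE x in lebesgue. x \<notin> {0..len e} \<longrightarrow> rep_L2 (u $ e) x = 0) \<and>
     (\<forall>e. e \<notin> arcs G \<longrightarrow> u $ e = 0)}"

definition has_edge_deriv ::
    "('v, 'e::finite) pre_digraph \<Rightarrow> ('e \<Rightarrow> real) \<Rightarrow> L2^'e \<Rightarrow> L2^'e \<Rightarrow> bool" where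
  "has_edge_deriv G len u w \<longleftrightarrow> w \<in> L2_net G len \<and>
     (\<forall>e\<in>arcs G. weak_deriv_on 0 (len e) (rep_L2 (u $ e)) (rep_L2 (w $ e)))"

definition edge_deriv :: "('v, 'e::finite) pre_digraph \<Rightarrow> ('e \<Rightarrow> real) \<Rightarrow> L2^'e \<Rightarrow> L2^'e" where
  "edge_deriv G len u = (THE w. has_edge_deriv G len u w)"

text \<open>\<open>u\<close> has a representative which is continuous on the network, with value \<open>c $ v\<close> at the
  vertex \<open>v\<close>.\<close>

definition has_vertex_values ::
    "('v::finite, 'e::finite) pre_digraph \<Rightarrow> ('e \<Rightarrow> real) \<Rightarrow> L2^'e \<Rightarrow> real^'v \<Rightarrow> bool" where
  "has_vertex_values G len u c \<longleftrightarrow> c \<in> vertex_vecs (verts G) \<and>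
     (\<exists>U. \<forall>e\<in>arcs G. continuous_on {0..len e} (U e) \<and>
        (AE x in lebesgue. x \<in> {0..len e} \<longrightarrow> rep_L2 (u $ e) x = U e x) \<and>
        U e 0 = c $ tail G e \<and> U e (len e) = c $ head G e)"

definition vertex_values ::
    "('v::finite, 'e::finite) pre_digraph \<Rightarrow> ('e \<Rightarrow> real) \<Rightarrow> L2^'e \<Rightarrow> real^'v" where
  "vertex_values G len u = (THE c. has_vertex_values G len u c)"

definition H1_net :: "('v::finite, 'e::finite) pre_digraph \<Rightarrow> ('e \<Rightarrow> real) \<Rightarrow> (L2^'e) set" where
  "H1_net G len = {u\<in>L2_net G len. (\<exists>w. has_edge_deriv G len u w) \<and> (\<exists>c. has_vertex_values G len u c)}"

definition H1_norm :: "('v, 'e::finite) pre_digraph \<Rightarrow> ('e \<Rightarrow> real) \<Rightarrow> L2^'e \<Rightarrow> real" where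
  "H1_norm G len u = sqrt ((norm u)\<^sup>2 + (norm (edge_deriv G len u))\<^sup>2)"

definition C0_time_H1 ::
    "real \<Rightarrow> ('v::finite, 'e::finite) pre_digraph \<Rightarrow> ('e \<Rightarrow> real) \<Rightarrow> (real \<Rightarrow> L2^'e) set" where
  "C0_time_H1 T G len = {p. (\<forall>t\<in>{0..T}. p t \<in> H1_net G len) \<and>
     (\<forall>t\<in>{0..T}. ((\<lambda>s. H1_norm G len (p s - p t)) \<longlongrightarrow> 0) (at t within {0..T}))}"

text \<open>Point evaluation at the vertices in \<open>S\<close>: the operator \<open>\<B>\<close> for \<open>S = VD\<close> and the operator
  \<open>\<C>\<close> for \<open>S = VN\<close>.\<close>

definition eval_op ::
    "('v::finite, 'e::finite) pre_digraph \<Rightarrow> ('e \<Rightarrow> real) \<Rightarrow> 'v set \<Rightarrow> L2^'e \<Rightarrow> real^'v" where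
  "eval_op G len S q = (\<chi> v. if v \<in> S then vertex_values G len q $ v else 0)"

definition eval_adj ::
    "('v::finite, 'e::finite) pre_digraph \<Rightarrow> ('e \<Rightarrow> real) \<Rightarrow> 'v set \<Rightarrow> real^'v \<Rightarrow> L2^'e \<Rightarrow> real" where
  "eval_adj G len S y = (\<lambda>q. y \<bullet> eval_op G len S q)"

definition H1_0_net ::
    "('v::finite, 'e::finite) pre_digraph \<Rightarrow> ('e \<Rightarrow> real) \<Rightarrow> 'v set \<Rightarrow> (L2^'e) set" where
  "H1_0_net G len VD = {q\<in>H1_net G len. eval_op G len VD q = 0}"

definition K_op :: "('v, 'e::finite) pre_digraph \<Rightarrow> ('e \<Rightarrow> real) \<Rightarrow> L2^'e \<Rightarrow> L2^'e \<Rightarrow> real" where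
  "K_op G len q = (\<lambda>m. edge_deriv G len q \<bullet> m)"

definition K_adj :: "('v, 'e::finite) pre_digraph \<Rightarrow> ('e \<Rightarrow> real) \<Rightarrow> L2^'e \<Rightarrow> L2^'e \<Rightarrow> real" where
  "K_adj G len m = (\<lambda>q. K_op G len q m)"

definition coeff_mult :: "('e::finite \<Rightarrow> real \<Rightarrow> real) \<Rightarrow> L2^'e \<Rightarrow> L2^'e" where
  "coeff_mult c u = (\<chi> e. abs_L2 (\<lambda>x. c e x * rep_L2 (u $ e) x))"

definition net_coefficient ::
    "('v, 'e) pre_digraph \<Rightarrow> ('e \<Rightarrow> real) \<Rightarrow> real \<Rightarrow> real \<Rightarrow> ('e \<Rightarrow> real \<Rightarrow> real) \<Rightarrow> bool" where
  "net_coefficient G len lo hi c \<longleftrightarrow> (\<forall>e\<in>arcs G. set_borel_measurable lebesgue {0..len e} (c e) \<and>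
     (AE x in lebesgue. x \<in> {0..len e} \<longrightarrow> lo \<le> c e x \<and> c e x \<le> hi))"

text \<open>An equation in a dual space is an equality of functionals: both sides agree on every
  element of the space.\<close>

definition classical_solution ::
    "('v::finite, 'e::finite) pre_digraph \<Rightarrow> ('e \<Rightarrow> real) \<Rightarrow> 'v set \<Rightarrow> 'v set \<Rightarrow>
     ('e \<Rightarrow> real \<Rightarrow> real) \<Rightarrow> ('e \<Rightarrow> real \<Rightarrow> real) \<Rightarrow> real \<Rightarrow> real \<Rightarrow>
     (real \<Rightarrow> L2^'e) \<Rightarrow> (real \<Rightarrow> L2^'e) \<Rightarrow> (real \<Rightarrow> real^'v) \<Rightarrow> (real \<Rightarrow> real^'v) \<Rightarrow> L2^'e \<Rightarrow> L2^'e \<Rightarrow>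
     (real \<Rightarrow> L2^'e) \<Rightarrow> (real \<Rightarrow> L2^'e) \<Rightarrow> (real \<Rightarrow> real^'v) \<Rightarrow> bool" where
  "classical_solution G len VD VN a d \<epsilon> T f g h r p0 m0 p m l \<longleftrightarrow>
     p \<in> C0_time_H1 T G len \<and> p \<in> C1_time T (L2_net G len) \<and>
     m \<in> C1_time T (L2_net G len) \<and> l \<in> C0_time T (vertex_vecs VD) \<and>
     p 0 = p0 \<and> m 0 = m0 \<and>
     (\<forall>t\<in>{0..T}.
        (\<forall>q\<in>H1_net G len.
           time_deriv T p t \<bullet> q + coeff_mult a (p t) \<bullet> q - K_adj G len (m t) q + eval_adj G len VD (l t) q
             = g t \<bullet> q - eval_adj G len VN (r t) q) \<and>
        (\<forall>w\<in>L2_net G len.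
           \<epsilon> * (time_deriv T m t \<bullet> w) + K_op G len (p t) w + coeff_mult d (m t) \<bullet> w = f t \<bullet> w) \<and>
        eval_op G len VD (p t) = h t)"

end

theory Submission
  imports Defs
begin

text \<open>
Subtracting a lift \<open>lift h\<close> of the Dirichlet data and a field \<open>Z r\<close> with
\<open>\<K>\<^sup>* (Z r) - \<C>\<^sup>* r \<in> L\<^sup>2\<close> reduces the problem to \<open>z' = A z + F\<close> for \<open>z = (p, sqrt \<epsilon> m)\<close>, where
\<open>F\<close> is absolutely continuous in time (this uses two time derivatives of \<open>h\<close> and \<open>r\<close>), and \<open>A\<close> is the
skew block operator built from \<open>\<K>\<close> on \<open>H\<^sup>1\<^sub>0\<close> and its adjoint, perturbed by the nonpositive bounded
multiplication operators. The existence of \<open>m_star\<close> says exactly that the initial value lies in the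
domain of \<open>A\<close>. The operator \<open>A\<close> is maximal dissipative: the resolvent equation of the skew part is a
symmetric coercive problem on \<open>H\<^sup>1\<^sub>0\<close>. The solution is obtained with the Yosida approximations
\<open>A\<^sub>n\<close>, for which \<open>z'\<close> is given by an explicit formula containing only \<open>exp (t A\<^sub>n)\<close>.
The multiplier \<open>\<lambda>\<close> is the residual of the first equation on the lifts of the unit vectors of \<open>VD\<close>.
Uniqueness is the energy estimate for the difference of two solutions, tested with the difference itself.
\<close>

section \<open>Symmetric Lax--Milgram and a growth estimate\<close>

text \<open>The operator theory is stated on a whole type, while \<open>L2_net\<close> is only a
  closed subspace of \<open>L2^'e\<close>. The operator is therefore extended by zero: membership in
  the graph \<open>V\<close> constrains the first component only after \<open>net_proj\<close>, so
  off the network the operator vanishes and its domain stays dense. The field \<open>Z r\<close>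
  comes from Riesz representation: evaluation at a vertex is a bounded functional on the graph of
  the edge derivative, hence of the form \<open>z v \<bullet> u + \<zeta> v \<bullet> w\<close>. The
  \<open>\<zeta>\<close> part enters \<open>m\<close>, the \<open>z\<close> part becomes a source
  \<open>\<Phi> r\<close> in the first equation. The factor \<open>sqrt \<epsilon>\<close> makes the
  two couplings negative adjoints of each other, as skewness demands. The multiplier is absent from
  the evolution problem because test functions in H1_0 do not see it. Continuity of \<open>p\<close>
  in the H1 norm comes last: the second equation expresses the edge derivative of \<open>p\<close>
  through terms that are continuous in time.\<close>

lemma quadratic_nonneg_imp_linear_zero:
  fixes \<beta> q :: real
  assumes q: "0 \<le> q" and nonneg: "\<And>t. 0 \<le> 2 * t * \<beta> + t\<^sup>2 * q"
  shows "\<beta> = 0"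
proof (rule ccontr)
  assume "\<beta> \<noteq> 0"
  \<comment> \<open>The minimiser is \<open>t = - \<beta> / q\<close>; the denominator
    \<open>q + 1\<close> also covers \<open>q = 0\<close>.\<close>
  have "0 \<le> 2 * (- \<beta> / (q + 1)) * \<beta> + (- \<beta> / (q + 1))\<^sup>2 * q"
    by (rule nonneg)
  also have "\<dots> = (\<beta> / (q + 1))\<^sup>2 * (- q - 2)"
  proof -
    have "2 * (- \<beta> / (q + 1)) * \<beta> = - 2 * (\<beta> / (q + 1))\<^sup>2 * (q + 1)"
      using q by (simp add: power2_eq_square)
    then show ?thesis by (simp add: algebra_simps)
  qed
  also have "\<dots> < 0"
    using q \<open>\<beta> \<noteq> 0\<close> by (intro mult_pos_neg) auto
  finally show False by simp
qed

text \<open>The direct method: a minimising sequence of \<open>J v = b v v - 2 * f v\<close> on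
  \<open>V\<close> is Cauchy by coercivity and the parallelogram identity, and the first variation
  at its limit is the equation. It serves for projections, for Riesz representation and for the
  resolvent of the skew block.\<close>

lemma lax_milgram_symmetric:
  fixes V :: "'a::{real_inner, banach} set"
  assumes V: "subspace V" "closed V"
    and b: "bounded_bilinear b" and sym: "\<And>u v. b u v = b v u"
    and \<alpha>: "\<alpha> > 0" and coercive: "\<And>v. v \<in> V \<Longrightarrow> \<alpha> * (norm v)\<^sup>2 \<le> b v v"
    and add: "\<And>u v. u \<in> V \<Longrightarrow> v \<in> V \<Longrightarrow> f (u + v) = f u + f v"
    and scale: "\<And>c v. v \<in> V \<Longrightarrow> f (c *\<^sub>R v) = c * f v"
    and bound: "\<And>v. v \<in> V \<Longrightarrow> \<bar>f v\<bar> \<le> C * norm v"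
  shows "\<exists>z\<in>V. \<forall>v\<in>V. b z v = f v"
proof -
  interpret b: bounded_bilinear b by (rule b)
  define J where "J v = b v v - 2 * f v" for v
  have diff: "f (u - v) = f u - f v" if "u \<in> V" "v \<in> V" for u v
    using add[of u "- v"] scale[of v "-1"] that V by (simp add: subspace_neg)
  have lower: "- (C\<^sup>2 / \<alpha>) \<le> J v" if "v \<in> V" for v
  proof -
    have "0 \<le> \<alpha> * (norm v - C / \<alpha>)\<^sup>2" using \<alpha> by simp
    also have "\<dots> = \<alpha> * (norm v)\<^sup>2 - 2 * C * norm v + C\<^sup>2 / \<alpha>"
      using \<alpha> by (simp add: power2_eq_square field_simps)
    finally show ?thesis
      using coercive[OF that] bound[OF that] unfolding J_def by linarith
  qed
  define d where "d = Inf (J ` V)"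
  have bdd: "bdd_below (J ` V)" using lower by (intro bdd_belowI2)
  have dle: "d \<le> J v" if "v \<in> V" for v
    unfolding d_def using bdd that by (intro cINF_lower)
  have "0 \<in> V" using V subspace_0 by blast
  then have "J ` V \<noteq> {}" by blast
  have "\<exists>u\<in>V. J u < d + 1 / real (Suc n)" for n
    using cInf_lessD[OF \<open>J ` V \<noteq> {}\<close>, of "d + 1 / real (Suc n)"] unfolding d_def[symmetric] by auto
  then obtain u where u: "\<And>n. u n \<in> V" "\<And>n. J (u n) < d + 1 / real (Suc n)" by metis
  \<comment> \<open>Parallelogram identity at the midpoint, which again lies in \<open>V\<close>, so
    \<open>J\<close> is at least \<open>d\<close> there.\<close>
  have par: "\<alpha> / 2 * (norm (x - y))\<^sup>2 \<le> J x + J y - 2 * d" if "x \<in> V" "y \<in> V" for x y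
  proof -
    have m: "(1/2) *\<^sub>R (x + y) \<in> V" using V that by (simp add: subspace_add subspace_scale)
    have "f ((1/2) *\<^sub>R (x + y)) = (f x + f y) / 2"
      using that V by (simp add: scale add subspace_add)
    then have "J x + J y - 2 * J ((1/2) *\<^sub>R (x + y)) = b (x - y) (x - y) / 2"
      unfolding J_def by (simp add: b.add_left b.add_right b.diff_left b.diff_right b.scaleR_left
          b.scaleR_right sym[of y x] field_simps)
    then show ?thesis
      using dle[OF m] coercive[OF subspace_diff[OF V(1) that]] by linarith
  qed
  have "Cauchy u"
  proof (rule CauchyI)
    fix e :: real assume e: "e > 0"
    \<comment> \<open>Beyond \<open>N\<close> both values of \<open>J\<close> are within \<alpha>
      e^2 / 4 of \<open>d\<close>, so \<open>par\<close> leaves less than \<alpha> e^2 / 2.\<close>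
    obtain N :: nat where N: "4 / (\<alpha> * e\<^sup>2) < real N" using reals_Archimedean2 by blast
    have "norm (u m - u n) < e" if "m \<ge> N" "n \<ge> N" for m n
    proof -
      have *: "1 / real (Suc k) < \<alpha> * e\<^sup>2 / 4" if "k \<ge> N" for k
      proof -
        have "4 / (\<alpha> * e\<^sup>2) < real (Suc k)" using N that by linarith
        then show ?thesis using \<alpha> e by (simp add: field_simps)
      qed
      have "\<alpha> / 2 * (norm (u m - u n))\<^sup>2 < \<alpha> / 2 * e\<^sup>2"
        using par[OF u(1) u(1), of m n] u(2)[of m] u(2)[of n] *[OF that(1)] *[OF that(2)] by linarith
      then have "(norm (u m - u n))\<^sup>2 < e\<^sup>2" using \<alpha> by simp
      then show ?thesis using e by (simp add: power2_less_imp_less)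
    qed
    then show "\<exists>M. \<forall>m\<ge>M. \<forall>n\<ge>M. norm (u m - u n) < e" by blast
  qed
  then obtain z where z: "u \<longlonglongrightarrow> z" using Cauchy_convergent convergent_def by blast
  have zV: "z \<in> V" using closed_sequentially[OF V(2) u(1) z] .
  have "(\<lambda>n. f (u n - z)) \<longlonglongrightarrow> 0"
  proof (rule Lim_null_comparison)
    show "\<forall>\<^sub>F n in sequentially. norm (f (u n - z)) \<le> C * norm (u n - z)"
      using bound[OF subspace_diff[OF V(1) u(1) zV]] by simp
    show "(\<lambda>n. C * norm (u n - z)) \<longlonglongrightarrow> 0"
      using z by (intro tendsto_mult_right_zero) (simp add: LIM_zero_iff tendsto_norm_zero)
  qed
  then have "(\<lambda>n. f (u n)) \<longlonglongrightarrow> f z"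
    by (simp add: diff[OF u(1) zV] LIM_zero_iff)
  then have "(\<lambda>n. J (u n)) \<longlonglongrightarrow> J z"
    unfolding J_def using z by (intro tendsto_intros b.tendsto)
  moreover have "(\<lambda>n. d + 1 / real (Suc n)) \<longlonglongrightarrow> d + 0"
    by (intro tendsto_intros LIMSEQ_Suc[OF lim_1_over_n])
  ultimately have "J z \<le> d + 0"
    using u(2) by (intro LIMSEQ_le) (auto intro!: exI[of _ 0] less_imp_le)
  have "b z v = f v" if v: "v \<in> V" for v
  proof -
    have "0 \<le> 2 * t * (b z v - f v) + t\<^sup>2 * b v v" for t
    proof -
      have "z + t *\<^sub>R v \<in> V" using V zV v by (simp add: subspace_add subspace_scale)
      then have "J z \<le> J (z + t *\<^sub>R v)" using dle[of "z + t *\<^sub>R v"] \<open>J z \<le> d + 0\<close> by linarith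
      moreover have "f (z + t *\<^sub>R v) = f z + t * f v"
        using add[OF zV subspace_scale[OF V(1) v]] scale[OF v] by simp
      ultimately show ?thesis
        unfolding J_def by (simp add: b.add_left b.add_right b.scaleR_left b.scaleR_right
            sym[of v z] power2_eq_square algebra_simps)
    qed
    moreover have "0 \<le> b v v"
      using coercive[OF v] \<alpha> by (smt (verit) mult_nonneg_nonneg zero_le_power2)
    ultimately show ?thesis using quadratic_nonneg_imp_linear_zero[of "b v v" "b z v - f v"] by simp
  qed
  with zV show ?thesis by blast
qed

lemma orthogonal_projection_exists:
  fixes V :: "'a::{real_inner, banach} set"
  assumes "subspace V" "closed V"
  shows "\<exists>z\<in>V. \<forall>v\<in>V. (x - z) \<bullet> v = 0"
proof -
  have "\<exists>z\<in>V. \<forall>v\<in>V. z \<bullet> v = x \<bullet> v"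
  proof (rule lax_milgram_symmetric[OF assms bounded_bilinear_inner inner_commute, of 1])
    show "\<bar>x \<bullet> v\<bar> \<le> norm x * norm v" for v by (rule Cauchy_Schwarz_ineq2)
  qed (auto simp: inner_add_right power2_norm_eq_inner)
  then obtain z where "z \<in> V" "\<And>v. v \<in> V \<Longrightarrow> z \<bullet> v = x \<bullet> v" by blast
  then show ?thesis by (intro bexI[of _ z]) (auto simp: inner_diff_left)
qed

lemma riesz_on_subspace:
  fixes V :: "'a::{real_inner, banach} set"
  assumes "subspace V" "closed V"
    and "\<And>u v. u \<in> V \<Longrightarrow> v \<in> V \<Longrightarrow> f (u + v) = f u + f v"
    and "\<And>c v. v \<in> V \<Longrightarrow> f (c *\<^sub>R v) = c * f v"
    and "\<And>v. v \<in> V \<Longrightarrow> \<bar>f v\<bar> \<le> C * norm v"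
  shows "\<exists>z. \<forall>v\<in>V. f v = z \<bullet> v"
proof -
  have "\<exists>z\<in>V. \<forall>v\<in>V. z \<bullet> v = f v"
    by (rule lax_milgram_symmetric[OF assms(1,2) bounded_bilinear_inner inner_commute, of 1 f C])
      (auto simp: power2_norm_eq_inner assms)
  then show ?thesis by metis
qed

text \<open>Formally the derivative of the norm is \<open>v \<bullet> v' / norm v\<close>, at most
  \<open>M\<close>. With \<open>M = 0\<close> this yields contractivity and the uniqueness of
  solutions; with a general constant it compares two exponentials.\<close>

lemma norm_le_initial_plus_linear:
  fixes v :: "real \<Rightarrow> 'a::real_inner"
  assumes v: "\<And>t. t \<in> {0..T} \<Longrightarrow> (v has_vector_derivative v' t) (at t within {0..T})"
    and le: "\<And>t. t \<in> {0..T} \<Longrightarrow> v t \<bullet> v' t \<le> M * norm (v t)"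
    and M: "0 \<le> M" and t: "t \<in> {0..T}"
  shows "norm (v t) \<le> norm (v 0) + M * t"
proof (rule field_le_epsilon)
  fix \<delta> :: real assume \<delta>: "\<delta> > 0"
  \<comment> \<open>The norm is not differentiable at zero; adding \<open>\<delta>\<^sup>2\<close>
    under the root repairs this and costs at most \<delta> at time zero.\<close>
  define \<phi> where "\<phi> s = sqrt (v s \<bullet> v s + \<delta>\<^sup>2)" for s
  have pos: "v s \<bullet> v s + \<delta>\<^sup>2 > 0" for s using \<delta> by (simp add: add_nonneg_pos)
  have \<phi>pos: "\<phi> s > 0" for s using pos by (simp add: \<phi>_def)
  have d\<phi>: "(\<phi> has_real_derivative (v s \<bullet> v' s / \<phi> s)) (at s within {0..T})" if s: "s \<in> {0..T}" for s
  proof -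
    have "((\<lambda>s. v s \<bullet> v s + \<delta>\<^sup>2) has_real_derivative (v s \<bullet> v' s + v' s \<bullet> v s)) (at s within {0..T})"
      unfolding has_real_derivative_iff_has_vector_derivative
      using has_vector_derivative_add[OF bounded_bilinear.has_vector_derivative[OF bounded_bilinear_inner v[OF s] v[OF s]]
        has_vector_derivative_const[of "\<delta>\<^sup>2"]] by simp
    from DERIV_chain2[OF DERIV_real_sqrt[OF pos] this]
    show ?thesis by (simp add: \<phi>_def[abs_def] inner_commute[of "v' s"] divide_simps)
  qed
  have mvt: "\<exists>x. x \<in> {0..t} \<and> \<phi> t - \<phi> 0 = (t - 0) * (v x \<bullet> v' x / \<phi> x)" if "t > 0"
  proof -
    have "\<exists>z\<in>{0<..<t}. \<phi> t - \<phi> 0 = (v z \<bullet> v' z / \<phi> z) * (t - 0)"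
    proof (rule mvt_simple[OF that, where f' = "\<lambda>z. (*) (v z \<bullet> v' z / \<phi> z)"])
      fix x assume "0 \<le> x" "x \<le> t"
      then have "x \<in> {0..T}" "{0..t} \<subseteq> {0..T}" using t by auto
      from has_field_derivative_subset[OF d\<phi>[OF this(1)] this(2)]
      show "(\<phi> has_derivative (*) (v x \<bullet> v' x / \<phi> x)) (at x within {0..t})"
        by (simp add: has_field_derivative_def)
    qed
    then obtain z where "z \<in> {0<..<t}" "\<phi> t - \<phi> 0 = (v z \<bullet> v' z / \<phi> z) * (t - 0)" ..
    then show ?thesis by (intro exI[of _ z]) auto
  qed
  have slope: "v x \<bullet> v' x / \<phi> x \<le> M" if x: "x \<in> {0..T}" for x
  proof -
    have "norm (v x) \<le> \<phi> x"
      unfolding \<phi>_def norm_eq_sqrt_inner by (intro real_sqrt_le_mono) simp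
    then have "v x \<bullet> v' x \<le> M * \<phi> x"
      using le[OF x] M by (meson mult_left_mono order_trans)
    then show ?thesis using \<phi>pos[of x] by (simp add: field_simps)
  qed
  have "\<phi> t - \<phi> 0 \<le> t * M"
  proof (cases "t = 0")
    case False
    then have "t > 0" using t by simp
    with mvt obtain x where x: "x \<in> {0..t}" "\<phi> t - \<phi> 0 = (t - 0) * (v x \<bullet> v' x / \<phi> x)" by blast
    have "x \<in> {0..T}" using x t by auto
    from slope[OF this] \<open>t > 0\<close>
    show ?thesis unfolding x(2) by (simp only: diff_zero) (intro mult_left_mono, auto)
  qed simp
  moreover have "\<phi> 0 \<le> norm (v 0) + \<delta>"
    unfolding \<phi>_def using sqrt_sum_squares_le_sum[of "norm (v 0)" \<delta>] \<delta> by (simp add: power2_norm_eq_inner)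
  moreover have "norm (v t) \<le> \<phi> t"
    unfolding \<phi>_def norm_eq_sqrt_inner by (intro real_sqrt_le_mono) simp
  ultimately show "norm (v t) \<le> norm (v 0) + M * t + \<delta>" by (simp add: mult.commute)
qed

section \<open>Exponentials of bounded operators and convolutions\<close>

text \<open>Written for plain functions, so that boundedness of \<open>B\<close> remains a
  hypothesis of each lemma.\<close>

definition exp_op :: "('a \<Rightarrow> 'a) \<Rightarrow> real \<Rightarrow> 'a \<Rightarrow> 'a::banach" where
  "exp_op B t x = (\<Sum>n. (t ^ n / fact n) *\<^sub>R (B ^^ n) x)"

lemma exp_op_zero [simp]: "exp_op B 0 x = x"
  unfolding exp_op_def using suminf_finite[of "{0}" "\<lambda>n. (0 ^ n / fact n) *\<^sub>R (B ^^ n) x"]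
  by (simp add: power_0_left)

lemma exp_op_series_bound:
  fixes B :: "'a \<Rightarrow> 'a::real_normed_vector"
  assumes "\<And>x. norm (B x) \<le> K * norm x" and "K \<ge> 0"
  shows "norm ((t ^ n / fact n) *\<^sub>R (B ^^ n) x) \<le> inverse (fact n) * (\<bar>t\<bar> * K) ^ n * norm x"
proof -
  have "norm ((B ^^ n) x) \<le> K ^ n * norm x"
  proof (induction n)
    case (Suc n)
    have "norm (B ((B ^^ n) x)) \<le> K * norm ((B ^^ n) x)" by (rule assms)
    also have "\<dots> \<le> K * (K ^ n * norm x)" using Suc assms(2) by (rule mult_left_mono)
    finally show ?case by (simp add: mult.assoc)
  qed simp
  then have "norm (t ^ n / fact n) * norm ((B ^^ n) x) \<le> norm (t ^ n / fact n) * (K ^ n * norm x)"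
    by (intro mult_left_mono) auto
  also have "\<dots> = inverse (fact n) * (\<bar>t\<bar> * K) ^ n * norm x"
    by (simp add: power_mult_distrib power_abs divide_inverse mult_ac abs_mult)
  finally show ?thesis by simp
qed

lemma summable_exp_op:
  fixes B :: "'a \<Rightarrow> 'a::banach"
  assumes "bounded_linear B"
  shows "summable (\<lambda>n. (t ^ n / fact n) *\<^sub>R (B ^^ n) x)"
proof -
  obtain K where K: "K \<ge> 0" "\<And>x. norm (B x) \<le> K * norm x"
    using bounded_linear.nonneg_bounded[OF assms] by (auto simp: mult.commute)
  show ?thesis
  proof (rule summable_comparison_test')
    show "summable (\<lambda>n. inverse (fact n) * (\<bar>t\<bar> * K) ^ n * norm x)"
      by (intro summable_mult2 summable_exp)
    show "norm ((t ^ n / fact n) *\<^sub>R (B ^^ n) x) \<le> inverse (fact n) * (\<bar>t\<bar> * K) ^ n * norm x" for n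
      by (rule exp_op_series_bound[OF K(2,1)])
  qed
qed

lemma exp_op_commute:
  assumes B: "bounded_linear B" and C: "bounded_linear C" and comm: "\<And>x. C (B x) = B (C x)"
  shows "C (exp_op B t x) = exp_op B t (C x)"
proof -
  have "C ((B ^^ n) x) = (B ^^ n) (C x)" for n x
    by (induction n) (auto simp: comm)
  then show ?thesis
    unfolding exp_op_def bounded_linear.suminf[OF C summable_exp_op[OF B]]
    by (simp add: linear_simps(5)[OF C])
qed

lemma linear_exp_op:
  assumes B: "bounded_linear B"
  shows "linear (exp_op B t)"
proof -
  have lin: "linear (B ^^ n)" for n
    by (induction n) (auto intro!: simp: linear_iff linear_simps[OF B])
  show ?thesis
    by (rule linearI)
      (simp_all add: exp_op_def suminf_add[OF summable_exp_op[OF B] summable_exp_op[OF B]] linear_add[OF lin]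
        linear_cmul[OF lin] scaleR_add_right suminf_scaleR_right[OF summable_exp_op[OF B]] mult.commute)
qed

text \<open>Termwise differentiation. The derived partial sum is \<open>B\<close> applied to the
  partial sum one term shorter, so its uniform convergence follows from that of the series itself
  and the boundedness of \<open>B\<close>.\<close>

lemma exp_op_has_vector_derivative:
  assumes B: "bounded_linear B"
  shows "((\<lambda>t. exp_op B t x) has_vector_derivative B (exp_op B t x)) (at t within S)"
proof -
  obtain K where K: "K > 0" "\<And>x. norm (B x) \<le> K * norm x"
    using bounded_linear.pos_bounded[OF B] by (auto simp: mult.commute)
  \<comment> \<open>The Weierstrass bound is uniform only for bounded times, hence a ball slightly
    larger than \<open>\<bar>t\<bar>\<close>.\<close>
  define R where "R = \<bar>t\<bar> + 1"
  define D where "D = ball (0::real) R"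
  have D: "convex D" "open D" "t \<in> D" by (auto simp: D_def R_def)
  define f where "f n t = (t ^ n / fact n) *\<^sub>R (B ^^ n) x" for n :: nat and t :: real
  have unif: "uniform_limit D (\<lambda>n t. \<Sum>i<n. f i t) (\<lambda>t. exp_op B t x) sequentially"
    unfolding exp_op_def f_def
  proof (rule Weierstrass_m_test)
    show "summable (\<lambda>n. inverse (fact n) * (R * K) ^ n * norm x)"
      by (intro summable_mult2 summable_exp)
    show "norm ((t ^ n / fact n) *\<^sub>R (B ^^ n) x) \<le> inverse (fact n) * (R * K) ^ n * norm x"
      if "t \<in> D" for n t
    proof -
      have "norm ((t ^ n / fact n) *\<^sub>R (B ^^ n) x) \<le> inverse (fact n) * (\<bar>t\<bar> * K) ^ n * norm x"
        using K by (intro exp_op_series_bound) auto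
      also have "\<dots> \<le> inverse (fact n) * (R * K) ^ n * norm x"
        using that K by (intro mult_right_mono mult_left_mono power_mono) (auto simp: D_def)
      finally show ?thesis .
    qed
  qed
  define f' where "f' n t h = h *\<^sub>R ((real n * t ^ (n - 1) / fact n) *\<^sub>R (B ^^ n) x)" for n :: nat and t h :: real
  have f'_sum: "(\<Sum>i<Suc m. f' i t h) = h *\<^sub>R B (\<Sum>i<m. f i t)" for m t h
  proof -
    have "(\<Sum>i<Suc m. f' i t h) = (\<Sum>i<m. f' (Suc i) t h)"
      by (subst sum.lessThan_Suc_shift) (simp add: f'_def)
    also have "\<dots> = h *\<^sub>R (\<Sum>i<m. B (f i t))"
      unfolding scaleR_sum_right
    proof (rule sum.cong[OF refl])
      fix i
      have "real (Suc i) * t ^ i / fact (Suc i) = t ^ i / fact i"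
        by (simp del: of_nat_Suc)
      then show "f' (Suc i) t h = h *\<^sub>R B (f i t)"
        by (simp add: f'_def f_def linear_simps(5)[OF B] del: fact_Suc)
    qed
    finally show ?thesis by (simp add: linear_sum[OF bounded_linear.linear[OF B]])
  qed
  have "\<exists>g. \<forall>s\<in>D. (\<lambda>n. f n s) sums g s \<and> (g has_derivative (\<lambda>h. h *\<^sub>R B (exp_op B s x))) (at s within D)"
  proof (rule has_derivative_series[OF D(1) _ _ D(3)])
    show "(f n has_derivative f' n s) (at s within D)" if "s \<in> D" for n s
    proof -
      have "((\<lambda>t. t ^ n / fact n) has_real_derivative (real n * s ^ (n - 1) / fact n)) (at s within D)"
        by (auto intro!: derivative_eq_intros)
      then have "((\<lambda>t. t ^ n / fact n) has_vector_derivative (real n * s ^ (n - 1) / fact n)) (at s within D)"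
        by (simp add: has_real_derivative_iff_has_vector_derivative)
      from bounded_linear.has_vector_derivative[OF bounded_linear_scaleR_left[of "(B ^^ n) x"] this]
      show ?thesis unfolding f_def[abs_def] f'_def[abs_def] has_vector_derivative_def by simp
    qed
    show "(\<lambda>n. f n t) sums exp_op B t x"
      unfolding exp_op_def f_def by (intro summable_sums summable_exp_op B)
    fix e :: real assume e: "e > 0"
    have "\<forall>\<^sub>F m in sequentially. \<forall>s\<in>D. \<forall>h. norm ((\<Sum>i<Suc m. f' i s h) - h *\<^sub>R B (exp_op B s x)) \<le> e * norm h"
      using uniform_limitD[OF unif divide_pos_pos[OF e K(1)]]
    proof eventually_elim
      case (elim m)
      show ?case
      proof (intro ballI allI)
        fix s h assume "s \<in> D"
        with elim have "norm ((\<Sum>i<m. f i s) - exp_op B s x) < e / K" by (auto simp: dist_norm)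
        then have "norm (B ((\<Sum>i<m. f i s) - exp_op B s x)) \<le> e"
          using K(2)[of "(\<Sum>i<m. f i s) - exp_op B s x"] K(1) by (simp add: field_simps)
        then show "norm ((\<Sum>i<Suc m. f' i s h) - h *\<^sub>R B (exp_op B s x)) \<le> e * norm h"
          unfolding f'_sum by (simp add: linear_simps(2)[OF B] mult.commute[of e] mult_left_mono flip: scaleR_diff_right)
      qed
    qed
    then show "\<forall>\<^sub>F n in sequentially. \<forall>s\<in>D. \<forall>h. norm ((\<Sum>i<n. f' i s h) - h *\<^sub>R B (exp_op B s x)) \<le> e * norm h"
      by (subst eventually_sequentially_Suc[symmetric])
  qed
  then obtain g where g: "\<And>s. s \<in> D \<Longrightarrow> (\<lambda>n. f n s) sums g s"
    "\<And>s. s \<in> D \<Longrightarrow> (g has_derivative (\<lambda>h. h *\<^sub>R B (exp_op B s x))) (at s within D)" by blast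
  have "g s = exp_op B s x" if "s \<in> D" for s
    using sums_unique[OF g(1)[OF that]] by (simp add: exp_op_def f_def)
  then have "((\<lambda>t. exp_op B t x) has_derivative (\<lambda>h. h *\<^sub>R B (exp_op B t x))) (at t within D)"
    using D(3) by (intro has_derivative_transform[OF _ _ g(2)]) auto
  then have "((\<lambda>t. exp_op B t x) has_vector_derivative B (exp_op B t x)) (at t)"
    using at_within_open[OF D(3,2)] by (simp add: has_vector_derivative_def)
  then show ?thesis by (rule has_vector_derivative_at_within)
qed

text \<open>Along the trajectory \<open>u\<close> half the derivative of the squared norm is
  \<open>u \<bullet> B u\<close>, which is nonpositive.\<close>

lemma exp_op_contraction:
  fixes B :: "'a \<Rightarrow> 'a::{real_inner, banach}"
  assumes B: "bounded_linear B" and diss: "\<And>x. x \<bullet> B x \<le> 0" and t: "t \<ge> 0"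
  shows "norm (exp_op B t x) \<le> norm x"
  using norm_le_initial_plus_linear[OF exp_op_has_vector_derivative[OF B], of t x 0 t] diss t by simp

text \<open>Because \<open>B\<close> and \<open>C\<close> commute, the difference \<open>v\<close>
  solves \<open>v' = B v + exp_op C s (B x - C x)\<close>; dissipativity discards the first term and
  contractivity bounds the second. This estimate makes the exponentials of the Yosida approximations
  Cauchy on the domain.\<close>

lemma exp_op_diff_le:
  fixes B :: "'a \<Rightarrow> 'a::{real_inner, banach}"
  assumes B: "bounded_linear B" "\<And>x. x \<bullet> B x \<le> 0"
    and C: "bounded_linear C" "\<And>x. x \<bullet> C x \<le> 0"
    and comm: "\<And>x. B (C x) = C (B x)" and t: "t \<ge> 0"
  shows "norm (exp_op B t x - exp_op C t x) \<le> norm (B x - C x) * t"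
proof -
  define v where "v s = exp_op B s x - exp_op C s x" for s
  have "norm (v t) \<le> norm (v 0) + norm (B x - C x) * t"
  proof (rule norm_le_initial_plus_linear)
    show "(v has_vector_derivative (B (exp_op B s x) - C (exp_op C s x))) (at s within {0..t})" for s
      unfolding v_def[abs_def]
      by (intro has_vector_derivative_diff exp_op_has_vector_derivative B C)
    fix s assume "s \<in> {0..t}"
    then have s: "s \<ge> 0" by simp
    have "B (exp_op C s x) - C (exp_op C s x) = exp_op C s (B x - C x)"
      using exp_op_commute[OF C(1) B(1) comm] exp_op_commute[OF C(1) C(1) refl]
        linear_diff[OF linear_exp_op[OF C(1)]] by simp
    then have eq: "B (exp_op B s x) - C (exp_op C s x) = B (v s) + exp_op C s (B x - C x)"
      by (simp add: v_def linear_simps(2)[OF B(1)] algebra_simps)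
    have "v s \<bullet> exp_op C s (B x - C x) \<le> norm (v s) * norm (B x - C x)"
      using norm_cauchy_schwarz[of "v s"] exp_op_contraction[OF C s, of "B x - C x"]
      by (meson mult_left_mono norm_ge_zero order_trans)
    then show "v s \<bullet> (B (exp_op B s x) - C (exp_op C s x)) \<le> norm (B x - C x) * norm (v s)"
      unfolding eq using B(2)[of "v s"] by (simp add: inner_add_right mult.commute)
  qed (use t in auto)
  then show ?thesis by (simp add: v_def)
qed

section \<open>Integration over intervals and Fubini on a triangle\<close>

lemma set_integrable_continuous_on_interval:
  fixes f :: "real \<Rightarrow> 'a::{banach, second_countable_topology}"
  assumes "continuous_on {a..b} f"
  shows "set_integrable lebesgue {a..b} f"
  using borel_integrable_atLeastAtMost'[OF assms] borel_measurable_integrable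
  unfolding set_integrable_def by (subst integrable_completion) blast+

lemma set_integral_bounded_linear:
  fixes f :: "real \<Rightarrow> 'a::{banach, second_countable_topology}"
    and L :: "'a \<Rightarrow> 'b::{banach, second_countable_topology}"
  assumes "bounded_linear L" "set_integrable M S f"
  shows "(LINT x:S|M. L (f x)) = L (LINT x:S|M. f x)"
  using integral_bounded_linear[OF assms(1) assms(2)[unfolded set_integrable_def]]
  by (simp add: set_lebesgue_integral_def linear_simps(5)[OF assms(1)])

lemma set_integrable_bounded_linear:
  fixes f :: "real \<Rightarrow> 'a::{banach, second_countable_topology}"
    and L :: "'a \<Rightarrow> 'b::{banach, second_countable_topology}"
  assumes "bounded_linear L" "set_integrable M S f"
  shows "set_integrable M S (\<lambda>x. L (f x))"
  using integrable_bounded_linear[OF assms(1) assms(2)[unfolded set_integrable_def]]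
  by (simp add: set_integrable_def linear_simps(5)[OF assms(1)])

text \<open>Pairing with an arbitrary vector reduces the vector-valued integral to a real one, for
  which the Lebesgue and the gauge integral coincide.\<close>

lemma set_integral_FTC:
  fixes F :: "real \<Rightarrow> 'a::{real_inner, banach, second_countable_topology}"
  assumes "a \<le> b"
    and F: "\<And>x. x \<in> {a..b} \<Longrightarrow> (F has_vector_derivative f x) (at x within {a..b})"
    and f: "continuous_on {a..b} f"
  shows "(LINT x:{a..b}|lebesgue. f x) = F b - F a"
proof (rule vector_eq_ldot[THEN iffD1, rule_format])
  fix v
  have "(LINT x:{a..b}|lebesgue. f x) \<bullet> v = (LINT x:{a..b}|lebesgue. f x \<bullet> v)"
    using set_integral_bounded_linear[OF bounded_linear_inner_left set_integrable_continuous_on_interval[OF f]]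
    by simp
  also have "\<dots> = integral {a..b} (\<lambda>x. f x \<bullet> v)"
    using f by (intro set_lebesgue_integral_eq_integral set_integrable_continuous_on_interval continuous_intros)
  also have "\<dots> = F b \<bullet> v - F a \<bullet> v"
    using assms by (intro integral_unique fundamental_theorem_of_calculus
        bounded_linear.has_vector_derivative[OF bounded_linear_inner_left]) auto
  finally show "v \<bullet> (LINT x:{a..b}|lebesgue. f x) = v \<bullet> (F b - F a)"
    by (simp add: inner_commute inner_diff_right)
qed

lemma has_vector_derivative_set_integral:
  fixes f :: "real \<Rightarrow> 'a::{real_inner, banach, second_countable_topology}"
  assumes f: "continuous_on {a..b} f" and t: "t \<in> {a..b}"
  shows "((\<lambda>u. LINT x:{a..u}|lebesgue. f x) has_vector_derivative f t) (at t within {a..b})"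
proof -
  have d: "((\<lambda>u. integral {a..u} f) has_vector_derivative f s) (at s within {a..b})" if "s \<in> {a..b}" for s
    using integral_has_vector_derivative[OF f] that by auto
  have "(LINT x:{a..u}|lebesgue. f x) = integral {a..u} f" if u: "u \<in> {a..b}" for u
  proof -
    have "(LINT x:{a..u}|lebesgue. f x) = integral {a..u} f - integral {a..a} f"
      using u by (intro set_integral_FTC has_vector_derivative_within_subset[OF d] continuous_on_subset[OF f]) auto
    then show ?thesis by simp
  qed
  with d[OF t] show ?thesis
    using t by (subst has_vector_derivative_cong_ev) auto
qed

lemma sigma_finite_lebesgue: "sigma_finite_measure (lebesgue :: real measure)"
proof
  let ?A = "range (\<lambda>n::nat. {- real n..real n})"
  have "\<Union> ?A = (UNIV :: real set)"
  proof safe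
    fix x :: real
    obtain n :: nat where "\<bar>x\<bar> < real n" using reals_Archimedean2 by blast
    then show "x \<in> \<Union> ?A" by (intro UN_I[of n]) auto
  qed auto
  then show "\<exists>A. countable A \<and> A \<subseteq> sets (lebesgue :: real measure) \<and> \<Union>A = space lebesgue \<and>
      (\<forall>a\<in>A. emeasure lebesgue a \<noteq> \<infinity>)"
    by (intro exI[of _ ?A]) auto
qed

interpretation lebesgue_pair: pair_sigma_finite "lebesgue :: real measure" "lebesgue :: real measure"
  by (simp add: pair_sigma_finite_def sigma_finite_lebesgue)

text \<open>Fubini on the triangle \<open>0 \<le> r \<le> s \<le> t\<close>. The majorant depends on
  \<open>r\<close> alone, so its product with the indicator of a bounded interval in
  \<open>s\<close> is integrable on the plane.\<close>

lemma set_integral_triangle_swap: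
  fixes k :: "real \<Rightarrow> real \<Rightarrow> 'a::{banach, second_countable_topology}"
  assumes k: "(\<lambda>(s, r). k s r) \<in> borel_measurable (lebesgue \<Otimes>\<^sub>M lebesgue)"
    and \<psi>: "integrable lebesgue \<psi>" and bound: "\<And>s r. norm (k s r) \<le> \<psi> r"
  shows "(LINT s:{0..t}|lebesgue. LINT r:{0..s}|lebesgue. k s r)
    = (LINT r:{0..t}|lebesgue. LINT s:{r..t}|lebesgue. k s r)"
proof -
  define f where "f s r = indicator {0..t} s *\<^sub>R indicator {0..s} r *\<^sub>R k s r" for s r
  \<comment> \<open>The same triangle sliced by \<open>r\<close> instead of \<open>s\<close>; this
    is where the limits of integration change.\<close>
  have f_eq: "f s r = indicator {0..t} r *\<^sub>R indicator {r..t} s *\<^sub>R k s r" for s r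
    by (auto simp: f_def indicator_def)
  have [measurable]: "(\<lambda>p. k (fst p) (snd p)) \<in> borel_measurable (lebesgue \<Otimes>\<^sub>M lebesgue)"
    using k by (simp add: case_prod_beta')
  have [measurable]: "fst \<in> borel_measurable (lebesgue \<Otimes>\<^sub>M (lebesgue :: real measure))"
      "snd \<in> borel_measurable ((lebesgue :: real measure) \<Otimes>\<^sub>M lebesgue)"
    by (auto intro!: measurable_compose[OF measurable_fst] measurable_compose[OF measurable_snd]
        measurable_completion)
  have "(\<lambda>p. f (fst p) (snd p)) = (\<lambda>p. if 0 \<le> fst p \<and> fst p \<le> t \<and> 0 \<le> snd p \<and> snd p \<le> fst p
      then k (fst p) (snd p) else 0)"
    by (auto simp: f_def indicator_def fun_eq_iff)
  also have "\<dots> \<in> borel_measurable (lebesgue \<Otimes>\<^sub>M lebesgue)" by measurable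
  finally have meas: "(\<lambda>p. f (fst p) (snd p)) \<in> borel_measurable (lebesgue \<Otimes>\<^sub>M lebesgue)" .
  have int: "integrable lebesgue (indicator {0..t} :: real \<Rightarrow> real)"
    by (cases "0 \<le> t") auto
  have "integrable (lebesgue \<Otimes>\<^sub>M lebesgue) (\<lambda>p. indicator {0..t} (fst p) * \<psi> (snd p))"
  proof (rule lebesgue_pair.Fubini_integrable)
    show "(\<lambda>p. indicator {0..t} (fst p) * \<psi> (snd p)) \<in> borel_measurable (lebesgue \<Otimes>\<^sub>M lebesgue)"
      using measurable_compose[OF measurable_snd borel_measurable_integrable[OF \<psi>]]
        measurable_compose[OF measurable_fst borel_measurable_integrable[OF int]]
      by (intro borel_measurable_times) auto
    show "integrable lebesgue (\<lambda>x. \<integral>y. norm (indicator {0..t} (fst (x, y)) * \<psi> (snd (x, y))) \<partial>lebesgue)"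
      using int by (simp add: abs_mult)
    show "AE x in lebesgue. integrable lebesgue (\<lambda>y. indicator {0..t} (fst (x, y)) * \<psi> (snd (x, y)))"
      using \<psi> by simp
  qed
  then have "integrable (lebesgue \<Otimes>\<^sub>M lebesgue) (\<lambda>p. f (fst p) (snd p))"
  proof (rule Bochner_Integration.integrable_bound[OF _ meas])
    have "norm (f s r) \<le> norm (indicator {0..t} s * \<psi> r)" for s r
      using bound[of s r] by (auto simp: f_def indicator_def)
    then show "AE p in lebesgue \<Otimes>\<^sub>M lebesgue. norm (f (fst p) (snd p)) \<le> norm (indicator {0..t} (fst p) * \<psi> (snd p))"
      by simp
  qed
  then have "(\<integral>r. (\<integral>s. f s r \<partial>lebesgue) \<partial>lebesgue) = (\<integral>s. (\<integral>r. f s r \<partial>lebesgue) \<partial>lebesgue)"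
    by (intro lebesgue_pair.Fubini_integral) (simp add: case_prod_beta')
  moreover have "(\<integral>s. (\<integral>r. f s r \<partial>lebesgue) \<partial>lebesgue) = (LINT s:{0..t}|lebesgue. LINT r:{0..s}|lebesgue. k s r)"
    by (simp add: f_def set_lebesgue_integral_def del: scaleR_scaleR)
  moreover have "(\<integral>r. (\<integral>s. f s r \<partial>lebesgue) \<partial>lebesgue) = (LINT r:{0..t}|lebesgue. LINT s:{r..t}|lebesgue. k s r)"
    by (simp add: f_eq set_lebesgue_integral_def del: scaleR_scaleR)
  ultimately show ?thesis by simp
qed

section \<open>Contraction families and their convolutions\<close>

text \<open>These are the properties that the convolution estimates use, shared by the exponentials
  \<open>exp_op B\<close> of dissipative operators and by their strong limit.\<close>

definition contraction_family :: "(real \<Rightarrow> 'a \<Rightarrow> 'a::real_normed_vector) \<Rightarrow> bool" where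
  "contraction_family S \<longleftrightarrow> (\<forall>t\<ge>0. linear (S t) \<and> (\<forall>x. norm (S t x) \<le> norm x)) \<and>
     (\<forall>x. continuous_on {0..} (\<lambda>t. S t x))"

text \<open>Strong continuity in time and the uniform bound in space combine to joint continuity.
  Clamping time with \<open>max 0\<close> gives a function on the whole product space, from which
  Borel measurability of the convolution integrands follows.\<close>

lemma contraction_family_continuous:
  fixes S :: "real \<Rightarrow> 'a \<Rightarrow> 'a::real_normed_vector"
  assumes S: "contraction_family S"
  shows "continuous_on UNIV (\<lambda>p. S (max 0 (fst p)) (snd p))"
  unfolding continuous_on_sequentially
proof (intro ballI allI impI, elim conjE)
  fix p and q :: "nat \<Rightarrow> real \<times> 'a" assume q: "q \<longlonglongrightarrow> p"
  let ?\<tau> = "\<lambda>n. max 0 (fst (q n))"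
  have \<tau>: "?\<tau> \<longlonglongrightarrow> max 0 (fst p)" using q by (intro tendsto_intros)
  have "continuous_on {0..} (\<lambda>t. S t (snd p))" using S by (simp add: contraction_family_def)
  then have "(\<lambda>n. S (?\<tau> n) (snd p)) \<longlonglongrightarrow> S (max 0 (fst p)) (snd p)"
    by (rule continuous_on_tendsto_compose[OF _ \<tau>]) auto
  moreover have "(\<lambda>n. S (?\<tau> n) (snd (q n) - snd p)) \<longlonglongrightarrow> 0"
  proof (rule Lim_null_comparison)
    show "\<forall>\<^sub>F n in sequentially. norm (S (?\<tau> n) (snd (q n) - snd p)) \<le> norm (snd (q n) - snd p)"
      using S by (simp add: contraction_family_def)
    show "(\<lambda>n. norm (snd (q n) - snd p)) \<longlonglongrightarrow> 0"
      using tendsto_snd[OF q] by (simp add: LIM_zero_iff tendsto_norm_zero)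
  qed
  ultimately have "(\<lambda>n. S (?\<tau> n) (snd p) + S (?\<tau> n) (snd (q n) - snd p)) \<longlonglongrightarrow> S (max 0 (fst p)) (snd p) + 0"
    by (rule tendsto_add)
  moreover have "S (?\<tau> n) (snd p) + S (?\<tau> n) (snd (q n) - snd p) = S (?\<tau> n) (snd (q n))" for n
    using S by (simp add: contraction_family_def linear_diff)
  ultimately show "((\<lambda>p. S (max 0 (fst p)) (snd p)) \<circ> q) \<longlonglongrightarrow> S (max 0 (fst p)) (snd p)"
    by (simp add: o_def)
qed

lemma contraction_family_measurable:
  fixes S :: "real \<Rightarrow> 'a \<Rightarrow> 'a::{real_normed_vector, second_countable_topology}"
  assumes S: "contraction_family S" and "\<tau> \<in> borel_measurable N" "H \<in> borel_measurable N"
  shows "(\<lambda>\<omega>. S (max 0 (\<tau> \<omega>)) (H \<omega>)) \<in> borel_measurable N"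
  using measurable_compose[OF borel_measurable_Pair[OF assms(2,3)]
      borel_measurable_continuous_onI[OF contraction_family_continuous[OF S]]] by simp

definition convolution :: "(real \<Rightarrow> 'a \<Rightarrow> 'a) \<Rightarrow> (real \<Rightarrow> 'a) \<Rightarrow> real \<Rightarrow> 'a::{banach, second_countable_topology}" where
  "convolution S H t = (LINT s:{0..t}|lebesgue. S (t - s) (H s))"

context
  fixes S :: "real \<Rightarrow> 'a \<Rightarrow> 'a::{banach, second_countable_topology}" and H :: "real \<Rightarrow> 'a" and T :: real
  assumes S: "contraction_family S" and H: "set_integrable lebesgue {0..T} H"
begin

text \<open>The integrand becomes a function on the whole line in which \<open>H\<close> is cut off
  to \<open>{0..T}\<close>, so that one integrable majorant serves every \<open>t\<close>.\<close>

lemma convolution_alt: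
  assumes "t \<in> {0..T}"
  shows "convolution S H t = (\<integral>s. indicator {0..t} s *\<^sub>R S (max 0 (t - s)) (indicator {0..T} s *\<^sub>R H s) \<partial>lebesgue)"
  unfolding convolution_def set_lebesgue_integral_def
  using assms by (intro Bochner_Integration.integral_cong) (auto simp: indicator_def)

lemma convolution_integrand_bound:
  "norm (indicator {0..t} s *\<^sub>R S (max 0 (t - s)) (indicator {0..T} s *\<^sub>R H s)) \<le> norm (indicator {0..T} s *\<^sub>R H s)"
proof -
  have "norm (S (max 0 (t - s)) (indicator {0..T} s *\<^sub>R H s)) \<le> norm (indicator {0..T} s *\<^sub>R H s)"
    using S by (simp add: contraction_family_def del: norm_scaleR)
  then show ?thesis by (auto simp: indicator_def)
qed

lemma convolution_integrand_measurable:
  "(\<lambda>s. indicator {0..t} s *\<^sub>R S (max 0 (t - s)) (indicator {0..T} s *\<^sub>R H s)) \<in> borel_measurable lebesgue"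
  using borel_measurable_integrable[OF H[unfolded set_integrable_def]]
  by (intro borel_measurable_scaleR[where g = "\<lambda>s. S (max 0 (t - s)) (indicator {0..T} s *\<^sub>R H s)"]
      contraction_family_measurable[OF S]) (auto intro: measurable_completion)

lemma convolution_integrand_integrable:
  "integrable lebesgue (\<lambda>s. indicator {0..t} s *\<^sub>R S (max 0 (t - s)) (indicator {0..T} s *\<^sub>R H s))"
  by (rule Bochner_Integration.integrable_bound[OF H[unfolded set_integrable_def]
        convolution_integrand_measurable AE_I2[OF convolution_integrand_bound]])

lemma convolution_norm_le:
  assumes "t \<in> {0..T}"
  shows "norm (convolution S H t) \<le> (\<integral>s. norm (indicator {0..T} s *\<^sub>R H s) \<partial>lebesgue)"
  unfolding convolution_alt[OF assms]
  by (rule order_trans[OF integral_norm_bound integral_mono[OF integrable_norm[OF convolution_integrand_integrable]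
        integrable_norm[OF H[unfolded set_integrable_def]] convolution_integrand_bound]])

text \<open>Dominated convergence. The moving indicator converges at every \<open>s\<close> except
  possibly \<open>s = t\<close>, which is a null set.\<close>

lemma continuous_on_convolution: "continuous_on {0..T} (convolution S H)"
  unfolding continuous_on_sequentially
proof (intro ballI allI impI, elim conjE)
  fix t and \<tau> :: "nat \<Rightarrow> real" assume t: "t \<in> {0..T}" and \<tau>: "\<forall>n. \<tau> n \<in> {0..T}" "\<tau> \<longlonglongrightarrow> t"
  let ?f = "\<lambda>t s. indicator {0..t} s *\<^sub>R S (max 0 (t - s)) (indicator {0..T} s *\<^sub>R H s)"
  have "(\<lambda>n. \<integral>s. ?f (\<tau> n) s \<partial>lebesgue) \<longlonglongrightarrow> (\<integral>s. ?f t s \<partial>lebesgue)"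
  proof (rule integral_dominated_convergence[where w = "\<lambda>s. norm (indicator {0..T} s *\<^sub>R H s)"])
    show "integrable lebesgue (\<lambda>s. norm (indicator {0..T} s *\<^sub>R H s))"
      using H unfolding set_integrable_def by (rule integrable_norm)
    have "(\<lambda>n. ?f (\<tau> n) s) \<longlonglongrightarrow> ?f t s" if "s \<noteq> t" for s
    proof -
      have "(\<lambda>n. S (max 0 (\<tau> n - s)) (indicator {0..T} s *\<^sub>R H s)) \<longlonglongrightarrow> S (max 0 (t - s)) (indicator {0..T} s *\<^sub>R H s)"
      proof -
        have "(\<lambda>n. (\<tau> n - s, indicator {0..T} s *\<^sub>R H s)) \<longlonglongrightarrow> (t - s, indicator {0..T} s *\<^sub>R H s)"
          by (intro tendsto_intros \<tau>(2))
        from continuous_on_tendsto_compose[OF contraction_family_continuous[OF S] this] show ?thesis by simp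
      qed
      moreover have "(\<lambda>n. indicator {0..\<tau> n} s :: real) \<longlonglongrightarrow> indicator {0..t} s"
      proof (cases "s < t")
        case True
        have "\<forall>\<^sub>F n in sequentially. indicator {0..\<tau> n} s = (indicator {0..t} s :: real)"
          using order_tendstoD(1)[OF \<tau>(2) True] by eventually_elim (use True in \<open>auto simp: indicator_def\<close>)
        then show ?thesis by (rule tendsto_eventually)
      next
        case False
        with that have "t < s" by simp
        have "\<forall>\<^sub>F n in sequentially. indicator {0..\<tau> n} s = (indicator {0..t} s :: real)"
          using order_tendstoD(2)[OF \<tau>(2) \<open>t < s\<close>] by eventually_elim (use \<open>t < s\<close> in \<open>auto simp: indicator_def\<close>)
        then show ?thesis by (rule tendsto_eventually)
      qed
      ultimately show ?thesis by (intro tendsto_scaleR)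
    qed
    moreover have "AE s in lebesgue. s \<noteq> t"
      by (rule AE_completion) (rule AE_lborel_singleton)
    ultimately show "AE s in lebesgue. (\<lambda>n. ?f (\<tau> n) s) \<longlonglongrightarrow> ?f t s" by (auto elim: AE_mp)
  qed (rule convolution_integrand_measurable convolution_integrand_measurable AE_I2 convolution_integrand_bound)+
  then show "(convolution S H \<circ> \<tau>) \<longlonglongrightarrow> convolution S H t"
    using t \<tau>(1) by (simp add: o_def convolution_alt)
qed

end

lemma convolution_tendsto:
  fixes H :: "real \<Rightarrow> 'a::{banach, second_countable_topology}"
  assumes E: "\<And>n. contraction_family (E n)" and S: "contraction_family S"
    and H: "set_integrable lebesgue {0..T} H"
    and lim: "\<And>t x. t \<in> {0..T} \<Longrightarrow> (\<lambda>n. E n t x) \<longlonglongrightarrow> S t x" and t: "t \<in> {0..T}"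
  shows "(\<lambda>n. convolution (E n) H t) \<longlonglongrightarrow> convolution S H t"
  unfolding convolution_alt[OF S H t] convolution_alt[OF E H t]
proof (rule integral_dominated_convergence[where w = "\<lambda>s. norm (indicator {0..T} s *\<^sub>R H s)"])
  show "integrable lebesgue (\<lambda>s. norm (indicator {0..T} s *\<^sub>R H s))"
    using H unfolding set_integrable_def by (rule integrable_norm)
  have "(\<lambda>n. indicator {0..t} s *\<^sub>R E n (max 0 (t - s)) (indicator {0..T} s *\<^sub>R H s)) \<longlonglongrightarrow>
      indicator {0..t} s *\<^sub>R S (max 0 (t - s)) (indicator {0..T} s *\<^sub>R H s)" for s
    by (cases "s \<in> {0..t}") (use t in \<open>auto intro!: tendsto_scaleR lim simp: max_def\<close>)
  then show "AE s in lebesgue. (\<lambda>n. indicator {0..t} s *\<^sub>R E n (max 0 (t - s)) (indicator {0..T} s *\<^sub>R H s)) \<longlonglongrightarrow>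
      indicator {0..t} s *\<^sub>R S (max 0 (t - s)) (indicator {0..T} s *\<^sub>R H s)" by simp
qed (rule convolution_integrand_measurable[OF S H] convolution_integrand_measurable[OF E H] AE_I2
    convolution_integrand_bound[OF E H])+

lemma contraction_family_exp_op:
  fixes B :: "'a \<Rightarrow> 'a::{real_inner, banach}"
  assumes B: "bounded_linear B" and diss: "\<And>x. x \<bullet> B x \<le> 0"
  shows "contraction_family (exp_op B)"
  unfolding contraction_family_def
  using linear_exp_op[OF B] exp_op_contraction[OF B diss]
  by (auto intro!: continuous_on_vector_derivative[OF exp_op_has_vector_derivative[OF B]])

lemma exp_op_set_integral:
  fixes B :: "'a \<Rightarrow> 'a::{real_inner, banach, second_countable_topology}"
  assumes B: "bounded_linear B" and "r \<le> t"
  shows "(LINT s:{r..t}|lebesgue. B (exp_op B (s - r) x)) = exp_op B (t - r) x - x"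
proof -
  have d: "((\<lambda>s. exp_op B (s - r) x) has_vector_derivative B (exp_op B (s - r) x)) (at s within {r..t})" for s
  proof -
    have "((\<lambda>s. s - r) has_vector_derivative 1) (at s within {r..t})"
      by (auto intro!: derivative_eq_intros)
    from vector_diff_chain_within[OF this exp_op_has_vector_derivative[OF B]]
    show ?thesis by (simp add: o_def)
  qed
  have "(LINT s:{r..t}|lebesgue. B (exp_op B (s - r) x)) = exp_op B (t - r) x - exp_op B (r - r) x"
    by (rule set_integral_FTC[OF assms(2) d])
      (intro bounded_linear.continuous_on[OF B] continuous_on_vector_derivative[OF d])
  then show ?thesis by simp
qed

text \<open>The integrated form of \<open>y' = B y + H\<close> for the convolution \<open>y\<close>:
  \<open>B\<close> moves under the integrals, the order of integration is exchanged, and the inner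
  integral of \<open>B (exp_op B (s - r) x)\<close> over \<open>s\<close> is exact.\<close>

lemma integral_convolution_exp_op:
  fixes B :: "'a \<Rightarrow> 'a::{real_inner, banach, second_countable_topology}"
  assumes B: "bounded_linear B" and diss: "\<And>x. x \<bullet> B x \<le> 0"
    and H: "set_integrable lebesgue {0..T} H" and t: "t \<in> {0..T}"
  shows "B (LINT s:{0..t}|lebesgue. convolution (exp_op B) H s)
    = convolution (exp_op B) H t - (LINT s:{0..t}|lebesgue. H s)"
proof -
  note E = contraction_family_exp_op[OF B diss]
  define H0 where "H0 s = indicator {0..T} s *\<^sub>R H s" for s
  \<comment> \<open>\<open>max 0\<close> and the cut-off \<open>H0\<close> give a kernel that is
    measurable and dominated on the whole plane, as the exchange of integrals requires.\<close>
  define k where "k s r = B (exp_op B (max 0 (s - r)) (H0 r))" for s r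
  have H0: "integrable lebesgue H0" using H by (simp add: set_integrable_def H0_def[abs_def])
  obtain K where K: "\<And>x. norm (B x) \<le> norm x * K" "K > 0"
    using bounded_linear.pos_bounded[OF B] by auto
  have int: "set_integrable lebesgue {0..t} (convolution (exp_op B) H)"
    using t by (intro set_integrable_continuous_on_interval continuous_on_subset[OF continuous_on_convolution[OF E H]]) auto
  have inner_int: "set_integrable lebesgue {0..s} (\<lambda>r. exp_op B (s - r) (H r))" if s: "s \<in> {0..T}" for s
  proof -
    have "integrable lebesgue (\<lambda>r. indicator {0..s} r *\<^sub>R exp_op B (max 0 (s - r)) (indicator {0..T} r *\<^sub>R H r))"
      by (rule convolution_integrand_integrable[OF E H])
    then show ?thesis
      unfolding set_integrable_def
      by (rule Bochner_Integration.integrable_cong[THEN iffD1, rotated -1]) (use s in \<open>auto simp: indicator_def\<close>)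
  qed
  have "B (LINT s:{0..t}|lebesgue. convolution (exp_op B) H s) = (LINT s:{0..t}|lebesgue. B (convolution (exp_op B) H s))"
    by (rule set_integral_bounded_linear[OF B int, symmetric])
  also have "\<dots> = (LINT s:{0..t}|lebesgue. LINT r:{0..s}|lebesgue. k s r)"
  proof (rule set_lebesgue_integral_cong)
    show "\<forall>s. s \<in> {0..t} \<longrightarrow> B (convolution (exp_op B) H s) = (LINT r:{0..s}|lebesgue. k s r)"
    proof (intro allI impI)
      fix s assume "s \<in> {0..t}"
      then have s: "s \<in> {0..T}" using t by auto
      have "B (convolution (exp_op B) H s) = (LINT r:{0..s}|lebesgue. B (exp_op B (s - r) (H r)))"
        unfolding convolution_def by (rule set_integral_bounded_linear[OF B inner_int[OF s], symmetric])
      also have "\<dots> = (LINT r:{0..s}|lebesgue. k s r)"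
        by (rule set_lebesgue_integral_cong) (use s in \<open>auto simp: k_def H0_def max_def\<close>)
      finally show "B (convolution (exp_op B) H s) = (LINT r:{0..s}|lebesgue. k s r)" .
    qed
  qed auto
  also have "\<dots> = (LINT r:{0..t}|lebesgue. LINT s:{r..t}|lebesgue. k s r)"
  proof (rule set_integral_triangle_swap)
    show "integrable lebesgue (\<lambda>r. norm (H0 r) * K)" using H0 by auto
    show "norm (k s r) \<le> norm (H0 r) * K" for s r
    proof -
      have "norm (k s r) \<le> norm (exp_op B (max 0 (s - r)) (H0 r)) * K" unfolding k_def by (rule K)
      also have "\<dots> \<le> norm (H0 r) * K"
        using K by (intro mult_right_mono exp_op_contraction[OF B diss]) auto
      finally show ?thesis .
    qed
    have "fst \<in> borel_measurable (lebesgue \<Otimes>\<^sub>M (lebesgue :: real measure))"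
      "snd \<in> borel_measurable ((lebesgue :: real measure) \<Otimes>\<^sub>M lebesgue)"
      by (auto intro!: measurable_compose[OF measurable_fst] measurable_compose[OF measurable_snd]
          measurable_completion)
    then have "(\<lambda>p. fst p - snd p) \<in> borel_measurable ((lebesgue :: real measure) \<Otimes>\<^sub>M lebesgue)"
      by (rule borel_measurable_diff)
    from contraction_family_measurable[OF E this measurable_compose[OF measurable_snd borel_measurable_integrable[OF H0]]]
    have "(\<lambda>p. B (exp_op B (max 0 (fst p - snd p)) (H0 (snd p)))) \<in> borel_measurable ((lebesgue :: real measure) \<Otimes>\<^sub>M lebesgue)"
      by (rule measurable_compose) (rule borel_measurable_continuous_onI[OF linear_continuous_on[OF B]])
    then show "(\<lambda>(s, r). k s r) \<in> borel_measurable (lebesgue \<Otimes>\<^sub>M lebesgue)"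
      by (simp add: k_def case_prod_beta')
  qed
  also have "\<dots> = (LINT r:{0..t}|lebesgue. exp_op B (t - r) (H r) - H r)"
  proof (rule set_lebesgue_integral_cong)
    show "\<forall>r. r \<in> {0..t} \<longrightarrow> (LINT s:{r..t}|lebesgue. k s r) = exp_op B (t - r) (H r) - H r"
    proof (intro allI impI)
      fix r assume r: "r \<in> {0..t}"
      have "(LINT s:{r..t}|lebesgue. k s r) = (LINT s:{r..t}|lebesgue. B (exp_op B (s - r) (H r)))"
        by (rule set_lebesgue_integral_cong) (use r t in \<open>auto simp: k_def H0_def max_def\<close>)
      then show "(LINT s:{r..t}|lebesgue. k s r) = exp_op B (t - r) (H r) - H r"
        using r exp_op_set_integral[OF B, of r t] by simp
    qed
  qed auto
  also have "\<dots> = convolution (exp_op B) H t - (LINT s:{0..t}|lebesgue. H s)"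
    unfolding convolution_def using t
    by (intro set_integral_diff inner_int set_integrable_subset[OF H]) auto
  finally show ?thesis .
qed

section \<open>Dissipative operators and the inhomogeneous evolution equation\<close>

lemma norm_telescope_le:
  fixes a b c d :: "'a::real_normed_vector"
  shows "norm (a - d) \<le> norm (a - b) + norm (b - c) + norm (d - c)"
  using norm_triangle_ineq[of "a - b" "b - d"] norm_triangle_ineq[of "b - c" "c - d"]
  by (simp add: norm_minus_commute[of d c])

lemma inner_self_nonpos_imp_zero: "x \<bullet> x \<le> 0 \<Longrightarrow> x = (0::'a::real_inner)"
  by (metis inner_eq_zero_iff inner_ge_zero order_antisym)

lemma subspace_closure:
  fixes S :: "'a::real_normed_vector set"
  assumes S: "subspace S"
  shows "subspace (closure S)"
proof (rule subspaceI)
  show "0 \<in> closure S" using subspace_0[OF S] closure_subset by blast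
  fix x y and c :: real assume x: "x \<in> closure S"
  have "(\<lambda>z. c *\<^sub>R z) ` closure S \<subseteq> closure S"
    using subspace_scale[OF S] closure_subset[of S] by (intro image_closure_subset continuous_intros) auto
  then show "c *\<^sub>R x \<in> closure S" using x by blast
  assume "y \<in> closure S"
  moreover have "(\<lambda>z. fst z + snd z) ` closure (S \<times> S) \<subseteq> closure S"
    using subspace_add[OF S] closure_subset[of S] by (intro image_closure_subset continuous_intros) auto
  ultimately show "x + y \<in> closure S" using x unfolding closure_Times by force
qed

text \<open>The operator is given by its graph. The bound \<open>\<omega>\<close> leaves room for bounded perturbations,
  whose resolvents are only constructed for large \<open>l\<close>.\<close>

locale m_dissipative =
  fixes A :: "('a \<times> 'a::{real_inner, banach, second_countable_topology}) set" and \<omega> :: real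
  assumes subspace: "subspace A"
    and dissipative: "(x, y) \<in> A \<Longrightarrow> x \<bullet> y \<le> 0"
    and range: "l > \<omega> \<Longrightarrow> \<exists>x. (x, l *\<^sub>R x - y) \<in> A"
    and single_valued: "(0, y) \<in> A \<Longrightarrow> y = 0"
    and \<omega>: "\<omega> \<ge> 0"
begin

lemma diff_mem: "(x, y) \<in> A \<Longrightarrow> (x', y') \<in> A \<Longrightarrow> (x - x', y - y') \<in> A"
  using subspace_diff[OF subspace, of "(x, y)" "(x', y')"] by simp

lemma add_mem: "(x, y) \<in> A \<Longrightarrow> (x', y') \<in> A \<Longrightarrow> (x + x', y + y') \<in> A"
  using subspace_add[OF subspace, of "(x, y)" "(x', y')"] by simp

lemma scale_mem: "(x, y) \<in> A \<Longrightarrow> (c *\<^sub>R x, c *\<^sub>R y) \<in> A"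
  using subspace_scale[OF subspace, of "(x, y)" c] by simp

definition resolvent :: "real \<Rightarrow> 'a \<Rightarrow> 'a" where
  "resolvent l y = (SOME x. (x, l *\<^sub>R x - y) \<in> A)"

lemma resolvent_mem: "l > \<omega> \<Longrightarrow> (resolvent l y, l *\<^sub>R resolvent l y - y) \<in> A"
  unfolding resolvent_def by (rule someI_ex[OF range])

text \<open>If two preimages differ by \<open>d\<close>, then \<open>(d, l *\<^sub>R d)\<close> lies
  in \<open>A\<close> and dissipativity forces \<open>l * (d \<bullet> d) \<le> 0\<close>. Hence the
  choice in \<open>resolvent\<close> is unambiguous.\<close>

lemma resolvent_eqI:
  assumes l: "l > \<omega>" and x: "(x, l *\<^sub>R x - y) \<in> A"
  shows "resolvent l y = x"
proof -
  let ?d = "resolvent l y - x"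
  have "(?d, l *\<^sub>R ?d) \<in> A"
    using diff_mem[OF resolvent_mem[OF l, of y] x] by (simp add: scaleR_diff_right)
  then have "l * (?d \<bullet> ?d) \<le> 0" using dissipative by fastforce
  moreover have "l > 0" using l \<omega> by simp
  ultimately have "?d \<bullet> ?d \<le> 0" by (simp add: mult_le_0_iff)
  from inner_self_nonpos_imp_zero[OF this] show ?thesis by simp
qed

text \<open>Testing the resolvent equation with its solution \<open>x\<close> gives
  \<open>l * (norm x)\<^sup>2 \<le> x \<bullet> y\<close>; Cauchy-Schwarz does the rest.\<close>

lemma resolvent_norm_le:
  assumes l: "l > \<omega>"
  shows "norm (l *\<^sub>R resolvent l y) \<le> norm y"
proof -
  let ?x = "resolvent l y"
  have "l > 0" using l \<omega> by simp
  have "l * (norm ?x)\<^sup>2 \<le> ?x \<bullet> y"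
    using dissipative[OF resolvent_mem[OF l, of y]] by (simp add: inner_diff_right power2_norm_eq_inner)
  also have "\<dots> \<le> norm ?x * norm y" by (rule norm_cauchy_schwarz)
  finally have "norm ?x * (l * norm ?x) \<le> norm ?x * norm y" by (simp add: power2_eq_square algebra_simps)
  then show ?thesis using \<open>l > 0\<close> by (cases "?x = 0") auto
qed

lemma bounded_linear_resolvent:
  assumes l: "l > \<omega>"
  shows "bounded_linear (resolvent l)"
proof (rule bounded_linear_intro[where K = "1 / l"])
  have "l > 0" using l \<omega> by simp
  show "resolvent l (x + y) = resolvent l x + resolvent l y" for x y
    using add_mem[OF resolvent_mem[OF l, of x] resolvent_mem[OF l, of y]]
    by (intro resolvent_eqI[OF l]) (simp add: algebra_simps)
  show "resolvent l (r *\<^sub>R x) = r *\<^sub>R resolvent l x" for r x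
    using scale_mem[OF resolvent_mem[OF l, of x], of r]
    by (intro resolvent_eqI[OF l]) (simp add: algebra_simps)
  show "norm (resolvent l x) \<le> norm x * (1 / l)" for x
    using resolvent_norm_le[OF l, of x] \<open>l > 0\<close> by (simp add: field_simps)
qed

text \<open>The resolvent equation at \<open>m\<close> with solution \<open>x\<close> is one at
  \<open>l\<close> with right-hand side \<open>y + (l - m) *\<^sub>R x\<close>.\<close>

lemma resolvent_identity:
  assumes l: "l > \<omega>" and m: "m > \<omega>"
  shows "resolvent m y - resolvent l y = (l - m) *\<^sub>R resolvent l (resolvent m y)"
proof -
  let ?x = "resolvent m y"
  have "?x = resolvent l (y + (l - m) *\<^sub>R ?x)"
    using resolvent_mem[OF m, of y] by (intro resolvent_eqI[OF l, symmetric]) (simp add: algebra_simps)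
  then have "?x = resolvent l y + (l - m) *\<^sub>R resolvent l ?x"
    by (simp add: linear_simps[OF bounded_linear_resolvent[OF l]])
  then show ?thesis by (simp add: algebra_simps)
qed

lemma resolvent_commute:
  assumes l: "l > \<omega>" and m: "m > \<omega>"
  shows "resolvent l (resolvent m y) = resolvent m (resolvent l y)"
proof (cases "l = m")
  case False
  have "(l - m) *\<^sub>R resolvent l (resolvent m y) = (l - m) *\<^sub>R resolvent m (resolvent l y)"
    unfolding resolvent_identity[OF l m, symmetric]
    using arg_cong[OF resolvent_identity[OF m l, of y], of uminus] by (simp flip: scaleR_minus_left)
  with False show ?thesis by simp
qed simp

text \<open>For fixed \<open>l\<close> a pair \<open>(x, v)\<close> is in \<open>A\<close> exactly
  when \<open>x = resolvent l (l *\<^sub>R x - v)\<close>, and limits preserve this condition since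
  the resolvent is continuous.\<close>

lemma closed_graph: "closed A"
  unfolding closed_sequential_limits
proof (intro allI impI, elim conjE)
  fix p and q :: "nat \<Rightarrow> 'a \<times> 'a" assume A: "\<forall>n. q n \<in> A" and q: "q \<longlonglongrightarrow> p"
  define l where "l = \<omega> + 1"
  have l: "l > \<omega>" by (simp add: l_def)
  have "resolvent l (l *\<^sub>R fst (q n) - snd (q n)) = fst (q n)" for n
    using A by (intro resolvent_eqI[OF l]) simp
  moreover have "(\<lambda>n. resolvent l (l *\<^sub>R fst (q n) - snd (q n))) \<longlonglongrightarrow> resolvent l (l *\<^sub>R fst p - snd p)"
    using q by (intro bounded_linear.tendsto[OF bounded_linear_resolvent[OF l]] tendsto_intros)
  ultimately have "resolvent l (l *\<^sub>R fst p - snd p) = fst p"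
    using tendsto_fst[OF q] LIMSEQ_unique by auto
  then show "p \<in> A" using resolvent_mem[OF l, of "l *\<^sub>R fst p - snd p"] by simp
qed

text \<open>Let \<open>y - c\<close> be orthogonal to the closed domain and \<open>x\<close> its
  resolvent. Then \<open>x\<close> is in the domain, so \<open>x \<bullet> (y - c) = 0\<close>,
  dissipativity yields \<open>x = 0\<close>, and \<open>single_valued\<close> gives
  \<open>y = c\<close>.\<close>

lemma dense_domain: "closure (fst ` A) = UNIV"
proof -
  have sub: "subspace (closure (fst ` A))"
    by (intro subspace_closure linear_subspace_image bounded_linear.linear bounded_linear_fst subspace)
  have "y \<in> closure (fst ` A)" for y
  proof -
    obtain c where c: "c \<in> closure (fst ` A)" "\<And>v. v \<in> closure (fst ` A) \<Longrightarrow> (y - c) \<bullet> v = 0"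
      using orthogonal_projection_exists[OF sub closed_closure] by blast
    define l where "l = \<omega> + 1"
    have l: "l > \<omega>" "l > 0" using \<omega> by (auto simp: l_def)
    let ?x = "resolvent l (y - c)"
    have mem: "(?x, l *\<^sub>R ?x - (y - c)) \<in> A" by (rule resolvent_mem[OF l(1)])
    then have "?x \<in> closure (fst ` A)" using closure_subset[of "fst ` A"] by force
    then have "(y - c) \<bullet> ?x = 0" by (rule c)
    then have "?x \<bullet> (y - c) = 0" by (simp add: inner_commute)
    then have "l * (?x \<bullet> ?x) \<le> 0" using dissipative[OF mem] by (simp add: inner_diff_right)
    then have "?x \<bullet> ?x \<le> 0" using l by (simp add: mult_le_0_iff)
    then have "?x = 0" by (rule inner_self_nonpos_imp_zero)
    then have "y - c = 0" using mem single_valued[of "- (y - c)"] by simp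
    then show ?thesis using c(1) by simp
  qed
  then show ?thesis by blast
qed

section \<open>Yosida approximation and the limiting contraction family\<close>

definition yosida :: "real \<Rightarrow> 'a \<Rightarrow> 'a" where
  "yosida l y = l *\<^sub>R (l *\<^sub>R resolvent l y - y)"

lemma yosida_mem: "l > \<omega> \<Longrightarrow> (l *\<^sub>R resolvent l y, yosida l y) \<in> A"
  unfolding yosida_def by (intro scale_mem resolvent_mem)

lemma bounded_linear_yosida: "l > \<omega> \<Longrightarrow> bounded_linear (yosida l)"
  unfolding yosida_def[abs_def]
  by (intro bounded_linear_scaleR_right[THEN bounded_linear_compose] bounded_linear_sub
      bounded_linear_resolvent bounded_linear_ident)

text \<open>\<open>y\<close> splits into a vector of the domain, where dissipativity of the graph
  applies, and \<open>- (1 / l)\<close> times its Yosida value, which contributes minus a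
  square.\<close>

lemma yosida_dissipative:
  assumes l: "l > \<omega>"
  shows "y \<bullet> yosida l y \<le> 0"
proof -
  have "l > 0" using l \<omega> by simp
  then have "y = l *\<^sub>R resolvent l y - (1 / l) *\<^sub>R yosida l y"
    by (simp add: yosida_def)
  then have "y \<bullet> yosida l y = l *\<^sub>R resolvent l y \<bullet> yosida l y - (1 / l) * (yosida l y \<bullet> yosida l y)"
    by (metis inner_diff_left inner_scaleR_left)
  moreover have "(1 / l) * (yosida l y \<bullet> yosida l y) \<ge> 0" using \<open>l > 0\<close> by simp
  ultimately show ?thesis using dissipative[OF yosida_mem[OF l, of y]] by linarith
qed

lemma yosida_commute:
  assumes "l > \<omega>" "m > \<omega>"
  shows "yosida l (yosida m y) = yosida m (yosida l y)"
  by (simp add: yosida_def linear_simps[OF bounded_linear_resolvent[OF assms(1)]]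
      linear_simps[OF bounded_linear_resolvent[OF assms(2)]] resolvent_commute[OF assms] algebra_simps)

text \<open>On the domain the resolvent acts on \<open>v\<close> instead, so convergence of the
  approximation to \<open>v\<close> reduces to convergence of
  \<open>l *\<^sub>R resolvent l v\<close> to \<open>v\<close>.\<close>

lemma yosida_eq:
  assumes l: "l > \<omega>" and x: "(x, v) \<in> A"
  shows "yosida l x = l *\<^sub>R resolvent l v"
proof -
  have "resolvent l (l *\<^sub>R x - v) = x" using x by (intro resolvent_eqI[OF l]) simp
  then have "l *\<^sub>R resolvent l x - x = resolvent l v"
    by (simp add: linear_simps[OF bounded_linear_resolvent[OF l]] algebra_simps)
  then show ?thesis by (simp add: yosida_def)
qed

lemma dense_domainE:
  assumes "e > 0"
  obtains x v where "(x, v) \<in> A" "norm (y - x) < e"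
proof -
  have "y \<in> closure (fst ` A)" using dense_domain by simp
  with assms obtain p where "p \<in> A" "dist (fst p) y < e" by (auto simp: closure_approachable)
  with that[of "fst p" "snd p"] show ?thesis by (simp add: dist_norm norm_minus_commute)
qed

text \<open>On the domain the error is the resolvent of \<open>v\<close>, of norm at most
  \<open>norm v / l\<close>. Density and the uniform bound \<open>resolvent_norm_le\<close> carry
  this to every \<open>y\<close>.\<close>

lemma resolvent_tendsto:
  assumes L: "filterlim L at_top sequentially" "\<And>n. L n > \<omega>"
  shows "(\<lambda>n. L n *\<^sub>R resolvent (L n) y) \<longlonglongrightarrow> y"
proof (rule metric_LIMSEQ_I)
  fix e :: real assume e: "e > 0"
  obtain x v where xv: "(x, v) \<in> A" "norm (y - x) < e / 3" using dense_domainE[of "e / 3" y] e by auto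
  have "\<forall>\<^sub>F n in sequentially. norm v / (e / 3) < L n"
    using L(1) by (simp add: filterlim_at_top_dense)
  then have "\<forall>\<^sub>F n in sequentially. dist (L n *\<^sub>R resolvent (L n) y) y < e"
  proof eventually_elim
    case (elim n)
    let ?J = "\<lambda>z. L n *\<^sub>R resolvent (L n) z"
    have Lpos: "L n > 0" using L(2)[of n] \<omega> by simp
    have "?J x - x = resolvent (L n) v"
      using yosida_eq[OF L(2) xv(1), of n] Lpos by (simp add: yosida_def)
    then have "L n * norm (?J x - x) \<le> norm v"
      using resolvent_norm_le[OF L(2), of n v] Lpos by simp
    also have "\<dots> < L n * (e / 3)" using elim e by (simp add: field_simps)
    finally have 1: "norm (?J x - x) < e / 3" using Lpos by simp
    have "?J y - ?J x = ?J (y - x)"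
      by (simp add: linear_simps[OF bounded_linear_resolvent[OF L(2)]] scaleR_diff_right)
    then have 2: "norm (?J y - ?J x) < e / 3"
      using resolvent_norm_le[OF L(2), of n "y - x"] xv(2) by simp
    show ?case using norm_telescope_le[of "?J y" y "?J x" x] 1 2 xv(2) by (simp add: dist_norm)
  qed
  then show "\<exists>N. \<forall>n\<ge>N. dist (L n *\<^sub>R resolvent (L n) y) y < e"
    by (simp add: eventually_sequentially)
qed

text \<open>The offset keeps every parameter above \<omega>, where the range condition provides
  resolvents.\<close>

definition approx_gen :: "nat \<Rightarrow> 'a \<Rightarrow> 'a" where
  "approx_gen n = yosida (\<omega> + 1 + real n)"

lemma approx_gen:
  "bounded_linear (approx_gen n)" "x \<bullet> approx_gen n x \<le> 0" "approx_gen m (approx_gen n x) = approx_gen n (approx_gen m x)"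
  unfolding approx_gen_def using bounded_linear_yosida yosida_dissipative yosida_commute by auto

lemma approx_parameter_tendsto: "filterlim (\<lambda>n. \<omega> + 1 + real n) at_top sequentially"
  by (rule filterlim_tendsto_add_at_top[OF tendsto_const filterlim_real_sequentially])

lemma approx_gen_tendsto: "(x, v) \<in> A \<Longrightarrow> (\<lambda>n. approx_gen n x) \<longlonglongrightarrow> v"
  unfolding approx_gen_def using resolvent_tendsto[OF approx_parameter_tendsto, of v]
  by (simp add: yosida_eq)

definition semigroup :: "real \<Rightarrow> 'a \<Rightarrow> 'a" where
  "semigroup t x = lim (\<lambda>n. exp_op (approx_gen n) t x)"

text \<open>For a start vector \<open>y\<close> in the domain, \<open>exp_op_diff_le\<close> bounds
  the distance of two exponentials by \<open>t\<close> times the distance of the approximate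
  generators at \<open>y\<close>, which is Cauchy. Contractivity and density extend this to all
  start vectors, uniformly on bounded time intervals.\<close>

lemma semigroup_uniform_limit:
  "uniform_limit {0..T} (\<lambda>n t. exp_op (approx_gen n) t x) (\<lambda>t. semigroup t x) sequentially"
proof -
  have "uniformly_Cauchy_on {0..T} (\<lambda>n t. exp_op (approx_gen n) t x)"
  proof (rule uniformly_Cauchy_onI)
    fix e :: real assume e: "e > 0"
    obtain y v where yv: "(y, v) \<in> A" "norm (x - y) < e / 3" using dense_domainE[of "e / 3" x] e by auto
    have "Cauchy (\<lambda>n. approx_gen n y)" using approx_gen_tendsto[OF yv(1)] by (rule LIMSEQ_imp_Cauchy)
    \<comment> \<open>The time factor is at most \<open>\<bar>T\<bar> + 1\<close>, which is positive
      for every \<open>T\<close>.\<close>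
    then obtain M where M: "\<And>m n. m \<ge> M \<Longrightarrow> n \<ge> M \<Longrightarrow> norm (approx_gen m y - approx_gen n y) < e / (3 * (\<bar>T\<bar> + 1))"
      using CauchyD[of "\<lambda>n. approx_gen n y" "e / (3 * (\<bar>T\<bar> + 1))"] e by (auto simp: add_nonneg_pos)
    have "dist (exp_op (approx_gen m) t x) (exp_op (approx_gen n) t x) < e"
      if t: "t \<in> {0..T}" and mn: "m \<ge> M" "n \<ge> M" for t m n
    proof -
      let ?E = "\<lambda>k. exp_op (approx_gen k) t"
      have t0: "t \<ge> 0" using t by simp
      have d: "norm (?E k x - ?E k y) < e / 3" for k
      proof -
        have "norm (?E k (x - y)) \<le> norm (x - y)" by (rule exp_op_contraction[OF approx_gen(1,2) t0])
        then show ?thesis using yv(2) by (simp add: linear_diff[OF linear_exp_op[OF approx_gen(1)]])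
      qed
      have "norm (?E m y - ?E n y) \<le> norm (approx_gen m y - approx_gen n y) * t"
        by (intro exp_op_diff_le approx_gen t0)
      also have "\<dots> \<le> e / (3 * (\<bar>T\<bar> + 1)) * (\<bar>T\<bar> + 1)"
        using M[OF mn] t e by (intro mult_mono) auto
      also have "\<dots> = e / 3" using abs_ge_zero[of T] by (simp add: divide_simps)
      finally have 2: "norm (?E m y - ?E n y) \<le> e / 3" .
      show ?thesis
        using norm_telescope_le[of "?E m x" "?E n x" "?E m y" "?E n y"] d[of m] d[of n] 2 by (simp add: dist_norm)
    qed
    then show "\<exists>M. \<forall>t\<in>{0..T}. \<forall>m\<ge>M. \<forall>n\<ge>M. dist (exp_op (approx_gen m) t x) (exp_op (approx_gen n) t x) < e"
      by blast
  qed
  from Cauchy_uniformly_convergent[OF this] show ?thesis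
    unfolding semigroup_def by (rule uniformly_convergent_uniform_limit_iff[THEN iffD1])
qed

lemma semigroup_tendsto: "t \<ge> 0 \<Longrightarrow> (\<lambda>n. exp_op (approx_gen n) t x) \<longlonglongrightarrow> semigroup t x"
  using tendsto_uniform_limitI[OF semigroup_uniform_limit[where T = t and x = x], of t] by simp

lemma contraction_family_semigroup: "contraction_family semigroup"
  unfolding contraction_family_def
proof (intro conjI allI impI)
  fix t :: real and x assume t: "t \<ge> 0"
  show "linear (semigroup t)"
  proof (rule linearI)
    fix x y and c :: real
    have "(\<lambda>n. exp_op (approx_gen n) t (x + y)) \<longlonglongrightarrow> semigroup t x + semigroup t y"
      using tendsto_add[OF semigroup_tendsto[OF t] semigroup_tendsto[OF t]]
      by (simp add: linear_add[OF linear_exp_op[OF approx_gen(1)]])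
    then show "semigroup t (x + y) = semigroup t x + semigroup t y"
      using semigroup_tendsto[OF t] LIMSEQ_unique by blast
    have "(\<lambda>n. exp_op (approx_gen n) t (c *\<^sub>R x)) \<longlonglongrightarrow> c *\<^sub>R semigroup t x"
      using tendsto_scaleR[OF tendsto_const semigroup_tendsto[OF t]]
      by (simp add: linear_cmul[OF linear_exp_op[OF approx_gen(1)]])
    then show "semigroup t (c *\<^sub>R x) = c *\<^sub>R semigroup t x"
      using semigroup_tendsto[OF t] LIMSEQ_unique by blast
  qed
  show "norm (semigroup t x) \<le> norm x"
    using exp_op_contraction[OF approx_gen(1,2) t]
    by (intro LIMSEQ_le_const2[OF tendsto_norm[OF semigroup_tendsto[OF t]]]) auto
next
  fix x
  have cont: "continuous_on {0..T} (\<lambda>t. semigroup t x)" for T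
    using semigroup_uniform_limit
    by (rule uniform_limit_theorem[rotated])
      (auto intro!: always_eventually continuous_on_vector_derivative[OF exp_op_has_vector_derivative[OF approx_gen(1)]])
  show "continuous_on {0..} (\<lambda>t. semigroup t x)"
    unfolding continuous_on_eq_continuous_within
  proof
    fix t :: real assume "t \<in> {0..}"
    then have "continuous (at t within {0..t + 1}) (\<lambda>t. semigroup t x)"
      using cont[of "t + 1"] by (simp add: continuous_on_eq_continuous_within)
    moreover have "at t within {0..t + 1} = at t within {0..}"
      by (rule at_within_nhd[of _ "{..<t + 1}"]) auto
    ultimately show "continuous (at t within {0..}) (\<lambda>t. semigroup t x)" by simp
  qed
qed

text \<open>For the Yosida approximation \<open>B\<close> the derivative of the solution is given explicitly by
  \<open>w t = exp (t B) (B z0 + F0) + convolution (exp_op B) F' t\<close>. This formula involves no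
  unbounded operator, hence it passes to the limit; the differential equation itself then follows
  since the graph is closed.\<close>

theorem inhomogeneous_solution:
  assumes F': "set_integrable lebesgue {0..T} F'" and z0: "(z0, v0) \<in> A" and T: "T \<ge> 0"
    and F: "\<And>t. t \<in> {0..T} \<Longrightarrow> F t = F0 + (LINT s:{0..t}|lebesgue. F' s)"
  shows "\<exists>z w. continuous_on {0..T} w \<and> z 0 = z0 \<and>
    (\<forall>t\<in>{0..T}. (z has_vector_derivative w t) (at t within {0..T}) \<and> (z t, w t - F t) \<in> A)"
proof -
  note S = contraction_family_semigroup and E = contraction_family_exp_op[OF approx_gen(1,2)]
  define w where "w t = semigroup t (v0 + F0) + convolution semigroup F' t" for t
  define z where "z t = z0 + (LINT s:{0..t}|lebesgue. w s)" for t
  \<comment> \<open>The approximate derivative at time zero; it converges because \<open>z0\<close>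
    lies in the domain.\<close>
  define x where "x n = approx_gen n z0 + F0" for n
  define W where "W n t = exp_op (approx_gen n) t (x n) + convolution (exp_op (approx_gen n)) F' t" for n t
  define Z where "Z n t = z0 + (LINT s:{0..t}|lebesgue. W n s)" for n t
  have x_lim: "x \<longlonglongrightarrow> v0 + F0"
    unfolding x_def by (intro tendsto_intros approx_gen_tendsto z0)
  have cont_w: "continuous_on {0..T} w"
    unfolding w_def
    using S continuous_on_convolution[OF S F']
    by (intro continuous_intros) (auto simp: contraction_family_def intro: continuous_on_subset[of "{0..}"])
  have cont_E: "continuous_on {0..T} (\<lambda>t. exp_op (approx_gen n) t y)" for n y
    by (intro continuous_on_vector_derivative[OF exp_op_has_vector_derivative[OF approx_gen(1)]])
  have cont_W: "continuous_on {0..T} (W n)" for n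
    unfolding W_def using continuous_on_convolution[OF E F'] cont_E by (intro continuous_intros)
  have W_lim: "(\<lambda>n. W n t) \<longlonglongrightarrow> w t" if t: "t \<in> {0..T}" for t
  proof -
    have t0: "t \<ge> 0" using t by simp
    have "(\<lambda>n. exp_op (approx_gen n) t (x n - (v0 + F0))) \<longlonglongrightarrow> 0"
    proof (rule Lim_null_comparison)
      show "\<forall>\<^sub>F n in sequentially. norm (exp_op (approx_gen n) t (x n - (v0 + F0))) \<le> norm (x n - (v0 + F0))"
        using exp_op_contraction[OF approx_gen(1,2) t0] by simp
      show "(\<lambda>n. norm (x n - (v0 + F0))) \<longlonglongrightarrow> 0"
        using x_lim by (simp add: LIM_zero_iff tendsto_norm_zero)
    qed
    from tendsto_add[OF this semigroup_tendsto[OF t0, of "v0 + F0"]]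
    have "(\<lambda>n. exp_op (approx_gen n) t (x n)) \<longlonglongrightarrow> semigroup t (v0 + F0)"
      by (simp add: linear_diff[OF linear_exp_op[OF approx_gen(1)]])
    moreover have "(\<lambda>n. convolution (exp_op (approx_gen n)) F' t) \<longlonglongrightarrow> convolution semigroup F' t"
      using semigroup_tendsto by (intro convolution_tendsto[OF E S F' _ t]) auto
    ultimately show ?thesis unfolding W_def w_def by (rule tendsto_add)
  qed
  obtain c where c: "\<And>n. norm (x n) \<le> c"
    using convergent_imp_Bseq[OF convergentI[OF x_lim]] unfolding Bseq_def by blast
  define C where "C = c + (\<integral>s. norm (indicator {0..T} s *\<^sub>R F' s) \<partial>lebesgue)"
  have W_bound: "norm (W n t) \<le> C" if t: "t \<in> {0..T}" for n t
    unfolding W_def C_def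
    using exp_op_contraction[OF approx_gen(1,2), of t n "x n"] c[of n] convolution_norm_le[OF E F' t, of n] t
    by (intro order_trans[OF norm_triangle_ineq] add_mono) auto
  have Z_lim: "(\<lambda>n. Z n t) \<longlonglongrightarrow> z t" if t: "t \<in> {0..T}" for t
    unfolding Z_def z_def set_lebesgue_integral_def
  proof (intro tendsto_add tendsto_const integral_dominated_convergence[where w = "\<lambda>s. indicator {0..t} s *\<^sub>R C"])
    show "(\<lambda>s. indicator {0..t} s *\<^sub>R w s) \<in> borel_measurable lebesgue"
      "(\<lambda>s. indicator {0..t} s *\<^sub>R W n s) \<in> borel_measurable lebesgue" for n
      using set_integrable_continuous_on_interval[OF continuous_on_subset[OF cont_w], of 0 t]
        set_integrable_continuous_on_interval[OF continuous_on_subset[OF cont_W], of 0 t n] t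
      by (auto simp: set_integrable_def)
    show "integrable lebesgue (\<lambda>s. indicator {0..t} s *\<^sub>R C)"
      using set_integrable_continuous_on_interval[of 0 t "\<lambda>_. C"] by (simp add: set_integrable_def)
    show "AE s in lebesgue. (\<lambda>n. indicator {0..t} s *\<^sub>R W n s) \<longlonglongrightarrow> indicator {0..t} s *\<^sub>R w s"
      using W_lim t by (intro AE_I2) (auto simp: indicator_def)
    show "AE s in lebesgue. norm (indicator {0..t} s *\<^sub>R W n s) \<le> indicator {0..t} s *\<^sub>R C" for n
      using W_bound t by (intro AE_I2) (auto simp: indicator_def)
  qed
  \<comment> \<open>\<open>?B\<close> is bounded and passes under the time integral in
    \<open>Z\<close>. The exponential part integrates exactly, the convolution part by
    \<open>integral_convolution_exp_op\<close>, and the leftover constants add up to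
    \<open>F t\<close>.\<close>
  have W_eq: "W n t = approx_gen n (Z n t) + F t" if t: "t \<in> {0..T}" for n t
  proof -
    let ?B = "approx_gen n" and ?l = "lebesgue :: real measure"
    have sub: "{0..t} \<subseteq> {0..T}" using t by auto
    have int: "set_integrable ?l {0..t} (\<lambda>s. exp_op ?B s (x n))" "set_integrable ?l {0..t} (convolution (exp_op ?B) F')"
      by (intro set_integrable_continuous_on_interval continuous_on_subset[OF _ sub] cont_E
          continuous_on_convolution[OF E F'])+
    have "?B (LINT s:{0..t}|?l. exp_op ?B s (x n)) = exp_op ?B t (x n) - x n"
      using set_integral_bounded_linear[OF approx_gen(1) int(1)] exp_op_set_integral[OF approx_gen(1), of 0 t n "x n"] t
      by simp
    moreover have "(LINT s:{0..t}|?l. W n s) = (LINT s:{0..t}|?l. exp_op ?B s (x n)) + (LINT s:{0..t}|?l. convolution (exp_op ?B) F' s)"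
      unfolding W_def by (rule set_integral_add[OF int])
    ultimately have "?B (Z n t) = ?B z0 + (exp_op ?B t (x n) - x n) + (convolution (exp_op ?B) F' t - (LINT s:{0..t}|?l. F' s))"
      using integral_convolution_exp_op[OF approx_gen(1,2) F' t] by (simp add: Z_def linear_simps[OF approx_gen(1)])
    then show ?thesis by (simp add: W_def F[OF t] x_def)
  qed
  have "(z t, w t - F t) \<in> A" if t: "t \<in> {0..T}" for t
  proof -
    define l where "l n = \<omega> + 1 + real n" for n
    have l: "l n > \<omega>" for n by (simp add: l_def)
    \<comment> \<open>\<open>Z n t\<close> itself may lie outside the domain;
      \<open>J n (Z n t)\<close> lies in it, is paired in the graph with
      \<open>approx_gen n (Z n t)\<close>, and has the same limit.\<close>
    define J where "J n y = l n *\<^sub>R resolvent (l n) y" for n y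
    have "(\<lambda>n. J n (Z n t - z t)) \<longlonglongrightarrow> 0"
    proof (rule Lim_null_comparison)
      show "\<forall>\<^sub>F n in sequentially. norm (J n (Z n t - z t)) \<le> norm (Z n t - z t)"
        using resolvent_norm_le[OF l] by (simp only: J_def) auto
      show "(\<lambda>n. norm (Z n t - z t)) \<longlonglongrightarrow> 0"
        using Z_lim[OF t] by (simp add: LIM_zero_iff tendsto_norm_zero)
    qed
    moreover have "(\<lambda>n. J n (z t)) \<longlonglongrightarrow> z t"
      unfolding J_def using approx_parameter_tendsto l by (intro resolvent_tendsto) (auto simp: l_def[abs_def])
    ultimately have "(\<lambda>n. J n (Z n t - z t) + J n (z t)) \<longlonglongrightarrow> 0 + z t" by (rule tendsto_add)
    moreover have "J n (Z n t - z t) + J n (z t) = J n (Z n t)" for n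
      by (simp add: J_def linear_simps[OF bounded_linear_resolvent[OF l]] algebra_simps)
    ultimately have "(\<lambda>n. J n (Z n t)) \<longlonglongrightarrow> z t" by simp
    moreover have "(\<lambda>n. approx_gen n (Z n t)) \<longlonglongrightarrow> w t - F t"
    proof -
      have "(\<lambda>n. W n t - F t) \<longlonglongrightarrow> w t - F t" by (intro tendsto_intros W_lim t)
      then show ?thesis by (simp add: W_eq[OF t])
    qed
    ultimately have lim: "(\<lambda>n. (J n (Z n t), approx_gen n (Z n t))) \<longlonglongrightarrow> (z t, w t - F t)"
      by (rule tendsto_Pair)
    have "(J n (Z n t), approx_gen n (Z n t)) \<in> A" for n
      unfolding J_def approx_gen_def l_def[symmetric] by (rule yosida_mem[OF l])
    from closed_sequentially[OF closed_graph this lim] show ?thesis .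
  qed
  moreover have deriv: "(z has_vector_derivative w t) (at t within {0..T})" if "t \<in> {0..T}" for t
    unfolding z_def[abs_def]
    using has_vector_derivative_add[OF has_vector_derivative_const has_vector_derivative_set_integral[OF cont_w that], of z0]
    by simp
  moreover have "z 0 = z0"
  proof -
    have "(LINT s:{0..0}|lebesgue. w s) = z 0 - z 0"
      using T by (intro set_integral_FTC has_vector_derivative_within_subset[OF deriv] continuous_on_subset[OF cont_w]) auto
    then show ?thesis by (simp add: z_def)
  qed
  ultimately show ?thesis using cont_w by blast
qed

end

section \<open>Bounded perturbations and skew block operators\<close>

text \<open>The perturbed resolvent equation is the fixed point problem
  \<open>x = resolvent l (y - M x)\<close>, a contraction with constant \<open>K / l\<close> once
  \<open>l > K\<close>. This is why the bound grows to \<open>max \<omega> K\<close>.\<close>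

lemma m_dissipative_perturbation:
  fixes M :: "'a \<Rightarrow> 'a::{real_inner, banach, second_countable_topology}"
  assumes A: "m_dissipative A \<omega>" and M: "bounded_linear M" and nonneg: "\<And>x. 0 \<le> x \<bullet> M x"
  shows "\<exists>\<omega>'. m_dissipative ((\<lambda>(x, y). (x, y - M x)) ` A) \<omega>'"
proof -
  interpret m_dissipative A \<omega> by (rule A)
  obtain K where K: "K > 0" "\<And>x. norm (M x) \<le> norm x * K"
    using bounded_linear.pos_bounded[OF M] by auto
  have mem: "(x, y) \<in> (\<lambda>(x, y). (x, y - M x)) ` A \<longleftrightarrow> (x, y + M x) \<in> A" for x y
    by (force intro: image_eqI[of _ _ "(x, y + M x)"])
  have "m_dissipative ((\<lambda>(x, y). (x, y - M x)) ` A) (max \<omega> K)"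
  proof
    have "linear (\<lambda>(x, y). (x, y - M x))"
      by (rule linearI) (auto simp: linear_simps[OF M] algebra_simps)
    then show "subspace ((\<lambda>(x, y). (x, y - M x)) ` A)" using subspace by (rule linear_subspace_image)
    fix x y
    show "x \<bullet> y \<le> 0" if "(x, y) \<in> (\<lambda>(x, y). (x, y - M x)) ` A"
      using dissipative[of x "y + M x"] that nonneg[of x] unfolding mem by (simp add: inner_add_right)
    show "y = 0" if "(0, y) \<in> (\<lambda>(x, y). (x, y - M x)) ` A"
      using single_valued[of y] that unfolding mem by (simp add: linear_simps[OF M])
  next
    fix l y assume "l > max \<omega> K"
    then have l: "l > \<omega>" "l > K" by auto
    define \<Phi> where "\<Phi> x = resolvent l (y - M x)" for x
    have "\<exists>!x. \<Phi> x = x"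
    proof (rule banach_fix_type[where c = "K / l"])
      show "0 \<le> K / l" "K / l < 1" using K l by auto
      show "\<forall>x x'. dist (\<Phi> x) (\<Phi> x') \<le> K / l * dist x x'"
      proof (intro allI)
        fix x x'
        have "\<Phi> x - \<Phi> x' = resolvent l (M (x' - x))"
          by (simp add: \<Phi>_def linear_simps[OF bounded_linear_resolvent[OF l(1)]] linear_simps[OF M])
        then have "l * norm (\<Phi> x - \<Phi> x') \<le> norm (M (x' - x))"
          using resolvent_norm_le[OF l(1), of "M (x' - x)"] K l by simp
        also have "\<dots> \<le> dist x x' * K"
          using K(2)[of "x' - x"] by (simp add: dist_norm norm_minus_commute)
        finally show "dist (\<Phi> x) (\<Phi> x') \<le> K / l * dist x x'"
          using K l by (simp add: dist_norm field_simps)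
      qed
    qed
    then obtain x where "\<Phi> x = x" by blast
    then have "(x, l *\<^sub>R x - (y - M x)) \<in> A"
      using resolvent_mem[OF l(1), of "y - M x"] by (simp add: \<Phi>_def)
    then show "\<exists>x. (x, l *\<^sub>R x - y) \<in> (\<lambda>(x, y). (x, y - M x)) ` A"
      unfolding mem by (auto simp: algebra_simps)
  qed (use \<omega> in auto)
  then show ?thesis ..
qed

definition adjoint_graph :: "('a \<times> 'a::real_inner) set \<Rightarrow> ('a \<times> 'a) set" where
  "adjoint_graph V = {(n, k). \<forall>(q, q')\<in>V. k \<bullet> q = n \<bullet> q'}"

lemma adjoint_graphD: "(n, k) \<in> adjoint_graph V \<Longrightarrow> (q, q') \<in> V \<Longrightarrow> k \<bullet> q = n \<bullet> q'"
  by (auto simp: adjoint_graph_def)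

text \<open>\<open>p \<bullet> k\<close> and \<open>n \<bullet> p'\<close> agree by the definition
  of the adjoint, so the two contributions to \<open>x \<bullet> y\<close> cancel. For the range,
  eliminating the second component leaves a symmetric problem on \<open>V\<close> that is coercive
  in the graph norm. \<open>single\<close> and \<open>dense\<close> make the two blocks
  single-valued.\<close>

lemma m_dissipative_skew_block:
  fixes V :: "('a \<times> 'a::{real_inner, banach, second_countable_topology}) set"
  assumes V: "subspace V" "closed V"
    and single: "\<And>y. (0, y) \<in> V \<Longrightarrow> y = 0"
    and dense: "\<And>k. (\<And>q q'. (q, q') \<in> V \<Longrightarrow> k \<bullet> q = 0) \<Longrightarrow> k = 0"
  shows "m_dissipative {((p, n), (k, - p')) | p n k p'. (p, p') \<in> V \<and> (n, k) \<in> adjoint_graph V} 0"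
    (is "m_dissipative ?A 0")
proof
  have sub: "subspace ?A"
  proof (rule subspaceI)
    show "0 \<in> ?A"
      using subspace_0[OF V(1)] by (auto simp: adjoint_graph_def zero_prod_def intro!: exI[of _ 0])
    fix x y and c :: real assume "x \<in> ?A"
    then obtain p n k p' where x: "x = ((p, n), (k, - p'))" "(p, p') \<in> V" "(n, k) \<in> adjoint_graph V" by blast
    have "(c *\<^sub>R p, c *\<^sub>R p') \<in> V" using subspace_scale[OF V(1) x(2), of c] by simp
    moreover have "(c *\<^sub>R n, c *\<^sub>R k) \<in> adjoint_graph V" using x(3) by (auto simp: adjoint_graph_def)
    ultimately show "c *\<^sub>R x \<in> ?A" unfolding x by force
    assume "y \<in> ?A"
    then obtain p2 n2 k2 p2' where y: "y = ((p2, n2), (k2, - p2'))" "(p2, p2') \<in> V" "(n2, k2) \<in> adjoint_graph V" by blast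
    have "(p + p2, p' + p2') \<in> V" using subspace_add[OF V(1) x(2) y(2)] by simp
    moreover have "(n + n2, k + k2) \<in> adjoint_graph V"
      using x(3) y(3) by (fastforce simp: adjoint_graph_def inner_add_left)
    ultimately show "x + y \<in> ?A" unfolding x y by force
  qed
  then show "subspace ?A" .
  show "x \<bullet> y \<le> 0" if "(x, y) \<in> ?A" for x y
    using that by (auto simp: adjoint_graph_def inner_commute)
  show "y = 0" if "(0, y) \<in> ?A" for y
  proof -
    from that obtain k p' where y: "y = (k, - p')" "(0, p') \<in> V" "(0, k) \<in> adjoint_graph V"
      by (auto simp: zero_prod_def)
    have "p' = 0" by (rule single[OF y(2)])
    moreover have "k = 0" using adjoint_graphD[OF y(3)] by (intro dense) simp
    ultimately show ?thesis by (simp add: y zero_prod_def)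
  qed
  fix l :: real and y :: "'a \<times> 'a" assume l: "l > 0"
  obtain y1 y2 where y: "y = (y1, y2)" by (cases y)
  \<comment> \<open>From \<open>l n - y2 = - p'\<close> follows \<open>n = (y2 - p') / l\<close>;
    inserting this in the adjoint condition for \<open>(n, l p - y1)\<close> gives the weak equation
    with form \<open>?b\<close> and data \<open>?f\<close>.\<close>
  let ?b = "\<lambda>u v :: 'a \<times> 'a. l * (fst u \<bullet> fst v) + (1 / l) * (snd u \<bullet> snd v)"
  let ?f = "\<lambda>v :: 'a \<times> 'a. y1 \<bullet> fst v + (1 / l) * (y2 \<bullet> snd v)"
  have "\<exists>z\<in>V. \<forall>v\<in>V. ?b z v = ?f v"
  proof (rule lax_milgram_symmetric[OF V, of ?b "min l (1 / l)"])
    have "bounded_linear (\<lambda>u :: 'a \<times> 'a. (l *\<^sub>R fst u, (1 / l) *\<^sub>R snd u))"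
      by (intro bounded_linear_Pair bounded_linear_fst bounded_linear_snd
          bounded_linear_compose[OF bounded_linear_scaleR_right])
    from bounded_bilinear.comp[OF bounded_bilinear_inner this bounded_linear_ident]
    show "bounded_bilinear ?b" by (simp add: inner_prod_def)
    show "min l (1 / l) > 0" using l by simp
    fix v :: "'a \<times> 'a"
    have "(norm v)\<^sup>2 = fst v \<bullet> fst v + snd v \<bullet> snd v"
      by (simp add: norm_prod_def power2_norm_eq_inner)
    moreover have "min l (1 / l) * (fst v \<bullet> fst v) \<le> l * (fst v \<bullet> fst v)"
      "min l (1 / l) * (snd v \<bullet> snd v) \<le> (1 / l) * (snd v \<bullet> snd v)"
      by (intro mult_right_mono; simp)+
    ultimately show "min l (1 / l) * (norm v)\<^sup>2 \<le> ?b v v" by (simp add: distrib_left)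
    have "\<bar>y1 \<bullet> fst v\<bar> \<le> norm y1 * norm v"
      by (rule order_trans[OF Cauchy_Schwarz_ineq2]) (simp add: mult_left_mono norm_fst_le[of "fst v" "snd v", simplified])
    moreover have "\<bar>y2 \<bullet> snd v\<bar> \<le> norm y2 * norm v"
      by (rule order_trans[OF Cauchy_Schwarz_ineq2]) (simp add: mult_left_mono norm_snd_le[of "snd v" "fst v", simplified])
    then have "\<bar>(1 / l) * (y2 \<bullet> snd v)\<bar> \<le> (1 / l) * (norm y2 * norm v)"
      using l by (simp add: abs_mult divide_right_mono)
    ultimately show "\<bar>?f v\<bar> \<le> (norm y1 + (1 / l) * norm y2) * norm v"
      using abs_triangle_ineq[of "y1 \<bullet> fst v" "(1 / l) * (y2 \<bullet> snd v)"] unfolding distrib_right mult.assoc by linarith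
  qed (auto simp: inner_commute inner_add_right distrib_left)
  then obtain p p' where V': "(p, p') \<in> V"
    and eq: "\<forall>v\<in>V. ?b (p, p') v = ?f v"
    by (metis prod.collapse)
  define n where "n = (1 / l) *\<^sub>R (y2 - p')"
  have "(n, l *\<^sub>R p - y1) \<in> adjoint_graph V"
    unfolding adjoint_graph_def
  proof (clarify)
    fix q q' assume "(q, q') \<in> V"
    from bspec[OF eq this] show "(l *\<^sub>R p - y1) \<bullet> q = n \<bullet> q'"
      by (simp add: n_def inner_diff_left algebra_simps diff_divide_distrib)
  qed
  moreover have "l *\<^sub>R (p, n) - y = (l *\<^sub>R p - y1, - p')"
    using l by (simp add: y n_def)
  ultimately show "\<exists>x. (x, l *\<^sub>R x - y) \<in> ?A"
    using V' by (intro exI[of _ "(p, n)"]) force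
qed simp

section \<open>Absolutely continuous sources and the skew system\<close>

text \<open>Absolute continuity in time, in a form that is visibly stable under bounded linear maps
  and sums; the transformed sources are built with these operations from the data and their first
  derivatives.\<close>

definition has_integrable_derivative :: "real \<Rightarrow> (real \<Rightarrow> 'a::{banach, second_countable_topology}) \<Rightarrow> bool" where
  "has_integrable_derivative T F \<longleftrightarrow> (\<exists>F'. set_integrable lebesgue {0..T} F' \<and>
     (\<forall>t\<in>{0..T}. F t = F 0 + (LINT s:{0..t}|lebesgue. F' s)))"

lemma has_integrable_derivative_bounded_linear:
  assumes L: "bounded_linear L" and F: "has_integrable_derivative T F"
  shows "has_integrable_derivative T (\<lambda>t. L (F t))"
proof -
  obtain F' where F': "set_integrable lebesgue {0..T} F'"
    "\<And>t. t \<in> {0..T} \<Longrightarrow> F t = F 0 + (LINT s:{0..t}|lebesgue. F' s)"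
    using F unfolding has_integrable_derivative_def by blast
  have "L (F t) = L (F 0) + (LINT s:{0..t}|lebesgue. L (F' s))" if t: "t \<in> {0..T}" for t
  proof -
    have "set_integrable lebesgue {0..t} F'" using t by (intro set_integrable_subset[OF F'(1)]) auto
    then have "(LINT s:{0..t}|lebesgue. L (F' s)) = L (LINT s:{0..t}|lebesgue. F' s)"
      by (rule set_integral_bounded_linear[OF L])
    then show ?thesis using arg_cong[OF F'(2)[OF t], of L] by (simp add: linear_simps[OF L])
  qed
  then show ?thesis
    unfolding has_integrable_derivative_def using set_integrable_bounded_linear[OF L F'(1)] by blast
qed

lemma has_integrable_derivative_add:
  assumes "has_integrable_derivative T F" "has_integrable_derivative T G"
  shows "has_integrable_derivative T (\<lambda>t. F t + G t)"
proof -
  obtain F' G' where F': "set_integrable lebesgue {0..T} F'" "set_integrable lebesgue {0..T} G'"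
    "\<And>t. t \<in> {0..T} \<Longrightarrow> F t = F 0 + (LINT s:{0..t}|lebesgue. F' s)"
    "\<And>t. t \<in> {0..T} \<Longrightarrow> G t = G 0 + (LINT s:{0..t}|lebesgue. G' s)"
    using assms unfolding has_integrable_derivative_def by blast
  have "F t + G t = F 0 + G 0 + (LINT s:{0..t}|lebesgue. F' s + G' s)" if t: "t \<in> {0..T}" for t
  proof -
    have "set_integrable lebesgue {0..t} F'" "set_integrable lebesgue {0..t} G'"
      using t by (auto intro: set_integrable_subset[OF F'(1)] set_integrable_subset[OF F'(2)])
    then show ?thesis using F'(3)[OF t] F'(4)[OF t] by (simp add: set_integral_add)
  qed
  then show ?thesis
    unfolding has_integrable_derivative_def using set_integral_add(1)[OF F'(1,2)] by blast
qed

lemma has_integrable_derivative_diff: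
  assumes "has_integrable_derivative T F" "has_integrable_derivative T G"
  shows "has_integrable_derivative T (\<lambda>t. F t - G t)"
  using has_integrable_derivative_add[OF assms(1)
      has_integrable_derivative_bounded_linear[OF bounded_linear_minus[OF bounded_linear_ident] assms(2)]] by simp

text \<open>Both components form one evolution equation in the product space, with the
  multiplications merged into one perturbation \<open>M\<close>. The hypotheses on \<open>p0\<close>
  and \<open>n0\<close> place the start vector in the domain of the block operator.\<close>

theorem skew_system_solution:
  fixes V :: "('a \<times> 'a::{real_inner, banach, second_countable_topology}) set"
  assumes V: "subspace V" "closed V"
    and single: "\<And>y. (0, y) \<in> V \<Longrightarrow> y = 0"
    and dense: "\<And>k. (\<And>q q'. (q, q') \<in> V \<Longrightarrow> k \<bullet> q = 0) \<Longrightarrow> k = 0"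
    and M1: "bounded_linear M1" "\<And>x. 0 \<le> x \<bullet> M1 x" and M2: "bounded_linear M2" "\<And>x. 0 \<le> x \<bullet> M2 x"
    and T: "T \<ge> 0" and F1: "has_integrable_derivative T F1" and F2: "has_integrable_derivative T F2"
    and p0: "(p0, p0') \<in> V" and n0: "(n0, k0) \<in> adjoint_graph V"
  shows "\<exists>p n p' n'. p 0 = p0 \<and> n 0 = n0 \<and> continuous_on {0..T} p' \<and> continuous_on {0..T} n' \<and>
    (\<forall>t\<in>{0..T}. (p has_vector_derivative p' t) (at t within {0..T}) \<and>
       (n has_vector_derivative n' t) (at t within {0..T}) \<and>
       (\<exists>q k. (p t, q) \<in> V \<and> (n t, k) \<in> adjoint_graph V \<and>
          p' t = k - M1 (p t) + F1 t \<and> n' t = - q - M2 (n t) + F2 t))"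
proof -
  define M where "M = (\<lambda>z. (M1 (fst z), M2 (snd z)))"
  define A where "A = {((p, n), (k, - p')) | p n k p'. (p, p') \<in> V \<and> (n, k) \<in> adjoint_graph V}"
  have M: "bounded_linear M"
    unfolding M_def by (intro bounded_linear_Pair bounded_linear_compose[OF M1(1)] bounded_linear_compose[OF M2(1)]
        bounded_linear_fst bounded_linear_snd)
  have "0 \<le> z \<bullet> M z" for z using M1(2) M2(2) by (cases z) (simp add: M_def)
  then obtain \<omega> where "m_dissipative ((\<lambda>(x, y). (x, y - M x)) ` A) \<omega>"
    using m_dissipative_perturbation[OF m_dissipative_skew_block[OF V single dense] M] unfolding A_def by blast
  then interpret m_dissipative "(\<lambda>(x, y). (x, y - M x)) ` A" \<omega> .
  have "has_integrable_derivative T (\<lambda>t. (F1 t, F2 t))"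
    using has_integrable_derivative_add[OF
        has_integrable_derivative_bounded_linear[OF bounded_linear_Pair[OF bounded_linear_ident bounded_linear_zero] F1]
        has_integrable_derivative_bounded_linear[OF bounded_linear_Pair[OF bounded_linear_zero bounded_linear_ident] F2]]
    by simp
  then obtain F' where F': "set_integrable lebesgue {0..T} F'"
    "\<And>t. t \<in> {0..T} \<Longrightarrow> (F1 t, F2 t) = (F1 0, F2 0) + (LINT s:{0..t}|lebesgue. F' s)"
    unfolding has_integrable_derivative_def by blast
  have "((p0, n0), (k0, - p0')) \<in> A" using p0 n0 by (auto simp: A_def)
  then have init: "((p0, n0), (k0, - p0') - M (p0, n0)) \<in> (\<lambda>(x, y). (x, y - M x)) ` A"
    by (rule rev_image_eqI) simp
  obtain z w where cont: "continuous_on {0..T} w" and z0: "z 0 = (p0, n0)"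
    and zw: "\<And>t. t \<in> {0..T} \<Longrightarrow> (z has_vector_derivative w t) (at t within {0..T})"
      "\<And>t. t \<in> {0..T} \<Longrightarrow> (z t, w t - (F1 t, F2 t)) \<in> (\<lambda>(x, y). (x, y - M x)) ` A"
    using inhomogeneous_solution[OF F'(1) init T F'(2)] by blast
  show ?thesis
  proof (rule exI[of _ "\<lambda>t. fst (z t)"], rule exI[of _ "\<lambda>t. snd (z t)"], rule exI[of _ "\<lambda>t. fst (w t)"],
      rule exI[of _ "\<lambda>t. snd (w t)"], intro conjI ballI)
    fix t assume t: "t \<in> {0..T}"
    show "((\<lambda>t. fst (z t)) has_vector_derivative fst (w t)) (at t within {0..T})"
      by (rule bounded_linear.has_vector_derivative[OF bounded_linear_fst zw(1)[OF t]])
    show "((\<lambda>t. snd (z t)) has_vector_derivative snd (w t)) (at t within {0..T})"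
      by (rule bounded_linear.has_vector_derivative[OF bounded_linear_snd zw(1)[OF t]])
    from zw(2)[OF t] obtain p n k q where "(p, q) \<in> V" "(n, k) \<in> adjoint_graph V"
      "z t = (p, n)" "w t - (F1 t, F2 t) = (k, - q) - M (p, n)"
      by (auto simp: A_def)
    moreover from this(4) have "w t = (k, - q) - M (p, n) + (F1 t, F2 t)" by (metis diff_add_cancel)
    ultimately show "\<exists>q k. (fst (z t), q) \<in> V \<and> (snd (z t), k) \<in> adjoint_graph V \<and>
        fst (w t) = k - M1 (fst (z t)) + F1 t \<and> snd (w t) = - q - M2 (snd (z t)) + F2 t"
      by (auto simp: M_def)
  qed (use cont z0 in \<open>auto intro!: continuous_intros\<close>)
qed

section \<open>Test functions and weak derivatives\<close>

definition smooth_fun :: "(real \<Rightarrow> real) \<Rightarrow> bool" where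
  "smooth_fun \<phi> \<longleftrightarrow> (\<forall>k x. (deriv ^^ k) \<phi> differentiable (at x))"

text \<open>All iterates of \<open>deriv\<close> stay inside an invariant family; this replaces
  formulas for higher derivatives.\<close>

lemma smooth_fun_coinduct:
  assumes \<phi>: "\<phi> \<in> S"
    and S: "\<And>\<psi>. \<psi> \<in> S \<Longrightarrow> \<exists>\<psi>'\<in>S. \<forall>x. (\<psi> has_real_derivative \<psi>' x) (at x)"
  shows "smooth_fun \<phi>"
proof -
  have "(deriv ^^ k) \<phi> \<in> S" for k
  proof (induction k)
    case (Suc k)
    obtain \<psi>' where "\<psi>' \<in> S" "\<And>x. ((deriv ^^ k) \<phi> has_real_derivative \<psi>' x) (at x)" using S[OF Suc] by blast
    then have "deriv ((deriv ^^ k) \<phi>) = \<psi>'" using DERIV_imp_deriv by blast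
    then show ?case using \<open>\<psi>' \<in> S\<close> by simp
  qed (simp add: \<phi>)
  then show ?thesis
    unfolding smooth_fun_def using S real_differentiable_def by blast
qed

lemma smooth_fun_has_derivative: "smooth_fun \<phi> \<Longrightarrow> (\<phi> has_real_derivative deriv \<phi> x) (at x)"
  unfolding smooth_fun_def using DERIV_deriv_iff_real_differentiable by (metis funpow_0)

lemma smooth_fun_deriv: "smooth_fun \<phi> \<Longrightarrow> smooth_fun (deriv \<phi>)"
  unfolding smooth_fun_def by (metis comp_apply funpow_Suc_right)

text \<open>For \<open>k = 0\<close> this is the classical flat function exp(-1/x). The factors
  x^(-k) make the span of the family closed under differentiation.\<close>

definition flat :: "nat \<Rightarrow> real \<Rightarrow> real" where
  "flat k x = (if x > 0 then inverse x ^ k / exp (inverse x) else 0)"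

lemma flat_tendsto_zero: "(flat k \<longlongrightarrow> 0) (at 0)"
proof -
  have "((\<lambda>x. inverse x ^ k / exp (inverse x)) \<longlongrightarrow> (0::real)) (at_right 0)"
    using filterlim_compose[OF tendsto_power_div_exp_0 filterlim_inverse_at_top_right] .
  then have "(flat k \<longlongrightarrow> 0) (at_right 0)"
    by (rule Lim_transform_eventually) (auto simp: eventually_at_filter flat_def)
  moreover have "(flat k \<longlongrightarrow> 0) (at_left 0)"
    by (rule tendsto_eventually) (auto simp: eventually_at_filter flat_def)
  ultimately show ?thesis by (simp add: filterlim_split_at)
qed

lemma flat_has_derivative: "(flat k has_real_derivative flat (k + 2) x - k * flat (k + 1) x) (at x)"
proof (cases x "0 :: real" rule: linorder_cases)
  case less
  have "((\<lambda>_. 0) has_real_derivative flat (k + 2) x - k * flat (k + 1) x) (at x)"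
    using less by (simp add: flat_def)
  then show ?thesis
    by (rule has_field_derivative_transform_within_open[of _ _ _ "{..<0}"]) (use less in \<open>auto simp: flat_def\<close>)
next
  case equal
  \<comment> \<open>\<open>flat k 0\<close> is 0, so the difference quotient at zero is the next
    member of the family, which tends to 0.\<close>
  have "(flat k h - flat k 0) / h = flat (k + 1) h" for h
    by (simp add: flat_def field_simps)
  then have "((\<lambda>h. (flat k (0 + h) - flat k 0) / h) \<longlongrightarrow> 0) (at 0)"
    using flat_tendsto_zero[of "k + 1"] by simp
  then have "(flat k has_real_derivative 0) (at 0)" by (simp add: DERIV_def)
  then show ?thesis using equal by (simp add: flat_def)
next
  case greater
  have "((\<lambda>x. inverse x ^ k / exp (inverse x)) has_real_derivative flat (k + 2) x - k * flat (k + 1) x) (at x)"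
    using greater
    by (cases k) (auto intro!: derivative_eq_intros simp: flat_def field_simps power2_eq_square,
        metis One_nat_def power_eq_if)
  then show ?thesis
    by (rule has_field_derivative_transform_within_open[of _ _ _ "{0<..}"]) (use greater in \<open>auto simp: flat_def\<close>)
qed

text \<open>The invariant family for the bump \<open>flat 0 x * flat 0 (1 - x)\<close>; every member
  vanishes outside the unit interval.\<close>

inductive_set bump_span :: "(real \<Rightarrow> real) set" where
  basic: "(\<lambda>x. flat i x * flat j (1 - x)) \<in> bump_span"
| add: "\<phi> \<in> bump_span \<Longrightarrow> \<psi> \<in> bump_span \<Longrightarrow> (\<lambda>x. \<phi> x + \<psi> x) \<in> bump_span"
| scale: "\<phi> \<in> bump_span \<Longrightarrow> (\<lambda>x. c * \<phi> x) \<in> bump_span"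

lemma bump_span_derivative:
  "\<phi> \<in> bump_span \<Longrightarrow> \<exists>\<phi>'\<in>bump_span. \<forall>x. (\<phi> has_real_derivative \<phi>' x) (at x)"
proof (induction rule: bump_span.induct)
  case (basic i j)
  let ?f = "\<lambda>i j x. flat i x * flat j (1 - x)"
  let ?\<phi>' = "\<lambda>x. (?f (i + 2) j x + - real i * ?f (i + 1) j x) + (- 1 * ?f i (j + 2) x + real j * ?f i (j + 1) x)"
  have "?\<phi>' \<in> bump_span"
    by (intro bump_span.add bump_span.scale bump_span.basic)
  moreover have "(?f i j has_real_derivative ?\<phi>' x) (at x)" for x
  proof -
    have "((\<lambda>x. flat j (1 - x)) has_real_derivative (flat (j + 2) (1 - x) - j * flat (j + 1) (1 - x)) * (- 1)) (at x)"
      by (rule DERIV_chain2[OF flat_has_derivative]) (auto intro!: derivative_eq_intros)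
    from DERIV_mult'[OF flat_has_derivative[of i x] this] show ?thesis
      by (simp add: algebra_simps)
  qed
  ultimately show ?case by (intro bexI[of _ ?\<phi>'] allI)
next
  case (add \<phi> \<psi>)
  then obtain \<phi>' \<psi>' where "\<phi>' \<in> bump_span" "\<psi>' \<in> bump_span"
    "\<And>x. (\<phi> has_real_derivative \<phi>' x) (at x)" "\<And>x. (\<psi> has_real_derivative \<psi>' x) (at x)" by blast
  then show ?case
    by (intro bexI[of _ "\<lambda>x. \<phi>' x + \<psi>' x"]) (auto intro: bump_span.add DERIV_add)
next
  case (scale \<phi> c)
  then obtain \<phi>' where "\<phi>' \<in> bump_span" "\<And>x. (\<phi> has_real_derivative \<phi>' x) (at x)" by blast
  then show ?case
    by (intro bexI[of _ "\<lambda>x. c * \<phi>' x"]) (auto intro: bump_span.scale DERIV_cmult)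
qed

text \<open>\<theta> is the primitive of the bump \<beta>, divided by its total increase over the
  unit interval.\<close>

lemma smooth_step_exists:
  obtains \<theta> :: "real \<Rightarrow> real" where "smooth_fun \<theta>" "\<And>x. deriv \<theta> x \<ge> 0" "\<And>x. x \<le> 0 \<Longrightarrow> \<theta> x = 0" "\<And>x. x \<ge> 1 \<Longrightarrow> \<theta> x = 1"
    "\<And>x. x \<notin> {0..1} \<Longrightarrow> deriv \<theta> x = 0" "\<And>x. \<theta> x \<in> {0..1}"
proof -
  define \<beta> where "\<beta> x = flat 0 x * flat 0 (1 - x)" for x
  have \<beta>: "\<beta> \<in> bump_span" unfolding \<beta>_def by (rule bump_span.basic)
  have smooth_\<beta>: "smooth_fun \<beta>" using \<beta> bump_span_derivative by (rule smooth_fun_coinduct)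
  have "isCont \<beta> x" for x using smooth_fun_has_derivative[OF smooth_\<beta>] by (rule DERIV_isCont)
  then obtain B where "\<And>x. (B has_vector_derivative \<beta> x) (at x)"
    using einterval_antiderivative[of "- \<infinity>" \<infinity> \<beta>] by auto
  then have B: "(B has_real_derivative \<beta> x) (at x)" for x
    by (simp add: has_real_derivative_iff_has_vector_derivative)
  have \<beta>_nonneg: "\<beta> x \<ge> 0" for x by (simp add: \<beta>_def flat_def)
  have \<beta>_zero: "\<beta> x = 0" if "x \<le> 0 \<or> x \<ge> 1" for x using that by (auto simp: \<beta>_def flat_def)
  have mono: "B x \<le> B y" if "x \<le> y" for x y
    using that B \<beta>_nonneg by (intro DERIV_nonneg_imp_nondecreasing[of x y B]) auto
  have const: "B y = B x" if "x \<le> y" "y \<le> 0 \<or> x \<ge> 1" for x y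
  proof (rule antisym)
    show "B y \<le> B x"
    proof (rule DERIV_nonpos_imp_nonincreasing[OF that(1)])
      fix z assume "x \<le> z" "z \<le> y"
      then have "\<beta> z = 0" using that(2) by (intro \<beta>_zero) auto
      then show "\<exists>d. (B has_real_derivative d) (at z) \<and> d \<le> 0" using B[of z] by auto
    qed
  qed (rule mono[OF that(1)])
  have "B 0 < B 1"
  proof -
    obtain z where "0 < z" "z < 1" "B 1 - B 0 = (1 - 0) * \<beta> z"
      using MVT2[of 0 1 B \<beta>] B by auto
    moreover from this have "\<beta> z > 0" by (simp add: \<beta>_def flat_def)
    ultimately show ?thesis by simp
  qed
  define c where "c = 1 / (B 1 - B 0)"
  have c: "c > 0" using \<open>B 0 < B 1\<close> by (simp add: c_def)
  define \<theta> where "\<theta> x = c * (B x - B 0)" for x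
  have d\<theta>: "(\<theta> has_real_derivative c * \<beta> x) (at x)" for x
    unfolding \<theta>_def by (auto intro!: derivative_eq_intros B)
  then have deriv_\<theta>: "deriv \<theta> = (\<lambda>x. c * \<beta> x)" using DERIV_imp_deriv by blast
  show ?thesis
  proof
    show "smooth_fun \<theta>"
    proof (rule smooth_fun_coinduct[of _ "insert \<theta> bump_span"])
      fix \<psi> assume "\<psi> \<in> insert \<theta> bump_span"
      then consider "\<psi> = \<theta>" | "\<psi> \<in> bump_span" by blast
      then show "\<exists>\<psi>'\<in>insert \<theta> bump_span. \<forall>x. (\<psi> has_real_derivative \<psi>' x) (at x)"
      proof cases
        case 1
        then show ?thesis using d\<theta> bump_span.scale[OF \<beta>, of c] by (intro bexI[of _ "\<lambda>x. c * \<beta> x"]) auto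
      next
        case 2
        then show ?thesis using bump_span_derivative by blast
      qed
    qed simp
    show "deriv \<theta> x \<ge> 0" for x using c \<beta>_nonneg by (simp add: deriv_\<theta>)
    show "deriv \<theta> x = 0" if "x \<notin> {0..1}" for x using \<beta>_zero[of x] that by (auto simp: deriv_\<theta>)
    show 0: "\<theta> x = 0" if "x \<le> 0" for x using const[of x 0] that by (simp add: \<theta>_def)
    show 1: "\<theta> x = 1" if "x \<ge> 1" for x
      using const[of 1 x] that \<open>B 0 < B 1\<close> by (simp add: \<theta>_def c_def)
    show "\<theta> x \<in> {0..1}" for x
    proof -
      have "\<theta> (min 0 x) \<le> \<theta> x" "\<theta> x \<le> \<theta> (max 1 x)"
        unfolding \<theta>_def using c by (auto intro!: mult_left_mono mono)
      then show ?thesis using 0[of "min 0 x"] 1[of "max 1 x"] by simp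
    qed
  qed
qed

section \<open>Modifications on null sets and vanishing integrals\<close>

text \<open>Subsets of null sets are measurable for the completed measure, so a change on a null set
  cannot destroy measurability.\<close>

lemma borel_measurable_lebesgue_cong_AE:
  fixes f g :: "real \<Rightarrow> 'a::topological_space"
  assumes f: "f \<in> borel_measurable lebesgue" and eq: "AE x in lebesgue. f x = g x"
  shows "g \<in> borel_measurable lebesgue"
proof (rule measurableI)
  obtain N where N: "\<And>x. x \<in> space lebesgue - N \<Longrightarrow> f x = g x" "N \<in> null_sets lebesgue"
    by (rule AE_E3[OF eq]) blast
  fix S :: "'a set" assume S: "S \<in> sets borel"
  have "g -` S \<inter> N \<in> null_sets lebesgue" using N(2) by (rule null_sets_completion_subset[rotated]) simp
  moreover have "f -` S \<inter> space lebesgue \<in> sets lebesgue" using f S by (rule measurable_sets)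
  moreover have "g -` S \<inter> space lebesgue = (f -` S \<inter> space lebesgue - N) \<union> (g -` S \<inter> N)" using N(1) by auto
  ultimately show "g -` S \<inter> space lebesgue \<in> sets lebesgue"
    using N(2) by (metis null_setsD2 sets.Diff sets.Un)
qed auto

lemma integral_lebesgue_cong_AE:
  fixes f g :: "real \<Rightarrow> 'a::{banach, second_countable_topology}"
  assumes eq: "AE x in lebesgue. f x = g x"
  shows "integral\<^sup>L lebesgue f = integral\<^sup>L lebesgue g"
proof (cases "f \<in> borel_measurable lebesgue")
  case True
  then show ?thesis using eq borel_measurable_lebesgue_cong_AE[OF True eq] by (intro integral_cong_AE)
next
  \<comment> \<open>Neither function is measurable then, so both integrals have the default value
    0.\<close>
  case False
  moreover have "g \<notin> borel_measurable lebesgue"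
    using False eq borel_measurable_lebesgue_cong_AE[of g f] by (auto simp: eq_commute)
  ultimately show ?thesis by (metis borel_measurable_integrable not_integrable_integral_eq)
qed

lemma integrable_lebesgue_cong_AE:
  fixes f g :: "real \<Rightarrow> 'a::{banach, second_countable_topology}"
  assumes eq: "AE x in lebesgue. f x = g x" and f: "integrable lebesgue f"
  shows "integrable lebesgue g"
  using integrable_cong_AE[OF borel_measurable_integrable[OF f]
      borel_measurable_lebesgue_cong_AE[OF borel_measurable_integrable[OF f] eq] eq] f by simp

lemma AE_lebesgue_neq: "AE x in lebesgue. x \<noteq> (c::real)"
  by (rule AE_completion, rule AE_lborel_singleton)

lemma AE_indicator_Ioo_Icc:
  "AE x in lebesgue. indicator {a<..<b} x *\<^sub>R f x = indicator {a..b} x *\<^sub>R (f x :: 'a::real_vector)"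
  for a b :: real
  using AE_lebesgue_neq[of a] AE_lebesgue_neq[of b] by eventually_elim (auto simp: indicator_def)

lemma set_integral_Ioo_eq_Icc:
  fixes f :: "real \<Rightarrow> 'a::{banach, second_countable_topology}"
  shows "(LINT x:{a<..<b}|lebesgue. f x) = (LINT x:{a..b}|lebesgue. f x)"
  unfolding set_lebesgue_integral_def by (rule integral_lebesgue_cong_AE[OF AE_indicator_Ioo_Icc])

lemma set_integrable_Ioo_iff_Icc:
  fixes f :: "real \<Rightarrow> 'a::{banach, second_countable_topology}"
  shows "set_integrable lebesgue {a<..<b} f \<longleftrightarrow> set_integrable lebesgue {a..b} f"
  unfolding set_integrable_def
  using integrable_lebesgue_cong_AE[OF AE_indicator_Ioo_Icc[of a b f]]
    integrable_lebesgue_cong_AE[OF AE_symmetric[OF AE_indicator_Ioo_Icc[of a b f]]] by blast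

text \<open>For a Borel version of \<open>w\<close> the sets with vanishing integral are closed
  under complements and countable disjoint unions, and they contain the half-lines
  \<open>{..t}\<close>, which are stable under intersection; hence they are all Borel sets.\<close>

lemma interval_integrals_zero_imp_AE_zero:
  fixes w :: "real \<Rightarrow> real"
  assumes w: "set_integrable lebesgue {a..b} w"
    and zero: "\<And>t. t \<in> {a..b} \<Longrightarrow> (LINT x:{a..t}|lebesgue. w x) = 0"
  shows "AE x in lebesgue. x \<in> {a..b} \<longrightarrow> w x = 0"
proof (cases "a \<le> b")
  case True
  let ?f = "\<lambda>x. indicator {a..b} x *\<^sub>R w x"
  have f: "integrable lebesgue ?f" using w by (simp add: set_integrable_def)
  then obtain f' where f': "f' \<in> borel_measurable lborel" "AE x in lborel. ?f x = f' x"
    using completion_ex_borel_measurable_real[of ?f lborel] borel_measurable_integrable by blast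
  have AE: "AE x in lebesgue. ?f x = f' x" using f'(2) by (rule AE_completion)
  have int: "integrable lborel f'"
    using integrable_lebesgue_cong_AE[OF AE f] f'(1) by (simp add: integrable_completion)
  have set_int: "set_integrable lborel A f'" if "A \<in> sets borel" for A
    using integrable_mult_indicator[OF _ int, of A] that by (simp add: set_integrable_def)
  have stable: "Int_stable (range (\<lambda>t::real. {..t}))" by (auto simp: Int_stable_def)
  have "(LINT x:A|lborel. f' x) = 0" if "A \<in> sigma_sets UNIV (range (\<lambda>t. {..t}))" for A
    using stable subset_Pow_Union[of "range (\<lambda>t::real. {..t})", THEN order.trans, OF Pow_mono[OF subset_UNIV]] that
  proof (induction rule: sigma_sets_induct_disjoint)
    case (basic A)
    then obtain t where A: "A = {..t}" by auto
    have "(LINT x:A|lborel. f' x) = (LINT x:A|lebesgue. f' x)"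
      unfolding set_lebesgue_integral_def using f'(1) A by (intro integral_completion[symmetric]) auto
    also have "\<dots> = (LINT x:{a..min t b}|lebesgue. w x)"
      unfolding set_lebesgue_integral_def
    proof (rule integral_lebesgue_cong_AE)
      show "AE x in lebesgue. indicator A x *\<^sub>R f' x = indicator {a..min t b} x *\<^sub>R w x"
        using AE by eventually_elim (auto simp: A indicator_def split: if_splits)
    qed
    also have "\<dots> = 0"
    proof (cases "a \<le> t")
      case True
      then show ?thesis using \<open>a \<le> b\<close> by (intro zero) auto
    qed (simp add: set_lebesgue_integral_def)
    finally show ?case .
  next
    case (compl A)
    then have A: "A \<in> sets borel" by (simp add: borel_eq_atMost)
    have "(LINT x:UNIV|lborel. f' x) = (LINT x:UNIV - A|lborel. f' x) + (LINT x:A|lborel. f' x)"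
      using set_integral_Un[of "UNIV - A" A lborel f'] set_int A by auto
    \<comment> \<open>The total integral is the hypothesis at \<open>t = b\<close>; this covers
      complements.\<close>
    moreover have "(LINT x:UNIV|lborel. f' x) = (LINT x:{a..b}|lebesgue. w x)"
      unfolding set_lebesgue_integral_def
      using integral_completion[OF f'(1)] integral_lebesgue_cong_AE[OF AE] by simp
    ultimately show ?case using compl.IH zero[of b] \<open>a \<le> b\<close> by simp
  next
    case (union A)
    then have A: "A i \<in> sets borel" for i by (auto simp: borel_eq_atMost)
    have "(LINT x:(\<Union>i. A i)|lborel. f' x) = (\<Sum>i. (LINT x:(A i)|lborel. f' x))"
      using union A by (intro lebesgue_integral_countable_add set_int) (auto simp: disjoint_family_on_def)
    then show ?case using union by simp
  qed (auto simp: set_lebesgue_integral_def)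
  then have "(LINT x:A|lborel. f' x) = 0" if "A \<in> sets lborel" for A
    using that by (simp add: borel_eq_atMost)
  then have "AE x in lborel. f' x = 0" using int by (intro sigma_finite_measure.density_zero[OF sigma_finite_lborel]) auto
  then have "AE x in lebesgue. f' x = 0" by (rule AE_completion)
  with AE show ?thesis by eventually_elim (auto simp: indicator_def split: if_splits)
qed auto

section \<open>Weak derivatives of functions of one real variable\<close>

text \<open>A smooth approximation of the indicator of \<open>{s<..t}\<close>: one step switched on
  after \<open>s\<close>, one subtracted after \<open>t\<close>. The bound
  \<open>t + 1 / n < b\<close> keeps the support inside the open interval.\<close>

lemma plateau_test_fun:
  assumes \<theta>: "smooth_fun \<theta>" "\<And>x. x \<le> 0 \<Longrightarrow> \<theta> x = 0" "\<And>x. x \<ge> 1 \<Longrightarrow> \<theta> x = 1"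
    and n: "n > 0" and st: "a < s" "s \<le> t" "t + 1 / n < b"
  shows "(\<lambda>x. \<theta> (n * (x - s)) - \<theta> (n * (x - t))) \<in> test_funs a b"
    and "deriv (\<lambda>x. \<theta> (n * (x - s)) - \<theta> (n * (x - t))) x = n * deriv \<theta> (n * (x - s)) - n * deriv \<theta> (n * (x - t))"
proof -
  \<comment> \<open>The free coefficient \<open>c\<close> absorbs the factor \<open>n\<close>
    produced by the chain rule, so this family is closed under differentiation.\<close>
  let ?S = "{\<lambda>x. c * \<Phi> (n * (x - s)) - c * \<Phi> (n * (x - t)) | c \<Phi>. smooth_fun \<Phi>}"
  have d: "((\<lambda>x. c * \<Phi> (n * (x - s)) - c * \<Phi> (n * (x - t))) has_real_derivative
      (c * n) * deriv \<Phi> (n * (x - s)) - (c * n) * deriv \<Phi> (n * (x - t))) (at x)" if "smooth_fun \<Phi>" for c \<Phi> x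
  proof -
    have "((\<lambda>x. \<Phi> (n * (x - r))) has_real_derivative deriv \<Phi> (n * (x - r)) * n) (at x)" for r
      by (rule DERIV_chain2[OF smooth_fun_has_derivative[OF that]]) (auto intro!: derivative_eq_intros)
    from DERIV_diff[OF DERIV_cmult[OF this] DERIV_cmult[OF this]] show ?thesis by (simp add: mult_ac)
  qed
  let ?\<phi> = "\<lambda>x. \<theta> (n * (x - s)) - \<theta> (n * (x - t))"
  have "smooth_fun ?\<phi>"
  proof (rule smooth_fun_coinduct[of _ ?S])
    show "?\<phi> \<in> ?S" using \<theta>(1) by (auto intro!: exI[of _ 1] exI[of _ \<theta>])
    fix \<psi> assume "\<psi> \<in> ?S"
    then obtain c \<Phi> where \<psi>: "\<psi> = (\<lambda>x. c * \<Phi> (n * (x - s)) - c * \<Phi> (n * (x - t)))" "smooth_fun \<Phi>" by blast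
    have "(\<lambda>x. (c * n) * deriv \<Phi> (n * (x - s)) - (c * n) * deriv \<Phi> (n * (x - t))) \<in> ?S"
      using smooth_fun_deriv[OF \<psi>(2)] by blast
    moreover have "\<forall>x. (\<psi> has_real_derivative (c * n) * deriv \<Phi> (n * (x - s)) - (c * n) * deriv \<Phi> (n * (x - t))) (at x)"
      unfolding \<psi>(1) using d[OF \<psi>(2)] by simp
    ultimately show "\<exists>\<psi>'\<in>?S. \<forall>x. (\<psi> has_real_derivative \<psi>' x) (at x)"
      by (intro bexI[of _ "\<lambda>x. (c * n) * deriv \<Phi> (n * (x - s)) - (c * n) * deriv \<Phi> (n * (x - t))"])
  qed
  moreover have "?\<phi> x = 0" if "x \<notin> {s..t + 1 / n}" for x
  proof (cases "x < s")
    case True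
    then have "n * (x - s) \<le> 0" "n * (x - t) \<le> 0" using n st by (auto simp: mult_le_0_iff)
    then show ?thesis by (simp add: \<theta>)
  next
    case False
    with that have "x > t + 1 / n" by auto
    then have "1 / n \<le> x - t" "1 / n \<le> x - s" using st by auto
    then have "n * (x - t) \<ge> 1" "n * (x - s) \<ge> 1" using n by (auto simp: field_simps)
    then show ?thesis by (simp add: \<theta>)
  qed
  moreover have "s \<le> t + 1 / n" using st n by (simp add: add_increasing2)
  ultimately show "?\<phi> \<in> test_funs a b"
    unfolding test_funs_def smooth_fun_def using st by blast
  show "deriv ?\<phi> x = n * deriv \<theta> (n * (x - s)) - n * deriv \<theta> (n * (x - t))"
    using DERIV_imp_deriv[OF d[OF \<theta>(1), of 1 x]] by simp
qed

lemma smooth_fun_affine_continuous: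
  assumes "smooth_fun \<Phi>"
  shows "continuous_on A (\<lambda>x. \<Phi> (c * (x - r)))"
proof -
  have "isCont \<Phi> x" for x using smooth_fun_has_derivative[OF assms] by (rule DERIV_isCont)
  then have "continuous_on UNIV \<Phi>" by (simp add: continuous_at_imp_continuous_on)
  then show ?thesis by (rule continuous_on_compose2) (auto intro!: continuous_intros)
qed

text \<open>For large \<open>n\<close> the weights are nonnegative, have integral 1 and live on
  \<open>{s..s + 1 / n}\<close>: a one-sided approximate identity at \<open>s\<close>.\<close>

lemma mollifier_tendsto:
  fixes U :: "real \<Rightarrow> real"
  assumes \<theta>: "smooth_fun \<theta>" "\<And>x. x \<le> 0 \<Longrightarrow> \<theta> x = 0" "\<And>x. x \<ge> 1 \<Longrightarrow> \<theta> x = 1"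
      "\<And>x. deriv \<theta> x \<ge> 0" "\<And>x. x \<notin> {0..1} \<Longrightarrow> deriv \<theta> x = 0"
    and U: "continuous_on {a..b} U" and s: "a < s" "s < b"
  shows "(\<lambda>n. LINT x:{a..b}|lebesgue. (real n * deriv \<theta> (real n * (x - s))) * U x) \<longlonglongrightarrow> U s"
proof (rule LIMSEQ_I)
  fix e :: real assume e: "e > 0"
  have cont: "continuous_on A (\<lambda>x. real n * deriv \<theta> (real n * (x - s)))" for A n
    by (intro continuous_on_mult_left smooth_fun_affine_continuous smooth_fun_deriv \<theta>)
  have "s \<in> {a..b}" using s by simp
  then obtain \<delta> where \<delta>: "\<delta> > 0" "\<And>x. x \<in> {a..b} \<Longrightarrow> \<bar>x - s\<bar> < \<delta> \<Longrightarrow> \<bar>U x - U s\<bar> < e / 2"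
    using U e unfolding continuous_on_iff dist_real_def by (metis half_gt_zero)
  obtain N0 :: nat where "inverse (real (Suc N0)) < min \<delta> (b - s)"
    using \<delta>(1) s reals_Archimedean[of "min \<delta> (b - s)"] by auto
  then obtain N :: nat where N: "real N > 0" "1 / real N < min \<delta> (b - s)"
    by (intro that[of "Suc N0"]) (simp_all only: inverse_eq_divide of_nat_0_less_iff zero_less_Suc)
  have "norm ((LINT x:{a..b}|lebesgue. (real n * deriv \<theta> (real n * (x - s))) * U x) - U s) < e" if n: "n \<ge> N" for n
  proof -
    have n0: "real n > 0" using N n by linarith
    have "1 / real n \<le> 1 / real N" using N n by (intro divide_left_mono) auto
    then have n1: "1 / real n < \<delta>" "1 / real n < b - s" using N by auto
    let ?k = "\<lambda>x. real n * deriv \<theta> (real n * (x - s))"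
    have d: "((\<lambda>x. \<theta> (real n * (x - s))) has_real_derivative ?k x) (at x within {a..b})" for x
    proof (rule has_field_derivative_at_within)
      have "((\<lambda>x. \<theta> (real n * (x - s))) has_real_derivative deriv \<theta> (real n * (x - s)) * real n) (at x)"
        by (rule DERIV_chain2[OF smooth_fun_has_derivative[OF \<theta>(1)]]) (auto intro!: derivative_eq_intros)
      then show "((\<lambda>x. \<theta> (real n * (x - s))) has_real_derivative ?k x) (at x)" by (simp add: mult.commute)
    qed
    have "(?k has_integral \<theta> (real n * (b - s)) - \<theta> (real n * (a - s))) {a..b}"
      using s d by (intro fundamental_theorem_of_calculus) (auto simp: has_real_derivative_iff_has_vector_derivative)
    moreover have "\<theta> (real n * (b - s)) = 1" using n0 n1 by (intro \<theta>) (simp add: field_simps)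
    moreover have "\<theta> (real n * (a - s)) = 0" using n0 s by (intro \<theta>) (simp add: mult_le_0_iff)
    ultimately have k1: "(?k has_integral 1) {a..b}" by simp
    have kU: "continuous_on {a..b} (\<lambda>x. ?k x * U x)" by (rule continuous_on_mult[OF cont U])
    have kc: "continuous_on {a..b} (\<lambda>x. ?k x * c)" for c by (rule continuous_on_mult[OF cont continuous_on_const])
    have "(LINT x:{a..b}|lebesgue. ?k x * U x) = integral {a..b} (\<lambda>x. ?k x * U x)"
      by (rule set_lebesgue_integral_eq_integral[OF set_integrable_continuous_on_interval[OF kU]])
    then have "(LINT x:{a..b}|lebesgue. ?k x * U x) - U s = integral {a..b} (\<lambda>x. ?k x * U x) - integral {a..b} (\<lambda>x. ?k x * U s)"
      using integral_unique[OF has_integral_mult_left[OF k1, of "U s"]] by (simp only: mult_1)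
    also have "\<dots> = integral {a..b} (\<lambda>x. ?k x * U x - ?k x * U s)"
      by (intro Henstock_Kurzweil_Integration.integral_diff[symmetric] integrable_continuous_interval kU kc)
    finally have eq: "(LINT x:{a..b}|lebesgue. ?k x * U x) - U s = integral {a..b} (\<lambda>x. ?k x * U x - ?k x * U s)" .
    have "norm (integral {a..b} (\<lambda>x. ?k x * U x - ?k x * U s)) \<le> integral {a..b} (\<lambda>x. ?k x * (e / 2))"
    proof (rule integral_norm_bound_integral)
      show "(\<lambda>x. ?k x * U x - ?k x * U s) integrable_on {a..b}" "(\<lambda>x. ?k x * (e / 2)) integrable_on {a..b}"
        by (intro integrable_continuous_interval continuous_on_diff[OF kU kc] kc)+
      fix x assume x: "x \<in> {a..b}"
      show "norm (?k x * U x - ?k x * U s) \<le> ?k x * (e / 2)"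
      proof (cases "real n * (x - s) \<in> {0..1}")
        case True
        then have "0 \<le> x - s" "x - s \<le> 1 / real n" using n0 by (auto simp: field_simps zero_le_mult_iff)
        then have "\<bar>U x - U s\<bar> < e / 2" using n1 x by (intro \<delta>) auto
        then have "?k x * \<bar>U x - U s\<bar> \<le> ?k x * (e / 2)" using n0 \<theta>(4) by (intro mult_left_mono) auto
        moreover have "norm (?k x * U x - ?k x * U s) = ?k x * \<bar>U x - U s\<bar>"
          using n0 \<theta>(4)[of "real n * (x - s)"] by (simp add: abs_mult flip: right_diff_distrib)
        ultimately show ?thesis by simp
      qed (use \<theta>(5) in simp)
    qed
    then have "norm (integral {a..b} (\<lambda>x. ?k x * U x - ?k x * U s)) \<le> 1 * (e / 2)"
      unfolding integral_unique[OF has_integral_mult_left[OF k1, of "e / 2"]] .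
    then show ?thesis unfolding eq using e by linarith
  qed
  then show "\<exists>N. \<forall>n\<ge>N. norm ((LINT x:{a..b}|lebesgue. (real n * deriv \<theta> (real n * (x - s))) * U x) - U s) < e" by blast
qed

text \<open>Testing with plateaus, the left side tends to \<open>U s - U t\<close> by mollification
  and the right side to minus the integral of \<open>w\<close> over \<open>{s..t}\<close> by
  dominated convergence. So \<open>U\<close> minus the primitive of \<open>w\<close> is constant on
  the open interval, and by continuity on the closed one.\<close>

lemma weak_deriv_continuous_eq_integral:
  fixes U w :: "real \<Rightarrow> real"
  assumes weak: "weak_deriv_on a b U w" and U: "continuous_on {a..b} U"
    and w: "set_integrable lebesgue {a..b} w" and x: "x \<in> {a..b}"
  shows "U x = U a + (LINT y:{a..x}|lebesgue. w y)"
proof -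
  obtain \<theta> where \<theta>: "smooth_fun \<theta>" "\<And>x. deriv \<theta> x \<ge> 0" "\<And>x. x \<le> 0 \<Longrightarrow> \<theta> x = 0" "\<And>x. x \<ge> 1 \<Longrightarrow> \<theta> x = 1"
    "\<And>x. x \<notin> {0..1} \<Longrightarrow> deriv \<theta> x = 0" "\<And>x. \<theta> x \<in> {0..1}"
    by (rule smooth_step_exists) blast
  have int_w: "w integrable_on {a..b}" by (rule set_lebesgue_integral_eq_integral[OF w])
  have sub_eq: "(LINT y:{c..d}|lebesgue. w y) = integral {c..d} w" if "a \<le> c" "d \<le> b" for c d
    using that by (intro set_lebesgue_integral_eq_integral set_integrable_subset[OF w]) auto
  have step: "U t - U s = integral {s..t} w" if st: "a < s" "s \<le> t" "t < b" for s t
  proof -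
    define \<phi> where "\<phi> n x = \<theta> (real n * (x - s)) - \<theta> (real n * (x - t))" for n x
    obtain N0 :: nat where "inverse (real (Suc N0)) < b - t"
      using reals_Archimedean[of "b - t"] st by auto
    then obtain N :: nat where N: "real N > 0" "1 / real N < b - t"
      by (intro that[of "Suc N0"]) (simp_all only: inverse_eq_divide of_nat_0_less_iff zero_less_Suc)
    have N': "real n > 0" "t + 1 / real n < b" if "n \<ge> N" for n
    proof -
      show "real n > 0" using N that by linarith
      have "1 / real n \<le> 1 / real N" using N that by (intro divide_left_mono) auto
      then show "t + 1 / real n < b" using N by linarith
    qed
    have "(\<lambda>n. LINT x:{a..b}|lebesgue. (real n * deriv \<theta> (real n * (x - r))) * U x) \<longlonglongrightarrow> U r" if "a < r" "r < b" for r
      by (rule mollifier_tendsto[OF \<theta>(1,3,4,2,5) U that])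
    then have lim1: "(\<lambda>n. (LINT x:{a..b}|lebesgue. (real n * deriv \<theta> (real n * (x - s))) * U x)
        - (LINT x:{a..b}|lebesgue. (real n * deriv \<theta> (real n * (x - t))) * U x)) \<longlonglongrightarrow> U s - U t"
      using st by (intro tendsto_diff) auto
    have cont: "continuous_on A (\<lambda>x. real n * deriv \<theta> (real n * (x - r)))" for A n r
      by (intro continuous_on_mult_left smooth_fun_affine_continuous smooth_fun_deriv \<theta>)
    have eq: "(LINT x:{a..b}|lebesgue. (real n * deriv \<theta> (real n * (x - s))) * U x)
        - (LINT x:{a..b}|lebesgue. (real n * deriv \<theta> (real n * (x - t))) * U x)
        = - (LINT x:{a..b}|lebesgue. \<phi> n x * w x)" if n: "n \<ge> N" for n
    proof -
      note \<phi>n = plateau_test_fun[OF \<theta>(1,3,4) N'(1)[OF n] st(1,2) N'(2)[OF n], folded \<phi>_def]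
      have "(LINT x:{a..b}|lebesgue. deriv (\<phi> n) x * U x) = - (LINT x:{a..b}|lebesgue. \<phi> n x * w x)"
        using weak \<phi>n(1) unfolding weak_deriv_on_def set_integral_Ioo_eq_Icc by (auto simp: \<phi>_def[abs_def])
      moreover have "deriv (\<phi> n) x * U x = (real n * deriv \<theta> (real n * (x - s))) * U x - (real n * deriv \<theta> (real n * (x - t))) * U x" for x
        using \<phi>n(2)[of x] by (simp add: \<phi>_def[abs_def] left_diff_distrib)
      ultimately show ?thesis
        by (subst set_integral_diff(2)[symmetric]) (auto intro!: set_integrable_continuous_on_interval continuous_on_mult[OF cont U])
    qed
    have "(\<lambda>n. LINT x:{a..b}|lebesgue. \<phi> n x * w x) \<longlonglongrightarrow> (\<integral>x. indicator {s<..t} x * (indicator {a..b} x *\<^sub>R w x) \<partial>lebesgue)"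
      unfolding set_lebesgue_integral_def
    proof (rule integral_dominated_convergence[where w = "\<lambda>x. norm (indicator {a..b} x *\<^sub>R w x)"])
      have wm: "(\<lambda>x. indicator {a..b} x *\<^sub>R w x) \<in> borel_measurable lebesgue"
        using w by (auto simp: set_integrable_def)
      have \<phi>m: "\<phi> n \<in> borel_measurable lebesgue" for n
      proof -
        have "continuous_on UNIV (\<phi> n)"
          unfolding \<phi>_def by (intro continuous_on_diff smooth_fun_affine_continuous \<theta>)
        then show ?thesis by (intro measurable_completion) (simp add: borel_measurable_continuous_onI)
      qed
      show "(\<lambda>x. indicator {s<..t} x * (indicator {a..b} x *\<^sub>R w x)) \<in> borel_measurable lebesgue"
        by (intro borel_measurable_times borel_measurable_indicator wm) simp
      show "(\<lambda>x. indicator {a..b} x *\<^sub>R (\<phi> n x * w x)) \<in> borel_measurable lebesgue" for n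
        using borel_measurable_times[OF \<phi>m wm] by (simp add: mult_ac)
      show "integrable lebesgue (\<lambda>x. norm (indicator {a..b} x *\<^sub>R w x))"
        using w by (simp only: set_integrable_def integrable_norm)
      show "AE x in lebesgue. norm (indicator {a..b} x *\<^sub>R (\<phi> n x * w x)) \<le> norm (indicator {a..b} x *\<^sub>R w x)" for n
      proof (rule AE_I2)
        fix x
        have "\<bar>\<phi> n x\<bar> \<le> 1" using \<theta>(6)[of "real n * (x - s)"] \<theta>(6)[of "real n * (x - t)"] by (auto simp: \<phi>_def)
        then show "norm (indicator {a..b} x *\<^sub>R (\<phi> n x * w x)) \<le> norm (indicator {a..b} x *\<^sub>R w x)"
          by (auto simp: indicator_def abs_mult mult_left_le_one_le)
      qed
      have one: "\<forall>\<^sub>F n in sequentially. \<theta> (real n * y) = 1" if y: "y > 0" for y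
      proof -
        obtain M :: nat where M: "1 / y < real M" using reals_Archimedean2 by blast
        show ?thesis using eventually_ge_at_top[of M]
        proof eventually_elim
          case (elim n)
          then have "1 / y \<le> real n" using M by linarith
          then show ?case using y by (intro \<theta>(4)) (simp add: field_simps)
        qed
      qed
      have zero: "\<theta> (real n * y) = 0" if "y \<le> 0" for n y
        using that by (intro \<theta>(3)) (simp add: mult_nonneg_nonpos)
      \<comment> \<open>\<open>\<theta> 0 = 0\<close> decides the end points: the value at
        \<open>s\<close> is 0, and at \<open>t > s\<close> it is eventually 1.\<close>
      have "(\<lambda>n. \<phi> n x) \<longlonglongrightarrow> indicator {s<..t} x" for x
      proof (rule tendsto_eventually)
        consider "x \<le> s" | "s < x" "x \<le> t" | "t < x" by linarith
        then show "\<forall>\<^sub>F n in sequentially. \<phi> n x = indicator {s<..t} x"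
        proof cases
          case 1
          then show ?thesis using st by (simp add: \<phi>_def zero)
        next
          case 2
          have "\<forall>\<^sub>F n in sequentially. \<theta> (real n * (x - s)) = 1" using 2 by (intro one) simp
          then show ?thesis by eventually_elim (use 2 in \<open>simp add: \<phi>_def zero\<close>)
        next
          case 3
          have "\<forall>\<^sub>F n in sequentially. \<theta> (real n * (x - s)) = 1" "\<forall>\<^sub>F n in sequentially. \<theta> (real n * (x - t)) = 1"
            using 3 st by (intro one; simp)+
          then show ?thesis by eventually_elim (use 3 in \<open>simp add: \<phi>_def\<close>)
        qed
      qed
      then show "AE x in lebesgue. (\<lambda>n. indicator {a..b} x *\<^sub>R (\<phi> n x * w x)) \<longlonglongrightarrow>
          indicator {s<..t} x * (indicator {a..b} x *\<^sub>R w x)"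
        by (intro AE_I2) (auto simp: indicator_def intro!: tendsto_eq_intros)
    qed
    moreover have "(\<integral>x. indicator {s<..t} x * (indicator {a..b} x *\<^sub>R w x) \<partial>lebesgue) = (LINT x:{s..t}|lebesgue. w x)"
      unfolding set_lebesgue_integral_def
    proof (rule integral_lebesgue_cong_AE)
      show "AE x in lebesgue. indicator {s<..t} x * (indicator {a..b} x *\<^sub>R w x) = indicator {s..t} x *\<^sub>R w x"
        using AE_lebesgue_neq[of s] by eventually_elim (use st in \<open>auto simp: indicator_def\<close>)
    qed
    ultimately have lim2: "(\<lambda>n. - (LINT x:{a..b}|lebesgue. \<phi> n x * w x)) \<longlonglongrightarrow> - (LINT x:{s..t}|lebesgue. w x)"
      by (simp add: tendsto_minus)
    have "\<forall>\<^sub>F n in sequentially. (LINT x:{a..b}|lebesgue. (real n * deriv \<theta> (real n * (x - s))) * U x)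
        - (LINT x:{a..b}|lebesgue. (real n * deriv \<theta> (real n * (x - t))) * U x) = - (LINT x:{a..b}|lebesgue. \<phi> n x * w x)"
      using eventually_ge_at_top[of N] by eventually_elim (rule eq)
    from LIMSEQ_unique[OF Lim_transform_eventually[OF lim1 this] lim2]
    have "U s - U t = - (LINT x:{s..t}|lebesgue. w x)" .
    then show ?thesis using sub_eq[of s t] st by simp
  qed
  define D where "D x = U x - integral {a..x} w" for x
  have cont_D: "continuous_on {a..b} D"
    unfolding D_def using U int_w by (intro continuous_intros indefinite_integral_continuous_1)
  have "D x = D a"
  proof (cases "a < b")
    case True
    define c where "c = (a + b) / 2"
    have c: "a < c" "c < b" using True by (auto simp: c_def)
    have D_le: "D t = D s" if "a < s" "s \<le> t" "t < b" for s t
      using step[OF that] Henstock_Kurzweil_Integration.integral_combine[of a s t w] that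
        integrable_subinterval_real[OF int_w, of a t] by (simp add: D_def)
    have "D y = D c" if "y \<in> {a<..<b}" for y
      using D_le[of y c] D_le[of c y] c that by (cases "y \<le> c") auto
    moreover have "closure {a<..<b} = {a..b}" using True by simp
    ultimately have "D y = D c" if "y \<in> {a..b}" for y
      using continuous_constant_on_closure[of "{a<..<b}" D "D c" y] cont_D that by auto
    then show ?thesis using x True by simp
  next
    case False
    then have "x = a" using x by simp
    then show ?thesis by simp
  qed
  then show ?thesis using sub_eq[of a x] x by (simp add: D_def)
qed

text \<open>The orthogonality says that the zero function has weak derivative \<open>w\<close>; the
  integral formula then makes all integrals of \<open>w\<close> from \<open>a\<close>
  vanish.\<close>

lemma test_orthogonal_imp_AE_zero:
  fixes w :: "real \<Rightarrow> real"
  assumes w: "set_integrable lebesgue {a..b} w"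
    and orth: "\<And>\<phi>. \<phi> \<in> test_funs a b \<Longrightarrow> (LINT x:{a..b}|lebesgue. \<phi> x * w x) = 0"
  shows "AE x in lebesgue. x \<in> {a..b} \<longrightarrow> w x = 0"
proof (rule interval_integrals_zero_imp_AE_zero[OF w])
  have "weak_deriv_on a b (\<lambda>_. 0) w"
    using orth by (simp add: weak_deriv_on_def set_integral_Ioo_eq_Icc)
  then show "(LINT x:{a..t}|lebesgue. w x) = 0" if "t \<in> {a..b}" for t
    using weak_deriv_continuous_eq_integral[OF _ continuous_on_const w that] by fastforce
qed

lemma test_fun_smooth: "\<phi> \<in> test_funs a b \<Longrightarrow> smooth_fun \<phi>"
  by (simp add: test_funs_def smooth_fun_def)

lemma smooth_fun_continuous_on: "smooth_fun \<phi> \<Longrightarrow> continuous_on A \<phi>"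
  using smooth_fun_affine_continuous[of \<phi> A 1 0] by simp

lemma set_integrable_continuous_scaleR:
  fixes f :: "real \<Rightarrow> 'a::{banach, second_countable_topology}"
  assumes k: "continuous_on {a..b} k" and f: "set_integrable lebesgue {a..b} f"
  shows "set_integrable lebesgue {a..b} (\<lambda>t. k t *\<^sub>R f t)"
proof -
  obtain K where K: "\<And>x. x \<in> {a..b} \<Longrightarrow> norm (k x) \<le> K"
    using compact_imp_bounded[OF compact_continuous_image[OF k compact_Icc]] unfolding bounded_iff by blast
  have km: "(\<lambda>x. indicator {a..b} x *\<^sub>R k x) \<in> borel_measurable lebesgue"
    using set_integrable_continuous_on_interval[OF k] by (auto simp: set_integrable_def)
  have fm: "(\<lambda>x. indicator {a..b} x *\<^sub>R f x) \<in> borel_measurable lebesgue"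
    using f by (auto simp: set_integrable_def)
  have "(\<lambda>x. (indicator {a..b} x *\<^sub>R k x) *\<^sub>R (indicator {a..b} x *\<^sub>R f x)) \<in> borel_measurable lebesgue"
    by (rule borel_measurable_scaleR[OF km fm])
  also have "(\<lambda>x. (indicator {a..b} x *\<^sub>R k x) *\<^sub>R (indicator {a..b} x *\<^sub>R f x)) = (\<lambda>x. indicator {a..b} x *\<^sub>R k x *\<^sub>R f x)"
    by (auto simp: indicator_def)
  finally have m: "(\<lambda>x. indicator {a..b} x *\<^sub>R k x *\<^sub>R f x) \<in> borel_measurable lebesgue" .
  show ?thesis
    unfolding set_integrable_def
  proof (rule Bochner_Integration.integrable_bound[OF _ m])
    show "integrable lebesgue (\<lambda>x. K *\<^sub>R (indicator {a..b} x *\<^sub>R f x))"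
      using f unfolding set_integrable_def by (rule integrable_scaleR_right)
    have "norm (indicator {a..b} x *\<^sub>R k x *\<^sub>R f x) \<le> norm (K *\<^sub>R (indicator {a..b} x *\<^sub>R f x))" for x
      using K[of x] by (auto simp: indicator_def intro!: mult_right_mono)
    then show "AE x in lebesgue. norm (indicator {a..b} x *\<^sub>R k x *\<^sub>R f x) \<le> norm (K *\<^sub>R (indicator {a..b} x *\<^sub>R f x))"
      by (rule AE_I2)
  qed
qed

section \<open>Hilbert-valued Sobolev functions of time\<close>

lemma weak_deriv_on_inner:
  fixes f f' :: "real \<Rightarrow> 'a::{real_inner, banach, second_countable_topology}"
  assumes weak: "weak_deriv_on a b f f'" and f: "set_integrable lebesgue {a..b} f" "set_integrable lebesgue {a..b} f'"
  shows "weak_deriv_on a b (\<lambda>t. f t \<bullet> v) (\<lambda>t. f' t \<bullet> v)"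
  unfolding weak_deriv_on_def set_integral_Ioo_eq_Icc
proof
  fix \<phi> assume \<phi>: "\<phi> \<in> test_funs a b"
  have c: "continuous_on {a..b} \<phi>" "continuous_on {a..b} (deriv \<phi>)"
    using test_fun_smooth[OF \<phi>] smooth_fun_deriv smooth_fun_continuous_on by auto
  have "(LINT t:{a..b}|lebesgue. deriv \<phi> t *\<^sub>R f t) \<bullet> v = - (LINT t:{a..b}|lebesgue. \<phi> t *\<^sub>R f' t) \<bullet> v"
    using weak \<phi> unfolding weak_deriv_on_def set_integral_Ioo_eq_Icc by simp
  then show "(LINT t:{a..b}|lebesgue. deriv \<phi> t *\<^sub>R (f t \<bullet> v)) = - (LINT t:{a..b}|lebesgue. \<phi> t *\<^sub>R (f' t \<bullet> v))"
    using set_integral_bounded_linear[OF bounded_linear_inner_left set_integrable_continuous_scaleR[OF c(2) f(1)], of v]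
      set_integral_bounded_linear[OF bounded_linear_inner_left set_integrable_continuous_scaleR[OF c(1) f(2)], of v]
    by simp
qed

text \<open>On a bounded interval the inequality norm y \<le> 1 + (norm y)^2 turns square
  integrability into integrability.\<close>

lemma L2_time_set_integrable:
  assumes "f \<in> L2_time T X"
  shows "set_integrable lebesgue {0..T} f"
proof -
  have m: "(\<lambda>x. indicator {0<..<T} x *\<^sub>R f x) \<in> borel_measurable lebesgue"
    and i: "integrable lebesgue (\<lambda>x. indicator {0<..<T} x *\<^sub>R (norm (f x))\<^sup>2)"
    using assms by (auto simp: L2_time_def set_borel_measurable_def set_integrable_def)
  have one: "integrable lebesgue (\<lambda>x. indicator {0<..<T} x :: real)"
    using set_integrable_continuous_on_interval[of 0 T "\<lambda>_. 1 :: real"]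
    unfolding set_integrable_Ioo_iff_Icc[symmetric] by (simp add: set_integrable_def)
  have "integrable lebesgue (\<lambda>x. indicator {0<..<T} x *\<^sub>R f x)"
  proof (rule Bochner_Integration.integrable_bound[OF Bochner_Integration.integrable_add[OF one i] m])
    have "norm y \<le> 1 + (norm y)\<^sup>2" for y :: 'a
    proof -
      have "2 * norm y \<le> 1 + (norm y)\<^sup>2"
        using zero_le_power2[of "norm y - 1"] by (simp add: power2_eq_square algebra_simps)
      then show ?thesis using norm_ge_zero[of y] by linarith
    qed
    then show "AE x in lebesgue. norm (indicator {0<..<T} x *\<^sub>R f x)
        \<le> norm (indicator {0<..<T} x + indicator {0<..<T} x *\<^sub>R (norm (f x))\<^sup>2)"
      by (intro AE_I2) (auto simp: indicator_def)
  qed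
  then show ?thesis unfolding set_integrable_Ioo_iff_Icc[symmetric] by (simp only: set_integrable_def)
qed

text \<open>The scalar functions \<open>f t \<bullet> v\<close> obey the one-variable formula, and a
  vector is determined by its inner products.\<close>

lemma weak_deriv_has_integrable_derivative:
  fixes f f' :: "real \<Rightarrow> 'a::{real_inner, banach, second_countable_topology}"
  assumes weak: "weak_deriv_on 0 T f f'" and f: "continuous_on {0..T} f" and f': "set_integrable lebesgue {0..T} f'"
    and t: "t \<in> {0..T}"
  shows "f t = f 0 + (LINT s:{0..t}|lebesgue. f' s)"
proof (rule vector_eq_rdot[THEN iffD1, rule_format])
  fix v
  have "f t \<bullet> v = f 0 \<bullet> v + (LINT s:{0..t}|lebesgue. f' s \<bullet> v)"
    by (rule weak_deriv_continuous_eq_integral[OF weak_deriv_on_inner[OF weak set_integrable_continuous_on_interval[OF f] f'] _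
          set_integrable_bounded_linear[OF bounded_linear_inner_left f'] t]) (intro continuous_intros f)
  moreover have "set_integrable lebesgue {0..t} f'" using t by (intro set_integrable_subset[OF f']) auto
  ultimately show "f t \<bullet> v = (f 0 + (LINT s:{0..t}|lebesgue. f' s)) \<bullet> v"
    by (simp add: set_integral_bounded_linear[OF bounded_linear_inner_left] inner_add_left)
qed

lemma H1_time_has_integrable_derivative:
  fixes f :: "real \<Rightarrow> 'a::{real_inner, banach, second_countable_topology}"
  assumes "f \<in> H1_time T X"
  shows "has_integrable_derivative T f"
proof -
  obtain f' where f': "f' \<in> L2_time T X" "weak_deriv_on 0 T f f'" and f: "continuous_on {0..T} f"
    using assms by (auto simp: H1_time_def)
  note int = L2_time_set_integrable[OF f'(1)]
  show ?thesis
    unfolding has_integrable_derivative_def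
    by (intro exI[of _ f'] conjI ballI int weak_deriv_has_integrable_derivative[OF f'(2) f int])
qed

text \<open>The weak derivative lies in \<open>H1_time\<close> and is therefore continuous; the
  integral formula then makes it the classical derivative.\<close>

lemma H2_time_derivative:
  fixes h :: "real \<Rightarrow> 'a::{real_inner, banach, second_countable_topology}"
  assumes "h \<in> H2_time T X"
  obtains h' where "continuous_on {0..T} h'" "has_integrable_derivative T h'"
    "\<And>t. t \<in> {0..T} \<Longrightarrow> (h has_vector_derivative h' t) (at t within {0..T})"
    "has_integrable_derivative T h" "continuous_on {0..T} h" "\<And>t. t \<in> {0..T} \<Longrightarrow> h t \<in> X"
proof -
  obtain h' where h': "h' \<in> H1_time T X" "weak_deriv_on 0 T h h'" "continuous_on {0..T} h" "\<And>t. t \<in> {0..T} \<Longrightarrow> h t \<in> X"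
    using assms by (auto simp: H2_time_def)
  have c: "continuous_on {0..T} h'" using h'(1) by (auto simp: H1_time_def)
  have eq: "h t = h 0 + (LINT s:{0..t}|lebesgue. h' s)" if "t \<in> {0..T}" for t
    by (rule weak_deriv_has_integrable_derivative[OF h'(2,3) set_integrable_continuous_on_interval[OF c] that])
  show ?thesis
  proof
    show "has_integrable_derivative T h'" by (rule H1_time_has_integrable_derivative[OF h'(1)])
    show "has_integrable_derivative T h"
      unfolding has_integrable_derivative_def
      by (intro exI[of _ h'] conjI ballI eq set_integrable_continuous_on_interval[OF c])
    show "(h has_vector_derivative h' t) (at t within {0..T})" if t: "t \<in> {0..T}" for t
    proof (rule has_vector_derivative_transform[OF t])
      show "((\<lambda>t. h 0 + (LINT s:{0..t}|lebesgue. h' s)) has_vector_derivative h' t) (at t within {0..T})"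
        using has_vector_derivative_add[OF has_vector_derivative_const has_vector_derivative_set_integral[OF c t]] by simp
      show "h s = h 0 + (LINT r:{0..s}|lebesgue. h' r)" if "s \<in> {0..T}" for s by (rule eq[OF that])
    qed
  qed (use c h' in auto)
qed

section \<open>Function spaces on the network\<close>

lemma inner_L2_rep: "u \<bullet> v = (\<integral>x. rep_L2 u x * rep_L2 v x \<partial>lebesgue)"
  using inner_L2.abs_eq[of "rep_L2 u" "rep_L2 v"] by (simp add: square_integrable_rep_L2 abs_L2_rep)

lemma inner_abs_L2:
  assumes "square_integrable g"
  shows "u \<bullet> abs_L2 g = (\<integral>x. rep_L2 u x * g x \<partial>lebesgue)"
  using inner_L2.abs_eq[of "rep_L2 u" g] assms by (simp add: square_integrable_rep_L2 abs_L2_rep)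

lemma rep_L2_add: "AE x in lebesgue. rep_L2 (u + v) x = rep_L2 u x + rep_L2 v x"
  using rep_abs_L2[OF square_integrable_add[OF square_integrable_rep_L2 square_integrable_rep_L2], of u v]
    plus_abs_L2[OF square_integrable_rep_L2 square_integrable_rep_L2, of u v] by (simp add: abs_L2_rep)

lemma rep_L2_scaleR: "AE x in lebesgue. rep_L2 (c *\<^sub>R u) x = c * rep_L2 u x"
  using rep_abs_L2[OF square_integrable_scale[OF square_integrable_rep_L2], of c u]
    scaleR_abs_L2[OF square_integrable_rep_L2, of c u] by (simp add: abs_L2_rep)

lemma rep_L2_zero: "AE x in lebesgue. rep_L2 0 x = 0"
  using rep_abs_L2[OF square_integrable_zero] by (simp add: zero_L2_def)

section \<open>Multiplication operators and the projection onto the network\<close>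

text \<open>The bounds hold at every point and on every edge, so that \<open>coeff_mult\<close> is
  bounded and self-adjoint on all of \<open>L2^'e\<close>. \<open>net_coefficient_clean\<close>
  derives such coefficients from the given ones.\<close>

definition bounded_coeff :: "real \<Rightarrow> ('e \<Rightarrow> real \<Rightarrow> real) \<Rightarrow> bool" where
  "bounded_coeff K c \<longleftrightarrow> 0 \<le> K \<and> (\<forall>e. c e \<in> borel_measurable lebesgue \<and> (\<forall>x. \<bar>c e x\<bar> \<le> K))"

lemma square_integrable_bounded_mult:
  assumes c: "c \<in> borel_measurable lebesgue" "\<And>x. \<bar>c x\<bar> \<le> K" and f: "square_integrable f"
  shows "square_integrable (\<lambda>x. c x * f x)"
proof -
  have m: "(\<lambda>x. c x * f x) \<in> borel_measurable lebesgue"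
    using c(1) square_integrable_measurable[OF f] by (rule borel_measurable_times)
  have "integrable lebesgue (\<lambda>x. (c x * f x)\<^sup>2)"
  proof (rule Bochner_Integration.integrable_bound)
    show "integrable lebesgue (\<lambda>x. K\<^sup>2 * (f x)\<^sup>2)" using f by (simp add: square_integrable_def)
    show "(\<lambda>x. (c x * f x)\<^sup>2) \<in> borel_measurable lebesgue" using m by (rule borel_measurable_power)
    have "(c x)\<^sup>2 \<le> K\<^sup>2" for x using c(2)[of x] by (simp add: abs_le_square_iff[symmetric])
    then show "AE x in lebesgue. norm ((c x * f x)\<^sup>2) \<le> norm (K\<^sup>2 * (f x)\<^sup>2)"
      by (intro AE_I2) (simp add: power_mult_distrib mult_right_mono)
  qed
  with m show ?thesis by (simp add: square_integrable_def)
qed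

context
  fixes c :: "'e::finite \<Rightarrow> real \<Rightarrow> real" and K :: real
  assumes c: "bounded_coeff K c"
begin

lemma square_integrable_coeff: "square_integrable f \<Longrightarrow> square_integrable (\<lambda>x. c e x * f x)"
  using c by (intro square_integrable_bounded_mult[of _ K]) (auto simp: bounded_coeff_def)

lemma rep_coeff_mult: "AE x in lebesgue. rep_L2 (coeff_mult c u $ e) x = c e x * rep_L2 (u $ e) x"
  unfolding coeff_mult_def by (simp add: rep_abs_L2 square_integrable_coeff square_integrable_rep_L2)

lemma inner_coeff_mult: "coeff_mult c u \<bullet> v = (\<Sum>e\<in>UNIV. \<integral>x. c e x * rep_L2 (u $ e) x * rep_L2 (v $ e) x \<partial>lebesgue)"
  unfolding inner_vec_def
proof (rule sum.cong[OF refl])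
  fix e
  show "coeff_mult c u $ e \<bullet> v $ e = (\<integral>x. c e x * rep_L2 (u $ e) x * rep_L2 (v $ e) x \<partial>lebesgue)"
    unfolding inner_L2_rep
    by (rule integral_lebesgue_cong_AE) (use rep_coeff_mult[of u e] in eventually_elim, simp)
qed

lemma coeff_mult_self_adjoint: "coeff_mult c u \<bullet> v = u \<bullet> coeff_mult c v"
  unfolding inner_coeff_mult inner_commute[of u] by (simp add: mult_ac)

lemma coeff_mult_nonneg: "(\<And>e x. 0 \<le> c e x) \<Longrightarrow> 0 \<le> u \<bullet> coeff_mult c u"
  unfolding inner_commute[of u] inner_coeff_mult
  by (intro sum_nonneg integral_nonneg_AE) (simp add: mult.assoc)

lemma bounded_linear_coeff_mult: "bounded_linear (coeff_mult c)"
proof (rule bounded_linear_intro[where K = K])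
  show "coeff_mult c (u + v) = coeff_mult c u + coeff_mult c v" for u v
  proof (rule vec_eq_iff[THEN iffD2, rule_format], rule L2_eqI)
    fix e
    show "AE x in lebesgue. rep_L2 (coeff_mult c (u + v) $ e) x = rep_L2 ((coeff_mult c u + coeff_mult c v) $ e) x"
      using rep_coeff_mult[of "u + v" e] rep_coeff_mult[of u e] rep_coeff_mult[of v e]
        rep_L2_add[of "u $ e" "v $ e"] rep_L2_add[of "coeff_mult c u $ e" "coeff_mult c v $ e"]
      by eventually_elim (simp add: algebra_simps)
  qed
  show "coeff_mult c (r *\<^sub>R u) = r *\<^sub>R coeff_mult c u" for r u
  proof (rule vec_eq_iff[THEN iffD2, rule_format], rule L2_eqI)
    fix e
    show "AE x in lebesgue. rep_L2 (coeff_mult c (r *\<^sub>R u) $ e) x = rep_L2 ((r *\<^sub>R coeff_mult c u) $ e) x"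
      using rep_coeff_mult[of "r *\<^sub>R u" e] rep_coeff_mult[of u e]
        rep_L2_scaleR[of r "u $ e"] rep_L2_scaleR[of r "coeff_mult c u $ e"]
      by eventually_elim (simp add: algebra_simps)
  qed
  show "norm (coeff_mult c u) \<le> norm u * K" for u
  proof -
    have "norm (coeff_mult c u $ e) \<le> K * norm (u $ e)" for e
    proof (rule power2_le_imp_le)
      have "(norm (coeff_mult c u $ e))\<^sup>2 = (\<integral>x. (c e x * rep_L2 (u $ e) x)\<^sup>2 \<partial>lebesgue)"
        unfolding coeff_mult_def by (simp add: norm_abs_L2 square_integrable_coeff square_integrable_rep_L2)
      also have "\<dots> \<le> (\<integral>x. K\<^sup>2 * (rep_L2 (u $ e) x)\<^sup>2 \<partial>lebesgue)"
      proof (rule integral_mono)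
        show "integrable lebesgue (\<lambda>x. (c e x * rep_L2 (u $ e) x)\<^sup>2)"
          using square_integrable_coeff[OF square_integrable_rep_L2] by (simp add: square_integrable_def)
        show "integrable lebesgue (\<lambda>x. K\<^sup>2 * (rep_L2 (u $ e) x)\<^sup>2)"
          using square_integrable_rep_L2[of "u $ e"] by (simp add: square_integrable_def)
        have "(c e x)\<^sup>2 \<le> K\<^sup>2" for x using c by (auto simp: bounded_coeff_def abs_le_square_iff[symmetric])
        then show "(c e x * rep_L2 (u $ e) x)\<^sup>2 \<le> K\<^sup>2 * (rep_L2 (u $ e) x)\<^sup>2" for x
          by (simp add: power_mult_distrib mult_right_mono)
      qed
      also have "\<dots> = (K * norm (u $ e))\<^sup>2"
        using norm_abs_L2[OF square_integrable_rep_L2, of "u $ e"] by (simp add: abs_L2_rep power_mult_distrib)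
      finally show "(norm (coeff_mult c u $ e))\<^sup>2 \<le> (K * norm (u $ e))\<^sup>2" .
      show "0 \<le> K * norm (u $ e)" using c by (simp add: bounded_coeff_def)
    qed
    then have "norm (coeff_mult c u) \<le> L2_set (\<lambda>e. K * norm (u $ e)) UNIV"
      unfolding norm_vec_def by (intro L2_set_mono) auto
    also have "\<dots> = K * norm u"
      unfolding norm_vec_def using c by (intro L2_set_right_distrib[symmetric]) (simp add: bounded_coeff_def)
    finally show ?thesis by (simp add: mult.commute)
  qed
qed

end

lemma coeff_mult_compose:
  assumes c: "bounded_coeff K c" and c': "bounded_coeff K' c'"
  shows "coeff_mult c (coeff_mult c' u) = coeff_mult (\<lambda>e x. c e x * c' e x) u"
proof (rule vec_eq_iff[THEN iffD2, rule_format], rule L2_eqI)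
  fix e
  have "bounded_coeff (K * K') (\<lambda>e x. c e x * c' e x)"
    using c c' by (auto simp: bounded_coeff_def abs_mult intro!: mult_mono borel_measurable_times)
  from rep_coeff_mult[OF this, of u e] rep_coeff_mult[OF c, of "coeff_mult c' u" e] rep_coeff_mult[OF c', of u e]
  show "AE x in lebesgue. rep_L2 (coeff_mult c (coeff_mult c' u) $ e) x = rep_L2 (coeff_mult (\<lambda>e x. c e x * c' e x) u $ e) x"
    by eventually_elim simp
qed

definition net_indicator :: "('v, 'e) pre_digraph \<Rightarrow> ('e \<Rightarrow> real) \<Rightarrow> 'e \<Rightarrow> real \<Rightarrow> real" where
  "net_indicator G len e x = (if e \<in> arcs G then indicator {0..len e} x else 0)"

text \<open>The orthogonal projection onto \<open>L2_net\<close>. As a multiplication operator it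
  inherits boundedness and self-adjointness from the coefficient lemmas.\<close>

definition net_proj :: "('v, 'e::finite) pre_digraph \<Rightarrow> ('e \<Rightarrow> real) \<Rightarrow> L2^'e \<Rightarrow> L2^'e" where
  "net_proj G len = coeff_mult (net_indicator G len)"

lemma bounded_coeff_net_indicator: "bounded_coeff 1 (net_indicator G len)"
proof -
  have "net_indicator G len e = (if e \<in> arcs G then indicator {0..len e} else (\<lambda>_. 0))" for e
    by (auto simp: net_indicator_def)
  then show ?thesis by (auto simp: bounded_coeff_def intro!: borel_measurable_indicator)
qed

lemmas bounded_linear_net_proj = bounded_linear_coeff_mult[OF bounded_coeff_net_indicator, folded net_proj_def]
lemmas net_proj_self_adjoint = coeff_mult_self_adjoint[OF bounded_coeff_net_indicator, folded net_proj_def]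

text \<open>As the fixed point set of a bounded linear map, \<open>L2_net\<close> is visibly a
  closed subspace.\<close>

lemma L2_net_iff: "u \<in> L2_net G len \<longleftrightarrow> net_proj G len u = u"
proof
  assume u: "u \<in> L2_net G len"
  show "net_proj G len u = u"
  proof (rule vec_eq_iff[THEN iffD2, rule_format], rule L2_eqI)
    fix e
    show "AE x in lebesgue. rep_L2 (net_proj G len u $ e) x = rep_L2 (u $ e) x"
    proof (cases "e \<in> arcs G")
      case True
      then have "AE x in lebesgue. x \<notin> {0..len e} \<longrightarrow> rep_L2 (u $ e) x = 0" using u by (auto simp: L2_net_def)
      with rep_coeff_mult[OF bounded_coeff_net_indicator, of G len u e] show ?thesis
        unfolding net_proj_def by eventually_elim (use True in \<open>auto simp: net_indicator_def indicator_def\<close>)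
    next
      case False
      then have zero: "u $ e = 0" using u by (auto simp: L2_net_def)
      show ?thesis
        unfolding net_proj_def using rep_coeff_mult[OF bounded_coeff_net_indicator, of G len u e] rep_L2_zero
        by eventually_elim (simp add: zero)
    qed
  qed
next
  assume u: "net_proj G len u = u"
  have ae: "AE x in lebesgue. rep_L2 (u $ e) x = net_indicator G len e x * rep_L2 (u $ e) x" for e
    using rep_coeff_mult[OF bounded_coeff_net_indicator, of G len u e] u by (simp add: net_proj_def)
  show "u \<in> L2_net G len"
    unfolding L2_net_def
  proof (intro CollectI conjI ballI allI impI)
    fix e assume "e \<in> arcs G"
    show "AE x in lebesgue. x \<notin> {0..len e} \<longrightarrow> rep_L2 (u $ e) x = 0"
      using ae[of e] by eventually_elim (auto simp: net_indicator_def indicator_def split: if_splits)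
  next
    fix e assume e: "e \<notin> arcs G"
    show "u $ e = 0"
    proof (rule L2_eqI)
      show "AE x in lebesgue. rep_L2 (u $ e) x = rep_L2 0 x"
        using ae[of e] rep_L2_zero by eventually_elim (use e in \<open>simp add: net_indicator_def\<close>)
    qed
  qed
qed

lemma net_proj_mem: "net_proj G len u \<in> L2_net G len"
  unfolding L2_net_iff net_proj_def coeff_mult_compose[OF bounded_coeff_net_indicator bounded_coeff_net_indicator]
  by (rule arg_cong[of _ _ "\<lambda>c. coeff_mult c u"]) (auto simp: net_indicator_def indicator_def fun_eq_iff)

lemma closed_L2_net: "closed (L2_net G len)"
proof -
  have "L2_net G len = {u. net_proj G len u = u}" by (auto simp: L2_net_iff)
  then show ?thesis
    by (simp add: closed_Collect_eq linear_continuous_on[OF bounded_linear_net_proj])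
qed

lemma subspace_L2_net: "subspace (L2_net G len)"
  by (rule subspaceI) (simp_all add: L2_net_iff linear_simps[OF bounded_linear_net_proj])

text \<open>Off the network the coefficient is arbitrary; replacing it there by zero does not change the
  products with elements of \<open>L2_net\<close>.\<close>

lemma net_coefficient_clean:
  assumes c: "net_coefficient G len lo hi c" and "0 \<le> lo"
  obtains c' K where "bounded_coeff K c'" "\<And>e x. 0 \<le> c' e x"
    "\<And>u. u \<in> L2_net G len \<Longrightarrow> coeff_mult c u = coeff_mult c' u"
    "\<And>u. coeff_mult c' (net_proj G len u) = coeff_mult c' u"
proof
  \<comment> \<open>Setting the value to zero wherever a bound fails changes the coefficient only on
    a null set of the network and yields bounds at every point.\<close>
  define c' where "c' e x = (if e \<in> arcs G \<and> x \<in> {0..len e} \<and> lo \<le> c e x \<and> c e x \<le> hi then c e x else 0)" for e x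
  have nonneg: "0 \<le> c' e x" for e x using assms(2) by (auto simp: c'_def)
  have meas: "c' e \<in> borel_measurable lebesgue" for e
  proof (cases "e \<in> arcs G")
    case True
    \<comment> \<open>Measurability is given for the cut-off product, so \<open>c'\<close> is
      expressed through \<open>g\<close>.\<close>
    define g where "g x = indicator {0..len e} x *\<^sub>R c e x" for x
    have [measurable]: "g \<in> borel_measurable lebesgue"
      using c True by (auto simp: net_coefficient_def set_borel_measurable_def g_def[abs_def])
    have [measurable]: "(\<lambda>x::real. x) \<in> borel_measurable lebesgue" by (rule measurable_completion) simp
    have "c' e = (\<lambda>x. if 0 \<le> x \<and> x \<le> len e \<and> lo \<le> g x \<and> g x \<le> hi then g x else 0)"
      using True by (auto simp: c'_def g_def fun_eq_iff)
    also have "\<dots> \<in> borel_measurable lebesgue" by measurable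
    finally show ?thesis .
  qed (simp add: c'_def[abs_def])
  show bc: "bounded_coeff \<bar>hi\<bar> c'"
    using meas assms(2) by (auto simp: bounded_coeff_def c'_def)
  show "0 \<le> c' e x" for e x by (rule nonneg)
  have ci: "c' e x * net_indicator G len e x = c' e x" for e x
    by (auto simp: c'_def net_indicator_def indicator_def)
  show "coeff_mult c' (net_proj G len u) = coeff_mult c' u" for u
    unfolding net_proj_def coeff_mult_compose[OF bc bounded_coeff_net_indicator] ci ..
  fix u assume u: "u \<in> L2_net G len"
  show "coeff_mult c u = coeff_mult c' u"
    unfolding coeff_mult_def
  proof (rule vec_eq_iff[THEN iffD2, rule_format], simp, rule abs_L2_eqI)
    fix e
    show sq: "square_integrable (\<lambda>x. c' e x * rep_L2 (u $ e) x)"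
      by (rule square_integrable_coeff[OF bc square_integrable_rep_L2])
    show ae: "AE x in lebesgue. c e x * rep_L2 (u $ e) x = c' e x * rep_L2 (u $ e) x"
    proof (cases "e \<in> arcs G")
      case True
      then have "AE x in lebesgue. x \<notin> {0..len e} \<longrightarrow> rep_L2 (u $ e) x = 0"
        "AE x in lebesgue. x \<in> {0..len e} \<longrightarrow> lo \<le> c e x \<and> c e x \<le> hi"
        using u c by (auto simp: L2_net_def net_coefficient_def)
      then show ?thesis by eventually_elim (use True in \<open>auto simp: c'_def\<close>)
    next
      case False
      then have zero: "u $ e = 0" using u by (auto simp: L2_net_def)
      show ?thesis using rep_L2_zero by eventually_elim (simp add: zero)
    qed
    have ae2: "AE x in lebesgue. (c' e x * rep_L2 (u $ e) x)\<^sup>2 = (c e x * rep_L2 (u $ e) x)\<^sup>2"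
      "AE x in lebesgue. c' e x * rep_L2 (u $ e) x = c e x * rep_L2 (u $ e) x"
      using ae by (eventually_elim, simp only:)+
    show "square_integrable (\<lambda>x. c e x * rep_L2 (u $ e) x)"
      using integrable_lebesgue_cong_AE[OF ae2(1)] borel_measurable_lebesgue_cong_AE[OF _ ae2(2)] sq
      unfolding square_integrable_def by simp
  qed
qed

section \<open>Continuous functions and primitives on one edge\<close>

definition trunc_L2 :: "real \<Rightarrow> (real \<Rightarrow> real) \<Rightarrow> L2" where
  "trunc_L2 L k = abs_L2 (\<lambda>x. indicator {0..L} x * k x)"

lemma square_integrable_trunc:
  assumes "continuous_on {0..L} k"
  shows "square_integrable (\<lambda>x. indicator {0..L} x * k x)"
proof -
  have "set_integrable lebesgue {0..L} k" "set_integrable lebesgue {0..L} (\<lambda>x. (k x)\<^sup>2)"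
    using assms by (auto intro!: set_integrable_continuous_on_interval continuous_intros)
  moreover have "(\<lambda>x. (indicator {0..L} x * k x)\<^sup>2) = (\<lambda>x. indicator {0..L} x *\<^sub>R (k x)\<^sup>2)"
    by (auto simp: indicator_def)
  ultimately show ?thesis by (simp add: square_integrable_def set_integrable_def borel_measurable_integrable)
qed

lemma rep_trunc: "continuous_on {0..L} k \<Longrightarrow> AE x in lebesgue. rep_L2 (trunc_L2 L k) x = indicator {0..L} x * k x"
  unfolding trunc_L2_def by (rule rep_abs_L2[OF square_integrable_trunc])

lemma inner_trunc: "continuous_on {0..L} k \<Longrightarrow> u \<bullet> trunc_L2 L k = (LINT x:{0..L}|lebesgue. k x * rep_L2 u x)"
  unfolding trunc_L2_def inner_abs_L2[OF square_integrable_trunc] set_lebesgue_integral_def by (simp add: mult_ac)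

lemma rep_L2_set_integrable: "set_integrable lebesgue {0..L} (rep_L2 u)"
  using square_integrable_mult[OF square_integrable_trunc[of L "\<lambda>_. 1"] square_integrable_rep_L2[of u]]
  by (simp add: set_integrable_def)

lemma inner_trunc_trunc:
  assumes k: "continuous_on {0..L} k" and g: "continuous_on {0..M} g" and "L \<le> M"
  shows "trunc_L2 M g \<bullet> trunc_L2 L k = integral {0..L} (\<lambda>x. k x * g x)"
proof -
  have "trunc_L2 M g \<bullet> trunc_L2 L k = (LINT x:{0..L}|lebesgue. k x * g x)"
    unfolding inner_trunc[OF k] set_lebesgue_integral_def
    by (rule integral_lebesgue_cong_AE, use rep_trunc[OF g] in eventually_elim)
      (use \<open>L \<le> M\<close> in \<open>auto simp: indicator_def\<close>)
  also have "\<dots> = integral {0..L} (\<lambda>x. k x * g x)"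
    using k continuous_on_subset[OF g, of "{0..L}"] \<open>L \<le> M\<close>
    by (intro set_lebesgue_integral_eq_integral set_integrable_continuous_on_interval continuous_intros) auto
  finally show ?thesis .
qed

text \<open>Pairing with this element is integration from 0 to \<open>L\<close>. Primitives thus
  become inner products, open to Cauchy-Schwarz and continuous in the integrand.\<close>

abbreviation unit_trunc :: "real \<Rightarrow> L2" where
  "unit_trunc L \<equiv> trunc_L2 L (\<lambda>_. 1)"

lemma norm_unit_trunc: "L \<ge> 0 \<Longrightarrow> norm (unit_trunc L) = sqrt L"
  using inner_trunc_trunc[of L "\<lambda>_. 1" L "\<lambda>_. 1"] by (simp add: norm_eq_sqrt_inner)

lemma inner_unit_trunc: "u \<bullet> unit_trunc x = (LINT y:{0..x}|lebesgue. rep_L2 u y)"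
  using inner_trunc[of x "\<lambda>_. 1" u] by simp

lemma continuous_on_inner_unit_trunc: "continuous_on {0..L} (\<lambda>x. u \<bullet> unit_trunc x)"
proof -
  have int: "rep_L2 u integrable_on {0..L}" using rep_L2_set_integrable by (rule set_lebesgue_integral_eq_integral)
  have "u \<bullet> unit_trunc x = integral {0..x} (rep_L2 u)" for x
    unfolding inner_unit_trunc by (rule set_lebesgue_integral_eq_integral[OF rep_L2_set_integrable])
  then show ?thesis using indefinite_integral_continuous_1[OF int] by simp
qed

lemma trunc_add:
  assumes "continuous_on {0..L} k" "continuous_on {0..L} g"
  shows "trunc_L2 L (\<lambda>x. k x + g x) = trunc_L2 L k + trunc_L2 L g"
  unfolding trunc_L2_def plus_abs_L2[OF square_integrable_trunc[OF assms(1)] square_integrable_trunc[OF assms(2)]]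
  by (simp add: algebra_simps)

lemma trunc_scale: "continuous_on {0..L} k \<Longrightarrow> trunc_L2 L (\<lambda>x. c * k x) = c *\<^sub>R trunc_L2 L k"
  unfolding trunc_L2_def by (simp add: scaleR_abs_L2 square_integrable_trunc mult.left_commute)

definition edge_primitive :: "real \<Rightarrow> L2 \<Rightarrow> L2" where
  "edge_primitive L w = trunc_L2 L (\<lambda>x. w \<bullet> unit_trunc x)"

text \<open>Cauchy-Schwarz bounds the primitive at \<open>x\<close> by
  \<open>norm w * sqrt x\<close>; squaring and integrating over the edge gives the second factor
  \<open>sqrt L\<close>.\<close>

lemma edge_primitive_bound:
  assumes L: "L \<ge> 0"
  shows "norm (edge_primitive L w) \<le> norm w * L"
proof (rule power2_le_imp_le)
  let ?k = "\<lambda>x. w \<bullet> unit_trunc x"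
  note k = continuous_on_inner_unit_trunc[of L w]
  have "(norm (edge_primitive L w))\<^sup>2 = integral {0..L} (\<lambda>x. ?k x * ?k x)"
    unfolding edge_primitive_def power2_norm_eq_inner by (rule inner_trunc_trunc[OF k k order_refl])
  also have "\<dots> \<le> integral {0..L} (\<lambda>x. (norm w)\<^sup>2 * L)"
  proof (rule integral_le)
    show "(\<lambda>x. ?k x * ?k x) integrable_on {0..L}" using k by (intro integrable_continuous_interval continuous_on_mult)
    fix x assume x: "x \<in> {0..L}"
    have "\<bar>?k x\<bar> \<le> norm w * sqrt x" using Cauchy_Schwarz_ineq2[of w "unit_trunc x"] x by (simp add: norm_unit_trunc)
    also have "\<dots> \<le> norm w * sqrt L" using x by (intro mult_left_mono) auto
    finally have "\<bar>?k x\<bar>\<^sup>2 \<le> (norm w * sqrt L)\<^sup>2" by (intro power_mono) auto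
    then show "?k x * ?k x \<le> (norm w)\<^sup>2 * L" using L by (simp add: power_mult_distrib flip: power2_eq_square)
  qed auto
  also have "\<dots> = (norm w * L)\<^sup>2" using L by (simp add: power2_eq_square)
  finally show "(norm (edge_primitive L w))\<^sup>2 \<le> (norm w * L)\<^sup>2" .
qed (use L in simp)

lemma bounded_linear_edge_primitive:
  assumes L: "L \<ge> 0"
  shows "bounded_linear (edge_primitive L)"
proof (rule bounded_linear_intro[OF _ _ edge_primitive_bound[OF L]])
  show "edge_primitive L (u + v) = edge_primitive L u + edge_primitive L v" for u v
    unfolding edge_primitive_def
    by (simp add: inner_add_left trunc_add[OF continuous_on_inner_unit_trunc continuous_on_inner_unit_trunc])
  show "edge_primitive L (r *\<^sub>R u) = r *\<^sub>R edge_primitive L u" for r u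
    unfolding edge_primitive_def by (simp add: trunc_scale[OF continuous_on_inner_unit_trunc])
qed

text \<open>Inner products with fixed elements replace representatives; in this form the condition
  is linear in \<open>(u, w)\<close> and passes to limits.\<close>

lemma weak_deriv_on_rep_iff:
  "weak_deriv_on 0 L (rep_L2 u) (rep_L2 w) \<longleftrightarrow>
     (\<forall>\<phi>\<in>test_funs 0 L. u \<bullet> trunc_L2 L (deriv \<phi>) = - (w \<bullet> trunc_L2 L \<phi>))"
proof -
  have "continuous_on {0..L} \<phi>" "continuous_on {0..L} (deriv \<phi>)" if "\<phi> \<in> test_funs 0 L" for \<phi>
    using test_fun_smooth[OF that] smooth_fun_deriv smooth_fun_continuous_on by auto
  then show ?thesis
    unfolding weak_deriv_on_def set_integral_Ioo_eq_Icc by (simp add: inner_trunc)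
qed

lemma test_orthogonal_imp_zero:
  assumes "\<And>\<phi>. \<phi> \<in> test_funs 0 L \<Longrightarrow> w \<bullet> trunc_L2 L \<phi> = 0" and "AE x in lebesgue. x \<notin> {0..L} \<longrightarrow> rep_L2 w x = 0"
  shows "w = 0"
proof (rule L2_eqI)
  have "AE x in lebesgue. x \<in> {0..L} \<longrightarrow> rep_L2 w x = 0"
  proof (rule test_orthogonal_imp_AE_zero[OF rep_L2_set_integrable])
    fix \<phi> assume \<phi>: "\<phi> \<in> test_funs 0 L"
    show "(LINT x:{0..L}|lebesgue. \<phi> x * rep_L2 w x) = 0"
      using assms(1)[OF \<phi>] inner_trunc[OF smooth_fun_continuous_on[OF test_fun_smooth[OF \<phi>]]] by simp
  qed
  with assms(2) rep_L2_zero show "AE x in lebesgue. rep_L2 w x = rep_L2 0 x"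
    by eventually_elim auto
qed

text \<open>A reformulation of membership in \<open>H1_net\<close> in which all conditions are linear and closed in
  the function \<open>u\<close>, its derivative \<open>w\<close> and its vertex values \<open>c\<close>.\<close>

definition H1_rel :: "('v::finite, 'e::finite) pre_digraph \<Rightarrow> ('e \<Rightarrow> real) \<Rightarrow> L2^'e \<Rightarrow> L2^'e \<Rightarrow> real^'v \<Rightarrow> bool" where
  "H1_rel G len u w c \<longleftrightarrow> u \<in> L2_net G len \<and> w \<in> L2_net G len \<and> c \<in> vertex_vecs (verts G) \<and>
     (\<forall>e\<in>arcs G. (\<forall>\<phi>\<in>test_funs 0 (len e). (u $ e) \<bullet> trunc_L2 (len e) (deriv \<phi>) = - ((w $ e) \<bullet> trunc_L2 (len e) \<phi>)) \<and>
        u $ e = (c $ tail G e) *\<^sub>R unit_trunc (len e) + edge_primitive (len e) (w $ e) \<and>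
        c $ head G e = c $ tail G e + (w $ e) \<bullet> unit_trunc (len e))"

lemma rep_edge_function:
  assumes "u = a *\<^sub>R unit_trunc L + edge_primitive L w"
  shows "AE x in lebesgue. rep_L2 u x = indicator {0..L} x * (a + w \<bullet> unit_trunc x)"
proof -
  have "continuous_on {0..L} (\<lambda>x. a + w \<bullet> unit_trunc x)"
    by (intro continuous_on_add continuous_on_const continuous_on_inner_unit_trunc)
  moreover have "u = trunc_L2 L (\<lambda>x. a + w \<bullet> unit_trunc x)"
    using trunc_add[of L "\<lambda>x. a * 1" "\<lambda>x. w \<bullet> unit_trunc x"] trunc_scale[of L "\<lambda>_. 1" a]
    by (simp add: assms edge_primitive_def continuous_on_inner_unit_trunc)
  ultimately show ?thesis using rep_trunc by simp
qed

section \<open>Traces, uniqueness and closedness of the H1 relation\<close>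

context
  fixes G :: "('v::finite, 'e::finite) pre_digraph" and len :: "'e \<Rightarrow> real" and VD VN :: "'v set"
  assumes network: "network G len VD VN"
begin

lemma len_pos: "e \<in> arcs G \<Longrightarrow> len e > 0"
  using network by (auto simp: network_def)

text \<open>Forward, the continuous representative is the tail value plus the primitive of
  \<open>w\<close>. Backward, the integral formula for weak derivatives forces every continuous
  representative into this form, which also gives the head value.\<close>

lemma H1_rel_iff:
  "H1_rel G len u w c \<longleftrightarrow> u \<in> L2_net G len \<and> has_edge_deriv G len u w \<and> has_vertex_values G len u c"
proof
  assume R: "H1_rel G len u w c"
  then have ed: "has_edge_deriv G len u w"
    by (auto simp: H1_rel_def has_edge_deriv_def weak_deriv_on_rep_iff)
  have "\<exists>U. \<forall>e\<in>arcs G. continuous_on {0..len e} (U e) \<and>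
        (AE x in lebesgue. x \<in> {0..len e} \<longrightarrow> rep_L2 (u $ e) x = U e x) \<and>
        U e 0 = c $ tail G e \<and> U e (len e) = c $ head G e"
  proof (intro exI[of _ "\<lambda>e x. c $ tail G e + (w $ e) \<bullet> unit_trunc x"] ballI conjI)
    fix e assume e: "e \<in> arcs G"
    show "continuous_on {0..len e} (\<lambda>x. c $ tail G e + (w $ e) \<bullet> unit_trunc x)"
      by (intro continuous_on_add continuous_on_const continuous_on_inner_unit_trunc)
    have "u $ e = (c $ tail G e) *\<^sub>R unit_trunc (len e) + edge_primitive (len e) (w $ e)"
      using R e by (auto simp: H1_rel_def)
    from rep_edge_function[OF this]
    show "AE x in lebesgue. x \<in> {0..len e} \<longrightarrow> rep_L2 (u $ e) x = c $ tail G e + (w $ e) \<bullet> unit_trunc x"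
      by eventually_elim simp
    have "norm (unit_trunc 0) = 0" by (simp add: norm_unit_trunc)
    then show "c $ tail G e + (w $ e) \<bullet> unit_trunc 0 = c $ tail G e" by simp
    show "c $ tail G e + (w $ e) \<bullet> unit_trunc (len e) = c $ head G e" using R e by (auto simp: H1_rel_def)
  qed
  with R ed show "u \<in> L2_net G len \<and> has_edge_deriv G len u w \<and> has_vertex_values G len u c"
    by (auto simp: H1_rel_def has_vertex_values_def)
next
  assume A: "u \<in> L2_net G len \<and> has_edge_deriv G len u w \<and> has_vertex_values G len u c"
  then have w: "w \<in> L2_net G len" and weak: "\<And>e. e \<in> arcs G \<Longrightarrow> weak_deriv_on 0 (len e) (rep_L2 (u $ e)) (rep_L2 (w $ e))"
    by (auto simp: has_edge_deriv_def)
  obtain U where U: "\<And>e. e \<in> arcs G \<Longrightarrow> continuous_on {0..len e} (U e)"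
    "\<And>e. e \<in> arcs G \<Longrightarrow> AE x in lebesgue. x \<in> {0..len e} \<longrightarrow> rep_L2 (u $ e) x = U e x"
    "\<And>e. e \<in> arcs G \<Longrightarrow> U e 0 = c $ tail G e" "\<And>e. e \<in> arcs G \<Longrightarrow> U e (len e) = c $ head G e"
    using A unfolding has_vertex_values_def by blast
  have eq: "U e x = c $ tail G e + (w $ e) \<bullet> unit_trunc x" if e: "e \<in> arcs G" and x: "x \<in> {0..len e}" for e x
  proof -
    have "weak_deriv_on 0 (len e) (U e) (rep_L2 (w $ e))"
      unfolding weak_deriv_on_def set_integral_Ioo_eq_Icc
    proof
      fix \<phi> assume "\<phi> \<in> test_funs 0 (len e)"
      then have "(LINT t:{0..len e}|lebesgue. deriv \<phi> t *\<^sub>R rep_L2 (u $ e) t) = - (LINT t:{0..len e}|lebesgue. \<phi> t *\<^sub>R rep_L2 (w $ e) t)"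
        using weak[OF e] unfolding weak_deriv_on_def set_integral_Ioo_eq_Icc by blast
      moreover have "(LINT t:{0..len e}|lebesgue. deriv \<phi> t *\<^sub>R rep_L2 (u $ e) t) = (LINT t:{0..len e}|lebesgue. deriv \<phi> t *\<^sub>R U e t)"
        unfolding set_lebesgue_integral_def
        by (rule integral_lebesgue_cong_AE, use U(2)[OF e] in eventually_elim) (auto simp: indicator_def)
      ultimately show "(LINT t:{0..len e}|lebesgue. deriv \<phi> t *\<^sub>R U e t) = - (LINT t:{0..len e}|lebesgue. \<phi> t *\<^sub>R rep_L2 (w $ e) t)"
        by simp
    qed
    from weak_deriv_continuous_eq_integral[OF this U(1)[OF e] rep_L2_set_integrable x]
    show ?thesis by (simp add: U(3)[OF e] inner_unit_trunc)
  qed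
  have "u $ e = (c $ tail G e) *\<^sub>R unit_trunc (len e) + edge_primitive (len e) (w $ e)" if e: "e \<in> arcs G" for e
  proof (rule L2_eqI)
    have "AE x in lebesgue. x \<notin> {0..len e} \<longrightarrow> rep_L2 (u $ e) x = 0" using A e by (auto simp: L2_net_def)
    with U(2)[OF e] rep_edge_function[OF refl, of "c $ tail G e" "len e" "w $ e"]
    show "AE x in lebesgue. rep_L2 (u $ e) x = rep_L2 ((c $ tail G e) *\<^sub>R unit_trunc (len e) + edge_primitive (len e) (w $ e)) x"
      by eventually_elim (use eq[OF e] in \<open>auto simp: indicator_def\<close>)
  qed
  moreover have "c $ head G e = c $ tail G e + (w $ e) \<bullet> unit_trunc (len e)" if e: "e \<in> arcs G" for e
    using eq[OF e, of "len e"] U(4)[OF e] len_pos[OF e] by simp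
  ultimately show "H1_rel G len u w c"
    using A w weak by (auto simp: H1_rel_def weak_deriv_on_rep_iff has_vertex_values_def)
qed

lemma H1_rel_zero: "H1_rel G len 0 0 0"
  by (simp add: H1_rel_def subspace_0[OF subspace_L2_net] vertex_vecs_def edge_primitive_def)
    (simp add: trunc_L2_def zero_L2_def)

lemma H1_rel_add:
  assumes R: "H1_rel G len u w c" and R': "H1_rel G len u' w' c'"
  shows "H1_rel G len (u + u') (w + w') (c + c')"
  unfolding H1_rel_def
proof (intro conjI ballI)
  show "u + u' \<in> L2_net G len" "w + w' \<in> L2_net G len" "c + c' \<in> vertex_vecs (verts G)"
    using R R' subspace_add[OF subspace_L2_net] by (auto simp: H1_rel_def vertex_vecs_def)
  fix e assume e: "e \<in> arcs G"
  show "(c + c') $ head G e = (c + c') $ tail G e + (w + w') $ e \<bullet> unit_trunc (len e)"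
    using R R' e by (simp add: H1_rel_def inner_add_left)
  have "u $ e = (c $ tail G e) *\<^sub>R unit_trunc (len e) + edge_primitive (len e) (w $ e)"
    "u' $ e = (c' $ tail G e) *\<^sub>R unit_trunc (len e) + edge_primitive (len e) (w' $ e)"
    using R R' e by (auto simp: H1_rel_def)
  then show "(u + u') $ e = ((c + c') $ tail G e) *\<^sub>R unit_trunc (len e) + edge_primitive (len e) ((w + w') $ e)"
    using linear_simps(1)[OF bounded_linear_edge_primitive, of "len e"] len_pos[OF e] by (simp add: algebra_simps)
  fix \<phi> assume "\<phi> \<in> test_funs 0 (len e)"
  then have "u $ e \<bullet> trunc_L2 (len e) (deriv \<phi>) = - (w $ e \<bullet> trunc_L2 (len e) \<phi>)"
    "u' $ e \<bullet> trunc_L2 (len e) (deriv \<phi>) = - (w' $ e \<bullet> trunc_L2 (len e) \<phi>)"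
    using R R' e unfolding H1_rel_def by blast+
  then show "(u + u') $ e \<bullet> trunc_L2 (len e) (deriv \<phi>) = - ((w + w') $ e \<bullet> trunc_L2 (len e) \<phi>)"
    by (simp add: inner_add_left)
qed

lemma H1_rel_scale:
  assumes R: "H1_rel G len u w c"
  shows "H1_rel G len (r *\<^sub>R u) (r *\<^sub>R w) (r *\<^sub>R c)"
  unfolding H1_rel_def
proof (intro conjI ballI)
  show "r *\<^sub>R u \<in> L2_net G len" "r *\<^sub>R w \<in> L2_net G len" "r *\<^sub>R c \<in> vertex_vecs (verts G)"
    using R subspace_scale[OF subspace_L2_net] by (auto simp: H1_rel_def vertex_vecs_def)
  fix e assume e: "e \<in> arcs G"
  show "(r *\<^sub>R c) $ head G e = (r *\<^sub>R c) $ tail G e + (r *\<^sub>R w) $ e \<bullet> unit_trunc (len e)"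
    using R e by (simp add: H1_rel_def distrib_left)
  have "u $ e = (c $ tail G e) *\<^sub>R unit_trunc (len e) + edge_primitive (len e) (w $ e)"
    using R e by (auto simp: H1_rel_def)
  then show "(r *\<^sub>R u) $ e = ((r *\<^sub>R c) $ tail G e) *\<^sub>R unit_trunc (len e) + edge_primitive (len e) ((r *\<^sub>R w) $ e)"
    using linear_simps(5)[OF bounded_linear_edge_primitive, of "len e"] len_pos[OF e] by (simp add: algebra_simps)
  fix \<phi> assume "\<phi> \<in> test_funs 0 (len e)"
  then have "u $ e \<bullet> trunc_L2 (len e) (deriv \<phi>) = - (w $ e \<bullet> trunc_L2 (len e) \<phi>)"
    using R e unfolding H1_rel_def by blast
  then show "(r *\<^sub>R u) $ e \<bullet> trunc_L2 (len e) (deriv \<phi>) = - ((r *\<^sub>R w) $ e \<bullet> trunc_L2 (len e) \<phi>)"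
    by simp
qed

lemma H1_rel_diff: "H1_rel G len u w c \<Longrightarrow> H1_rel G len u' w' c' \<Longrightarrow> H1_rel G len (u - u') (w - w') (c - c')"
  using H1_rel_add[OF _ H1_rel_scale[of u' w' c' "-1"]] by simp

text \<open>A walk from \<open>v\<close> to the tail of some arc, in the symmetrised graph, leaves
  \<open>v\<close> along an arc. So every vertex value is seen by an edge function.\<close>

lemma vertex_incident:
  assumes v: "v \<in> verts G"
  shows "\<exists>e\<in>arcs G. tail G e = v \<or> head G e = v"
proof -
  interpret fin_digraph G using network by (simp add: network_def)
  obtain e0 where e0: "e0 \<in> arcs G" using network by (auto simp: network_def)
  show ?thesis
  proof (cases "tail G e0 = v")
    case False
    have "strongly_connected (mk_symmetric G)" using network by (simp add: network_def connected_def)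
    then have "v \<rightarrow>\<^sup>*\<^bsub>mk_symmetric G\<^esub> tail G e0"
      using v tail_in_verts[OF e0] by (simp add: strongly_connected_def)
    then have "(v, tail G e0) \<in> rtrancl_on (verts (mk_symmetric G)) (arcs_ends (mk_symmetric G))"
      by (simp add: reachable_def)
    then obtain z where "(v, z) \<in> arcs_ends (mk_symmetric G)"
      using False by (cases rule: converse_rtrancl_on_cases) auto
    then show ?thesis by (auto simp: parcs_mk_symmetric)
  qed (use e0 in blast)
qed

text \<open>A trace inequality: solving the representation of \<open>u\<close> on an incident edge
  for its constant bounds the tail value, and the integral of \<open>w\<close> over the edge leads
  on to the head value.\<close>

lemma vertex_values_bound:
  obtains C where "C \<ge> 0" "\<And>u w c v. H1_rel G len u w c \<Longrightarrow> \<bar>c $ v\<bar> \<le> C * (norm u + norm w)"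
proof -
  \<comment> \<open>The first summand bounds the tail value, the second the step to the head.
    Summing over all arcs then gives one constant for all vertices.\<close>
  define B where "B e = (1 + len e) / sqrt (len e) + sqrt (len e)" for e
  define C where "C = (\<Sum>e\<in>arcs G. B e)"
  have Bpos: "B e \<ge> 0" if "e \<in> arcs G" for e using len_pos[OF that] by (simp add: B_def)
  have C: "C \<ge> 0" unfolding C_def using Bpos by (intro sum_nonneg)
  have "\<bar>c $ v\<bar> \<le> C * (norm u + norm w)" if R: "H1_rel G len u w c" for u w c v
  proof (cases "v \<in> verts G")
    case True
    then obtain e where e: "e \<in> arcs G" "tail G e = v \<or> head G e = v" using vertex_incident by blast
    let ?L = "len e" and ?N = "norm u + norm w"
    have L: "?L > 0" by (rule len_pos[OF e(1)])
    have un: "norm (u $ e) \<le> ?N" "norm (w $ e) \<le> ?N"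
      using Finite_Cartesian_Product.norm_nth_le[of u e] Finite_Cartesian_Product.norm_nth_le[of w e] by (simp_all add: add_increasing add_increasing2)
    have "(c $ tail G e) *\<^sub>R unit_trunc ?L = u $ e - edge_primitive ?L (w $ e)" using R e by (simp add: H1_rel_def)
    then have "\<bar>c $ tail G e\<bar> * sqrt ?L = norm (u $ e - edge_primitive ?L (w $ e))"
      using L by (metis norm_scaleR norm_unit_trunc less_imp_le real_norm_def)
    also have "\<dots> \<le> norm (u $ e) + norm (w $ e) * ?L"
      using edge_primitive_bound[of ?L "w $ e"] L norm_triangle_ineq4[of "u $ e" "edge_primitive ?L (w $ e)"] by linarith
    also have "\<dots> \<le> ?N + ?N * ?L" using un L by (intro add_mono mult_right_mono) auto
    finally have t: "\<bar>c $ tail G e\<bar> \<le> (1 + ?L) / sqrt ?L * ?N" using L by (simp add: field_simps)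
    have "c $ head G e = c $ tail G e + (w $ e) \<bullet> unit_trunc ?L" using R e by (simp add: H1_rel_def)
    moreover have "\<bar>(w $ e) \<bullet> unit_trunc ?L\<bar> \<le> ?N * sqrt ?L"
      using Cauchy_Schwarz_ineq2[of "w $ e" "unit_trunc ?L"] un(2) L
      by (simp add: norm_unit_trunc less_imp_le) (meson mult_right_mono order_trans real_sqrt_ge_zero less_imp_le)
    moreover have "B e * ?N = (1 + ?L) / sqrt ?L * ?N + ?N * sqrt ?L" by (simp only: B_def distrib_right mult.commute[of "sqrt ?L"])
    ultimately have h: "\<bar>c $ head G e\<bar> \<le> B e * ?N"
      using t abs_triangle_ineq[of "c $ tail G e" "(w $ e) \<bullet> unit_trunc ?L"] by linarith
    have "(1 + ?L) / sqrt ?L * ?N \<le> B e * ?N" unfolding B_def using L by (intro mult_right_mono) auto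
    with t h e(2) have "\<bar>c $ v\<bar> \<le> B e * ?N" by auto
    also have "\<dots> \<le> C * ?N"
      unfolding C_def using Bpos e by (intro mult_right_mono member_le_sum) auto
    finally show ?thesis .
  next
    case False
    then have "c $ v = 0" using R by (auto simp: H1_rel_def vertex_vecs_def)
    then show ?thesis using C by simp
  qed
  with C show ?thesis using that by blast
qed

lemma edge_deriv_eq:
  assumes "H1_rel G len u w c"
  shows "edge_deriv G len u = w"
proof -
  have unique: "w' = w''" if "has_edge_deriv G len u w'" "has_edge_deriv G len u w''" for w' w''
  proof -
    have mem: "w' - w'' \<in> L2_net G len"
      using that subspace_diff[OF subspace_L2_net] by (auto simp: has_edge_deriv_def)
    have "(w' - w'') $ e = 0" for e
    proof (cases "e \<in> arcs G")
      case True
      show ?thesis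
      proof (rule test_orthogonal_imp_zero)
        show "(w' - w'') $ e \<bullet> trunc_L2 (len e) \<phi> = 0" if "\<phi> \<in> test_funs 0 (len e)" for \<phi>
          using \<open>has_edge_deriv G len u w'\<close> \<open>has_edge_deriv G len u w''\<close> True that
          by (auto simp: has_edge_deriv_def weak_deriv_on_rep_iff inner_diff_left)
        show "AE x in lebesgue. x \<notin> {0..len e} \<longrightarrow> rep_L2 ((w' - w'') $ e) x = 0"
          using mem True by (auto simp: L2_net_def)
      qed
    next
      case False
      then show ?thesis using mem by (auto simp: L2_net_def)
    qed
    then have "w' - w'' = 0" by (simp add: vec_eq_iff)
    then show ?thesis by simp
  qed
  have "has_edge_deriv G len u w" using assms by (simp add: H1_rel_iff)
  then show ?thesis unfolding edge_deriv_def using unique by (intro the_equality) auto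
qed

lemma vertex_values_eq:
  assumes R: "H1_rel G len u w c"
  shows "vertex_values G len u = c"
  unfolding vertex_values_def
proof (rule the_equality)
  show "has_vertex_values G len u c" using R by (simp add: H1_rel_iff)
  fix c' assume "has_vertex_values G len u c'"
  then have "H1_rel G len u w c'" using R by (simp add: H1_rel_iff)
  \<comment> \<open>Two value vectors for the same \<open>u\<close> differ by values of the zero
    function, which the trace bound forces to vanish.\<close>
  from H1_rel_diff[OF R this] have R0: "H1_rel G len 0 0 (c - c')" by simp
  obtain C where C: "\<And>u w c v. H1_rel G len u w c \<Longrightarrow> \<bar>c $ v\<bar> \<le> C * (norm u + norm w)"
    by (rule vertex_values_bound) blast
  have "(c - c') $ v = 0" for v using C[OF R0, of v] by simp
  then show "c' = c" by (simp add: vec_eq_iff)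
qed

lemma H1_net_iff: "u \<in> H1_net G len \<longleftrightarrow> (\<exists>w c. H1_rel G len u w c)"
  by (auto simp: H1_net_def H1_rel_iff)

text \<open>The trace bound applied to differences makes the vertex values Cauchy; then every
  condition in \<open>H1_rel\<close> passes to the limit.\<close>

lemma H1_rel_limit:
  assumes R: "\<And>n. H1_rel G len (u n) (w n) (c n)" and u: "u \<longlonglongrightarrow> u'" and w: "w \<longlonglongrightarrow> w'"
  shows "\<exists>c'. H1_rel G len u' w' c' \<and> c \<longlonglongrightarrow> c'"
proof -
  obtain C where C: "C \<ge> 0" "\<And>u w c v. H1_rel G len u w c \<Longrightarrow> \<bar>c $ v\<bar> \<le> C * (norm u + norm w)"
    by (rule vertex_values_bound) blast
  have "Cauchy (\<lambda>n. c n $ v)" for v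
  proof (rule CauchyI)
    fix e :: real assume e: "e > 0"
    \<comment> \<open>The denominator \<open>C + 1\<close> stays positive for \<open>C = 0\<close>
      and makes the final inequality strict.\<close>
    define \<delta> where "\<delta> = e / (C + 1) / 2"
    have \<delta>: "\<delta> > 0" using e C by (simp add: \<delta>_def)
    obtain M1 where M1: "\<forall>m\<ge>M1. \<forall>n\<ge>M1. norm (u m - u n) < \<delta>" using CauchyD[OF LIMSEQ_imp_Cauchy[OF u] \<delta>] by blast
    obtain M2 where M2: "\<forall>m\<ge>M2. \<forall>n\<ge>M2. norm (w m - w n) < \<delta>" using CauchyD[OF LIMSEQ_imp_Cauchy[OF w] \<delta>] by blast
    have "norm (c m $ v - c n $ v) < e" if "m \<ge> max M1 M2" "n \<ge> max M1 M2" for m n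
    proof -
      have "\<bar>(c m - c n) $ v\<bar> \<le> C * (norm (u m - u n) + norm (w m - w n))"
        by (rule C(2)[OF H1_rel_diff[OF R R]])
      also have "\<dots> \<le> C * (\<delta> + \<delta>)"
        using M1 M2 that C(1) by (intro mult_left_mono add_mono) (auto simp: less_imp_le)
      also have "\<dots> < (C + 1) * (\<delta> + \<delta>)" using \<delta> by simp
      also have "\<dots> = e" unfolding \<delta>_def field_sum_of_halves using C(1) by simp
      finally show ?thesis by simp
    qed
    then show "\<exists>M. \<forall>m\<ge>M. \<forall>n\<ge>M. norm (c m $ v - c n $ v) < e" by blast
  qed
  then have "\<exists>y. (\<lambda>n. c n $ v) \<longlonglongrightarrow> y" for v using Cauchy_convergent convergent_def by blast
  then obtain y where y: "\<And>v. (\<lambda>n. c n $ v) \<longlonglongrightarrow> y v" by metis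
  define c' where "c' = (\<chi> v. y v)"
  have c: "c \<longlonglongrightarrow> c'" using y by (intro vec_tendstoI) (simp add: c'_def)
  have cv: "(\<lambda>n. c n $ v) \<longlonglongrightarrow> c' $ v" for v using y by (simp add: c'_def)
  have ue: "(\<lambda>n. u n $ e) \<longlonglongrightarrow> u' $ e" and we: "(\<lambda>n. w n $ e) \<longlonglongrightarrow> w' $ e" for e
    using u w by (auto intro: tendsto_vec_nth)
  have "H1_rel G len u' w' c'"
    unfolding H1_rel_def
  proof (intro conjI ballI)
    show "u' \<in> L2_net G len" "w' \<in> L2_net G len"
      by (rule closed_sequentially[OF closed_L2_net _ u] closed_sequentially[OF closed_L2_net _ w],
          use R in \<open>simp add: H1_rel_def\<close>)+
    show "c' \<in> vertex_vecs (verts G)"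
      unfolding vertex_vecs_def
    proof (intro CollectI allI impI)
      fix v assume "v \<notin> verts G"
      then have "c n $ v = 0" for n using R[of n] by (auto simp: H1_rel_def vertex_vecs_def)
      then show "c' $ v = 0" using cv[of v] LIMSEQ_unique[of "\<lambda>_. 0 :: real"] by auto
    qed
    fix e assume e: "e \<in> arcs G"
    have "(\<lambda>n. (c n $ tail G e) *\<^sub>R unit_trunc (len e) + edge_primitive (len e) (w n $ e)) \<longlonglongrightarrow>
        (c' $ tail G e) *\<^sub>R unit_trunc (len e) + edge_primitive (len e) (w' $ e)"
      using len_pos[OF e] by (intro tendsto_intros cv bounded_linear.tendsto[OF bounded_linear_edge_primitive] we) simp
    moreover have "u n $ e = (c n $ tail G e) *\<^sub>R unit_trunc (len e) + edge_primitive (len e) (w n $ e)" for n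
      using R[of n] e unfolding H1_rel_def by blast
    ultimately show "u' $ e = (c' $ tail G e) *\<^sub>R unit_trunc (len e) + edge_primitive (len e) (w' $ e)"
      using ue[of e] LIMSEQ_unique by auto
    have "(\<lambda>n. c n $ tail G e + (w n $ e) \<bullet> unit_trunc (len e)) \<longlonglongrightarrow> c' $ tail G e + (w' $ e) \<bullet> unit_trunc (len e)"
      by (intro tendsto_intros cv we)
    moreover have "c n $ head G e = c n $ tail G e + (w n $ e) \<bullet> unit_trunc (len e)" for n
      using R[of n] e by (simp add: H1_rel_def)
    ultimately show "c' $ head G e = c' $ tail G e + (w' $ e) \<bullet> unit_trunc (len e)"
      using cv[of "head G e"] LIMSEQ_unique by auto
    fix \<phi> assume \<phi>: "\<phi> \<in> test_funs 0 (len e)"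
    have "(\<lambda>n. - ((w n $ e) \<bullet> trunc_L2 (len e) \<phi>)) \<longlonglongrightarrow> - ((w' $ e) \<bullet> trunc_L2 (len e) \<phi>)"
      "(\<lambda>n. (u n $ e) \<bullet> trunc_L2 (len e) (deriv \<phi>)) \<longlonglongrightarrow> (u' $ e) \<bullet> trunc_L2 (len e) (deriv \<phi>)"
      by (intro tendsto_intros we ue)+
    moreover have "(u n $ e) \<bullet> trunc_L2 (len e) (deriv \<phi>) = - ((w n $ e) \<bullet> trunc_L2 (len e) \<phi>)" for n
      using R[of n] e \<phi> unfolding H1_rel_def by blast
    ultimately show "(u' $ e) \<bullet> trunc_L2 (len e) (deriv \<phi>) = - ((w' $ e) \<bullet> trunc_L2 (len e) \<phi>)"
      using LIMSEQ_unique by auto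
  qed
  with c show ?thesis by blast
qed

end

section \<open>Concrete H1 functions, lifts and vertex functionals\<close>

lemma test_fun_vanishes: "\<phi> \<in> test_funs a b \<Longrightarrow> \<phi> a = 0 \<and> \<phi> b = 0"
  by (fastforce simp: test_funs_def)

lemma trunc_cong: "(\<And>x. x \<in> {0..L} \<Longrightarrow> k x = g x) \<Longrightarrow> trunc_L2 L k = trunc_L2 L g"
  unfolding trunc_L2_def by (rule arg_cong[of _ _ abs_L2]) (auto simp: fun_eq_iff indicator_def)

lemma trunc_mem_L2_net:
  assumes "\<And>e. e \<in> arcs G \<Longrightarrow> continuous_on {0..len e} (k e)"
  shows "(\<chi> e. if e \<in> arcs G then trunc_L2 (len e) (k e) else 0) \<in> L2_net G len"
  unfolding L2_net_def
proof (intro CollectI conjI ballI allI impI)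
  fix e assume e: "e \<in> arcs G"
  show "AE x in lebesgue. x \<notin> {0..len e} \<longrightarrow> rep_L2 ((\<chi> e. if e \<in> arcs G then trunc_L2 (len e) (k e) else 0) $ e) x = 0"
    using rep_trunc[OF assms[OF e]] by eventually_elim (use e in simp)
qed simp

text \<open>Fundamental theorem and integration by parts on each edge; the boundary terms vanish
  because test functions are zero at both ends. Interpolants and bumps on one edge are
  instances.\<close>

lemma H1_rel_smooth:
  fixes G :: "('v::finite, 'e::finite) pre_digraph"
  assumes len: "\<And>e. e \<in> arcs G \<Longrightarrow> len e > 0"
    and deriv: "\<And>e x. (k e has_real_derivative k' e x) (at x)" and cont: "\<And>e A. continuous_on A (k' e)"
    and c: "c \<in> vertex_vecs (verts G)"
    and tail: "\<And>e. e \<in> arcs G \<Longrightarrow> k e 0 = c $ tail G e"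
    and head: "\<And>e. e \<in> arcs G \<Longrightarrow> k e (len e) = c $ head G e"
  shows "H1_rel G len (\<chi> e. if e \<in> arcs G then trunc_L2 (len e) (k e) else 0)
    (\<chi> e. if e \<in> arcs G then trunc_L2 (len e) (k' e) else 0) c"
  unfolding H1_rel_def
proof (intro conjI ballI)
  have cont_k: "continuous_on A (k e)" for e A
    using deriv by (meson DERIV_continuous_on has_field_derivative_at_within)
  show "(\<chi> e. if e \<in> arcs G then trunc_L2 (len e) (k e) else 0) \<in> L2_net G len"
    "(\<chi> e. if e \<in> arcs G then trunc_L2 (len e) (k' e) else 0) \<in> L2_net G len"
    by (intro trunc_mem_L2_net cont cont_k)+
  fix e assume e: "e \<in> arcs G"
  let ?L = "len e"
  have inner: "trunc_L2 ?L (k' e) \<bullet> unit_trunc x = k e x - k e 0" if "x \<in> {0..?L}" for x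
  proof -
    have "trunc_L2 ?L (k' e) \<bullet> unit_trunc x = integral {0..x} (\<lambda>x. 1 * k' e x)"
      using that by (intro inner_trunc_trunc cont continuous_on_const) simp
    also have "\<dots> = k e x - k e 0"
      using that deriv by (intro integral_unique fundamental_theorem_of_calculus)
        (auto simp: has_real_derivative_iff_has_vector_derivative[symmetric] intro: has_field_derivative_at_within)
    finally show ?thesis .
  qed
  show "c $ head G e = c $ tail G e + (\<chi> e. if e \<in> arcs G then trunc_L2 (len e) (k' e) else 0) $ e \<bullet> unit_trunc ?L"
    using e inner[of ?L] len[OF e] by (simp add: tail head)
  have "trunc_L2 ?L (k e) = trunc_L2 ?L (\<lambda>x. c $ tail G e * 1 + trunc_L2 ?L (k' e) \<bullet> unit_trunc x)"
    by (rule trunc_cong) (use inner e in \<open>simp add: tail\<close>)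
  also have "\<dots> = (c $ tail G e) *\<^sub>R unit_trunc ?L + edge_primitive ?L (trunc_L2 ?L (k' e))"
    unfolding edge_primitive_def
    using trunc_add[OF continuous_on_const continuous_on_inner_unit_trunc, of ?L "c $ tail G e * 1" "trunc_L2 ?L (k' e)"]
      trunc_scale[OF continuous_on_const, of ?L "c $ tail G e" 1] by (simp only:)
  finally show "(\<chi> e. if e \<in> arcs G then trunc_L2 (len e) (k e) else 0) $ e = (c $ tail G e) *\<^sub>R unit_trunc ?L +
      edge_primitive ?L ((\<chi> e. if e \<in> arcs G then trunc_L2 (len e) (k' e) else 0) $ e)"
    using e by simp
  fix \<phi> assume \<phi>: "\<phi> \<in> test_funs 0 ?L"
  note sm = test_fun_smooth[OF \<phi>]
  note c\<phi> = smooth_fun_continuous_on[OF sm] smooth_fun_continuous_on[OF smooth_fun_deriv[OF sm]]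
  have "integral {0..?L} (\<lambda>x. deriv \<phi> x * k e x) + integral {0..?L} (\<lambda>x. \<phi> x * k' e x)
      = integral {0..?L} (\<lambda>x. deriv \<phi> x * k e x + \<phi> x * k' e x)"
    using c\<phi> cont cont_k by (intro Henstock_Kurzweil_Integration.integral_add[symmetric] integrable_continuous_interval continuous_on_mult)
  also have "\<dots> = \<phi> ?L * k e ?L - \<phi> 0 * k e 0"
  proof (intro integral_unique fundamental_theorem_of_calculus)
    show "((\<lambda>x. \<phi> x * k e x) has_vector_derivative deriv \<phi> x * k e x + \<phi> x * k' e x) (at x within {0..?L})" for x
      using DERIV_mult[OF smooth_fun_has_derivative[OF sm] deriv]
      by (simp add: has_real_derivative_iff_has_vector_derivative[symmetric] mult.commute has_field_derivative_at_within)
  qed (use len[OF e] in simp)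
  also have "\<dots> = 0" using test_fun_vanishes[OF \<phi>] by simp
  finally have "trunc_L2 ?L (k e) \<bullet> trunc_L2 ?L (deriv \<phi>) = - (trunc_L2 ?L (k' e) \<bullet> trunc_L2 ?L \<phi>)"
    by (simp add: inner_trunc_trunc c\<phi> cont cont_k)
  then show "(\<chi> e. if e \<in> arcs G then trunc_L2 (len e) (k e) else 0) $ e \<bullet> trunc_L2 ?L (deriv \<phi>) =
      - ((\<chi> e. if e \<in> arcs G then trunc_L2 (len e) (k' e) else 0) $ e \<bullet> trunc_L2 ?L \<phi>)"
    using e by simp
qed (rule c)

text \<open>The graph of the edge derivative as an unbounded operator: \<open>S = {}\<close> gives
  all of H1, \<open>S = VD\<close> the space H1_0.\<close>

definition H1_graph :: "('v::finite, 'e::finite) pre_digraph \<Rightarrow> ('e \<Rightarrow> real) \<Rightarrow> 'v set \<Rightarrow> ((L2^'e) \<times> (L2^'e)) set" where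
  "H1_graph G len S = {(u, w). \<exists>c. H1_rel G len u w c \<and> (\<forall>v\<in>S. c $ v = 0)}"

context
  fixes G :: "('v::finite, 'e::finite) pre_digraph" and len :: "'e \<Rightarrow> real" and VD VN :: "'v set"
  assumes network: "network G len VD VN"
begin

text \<open>Affine interpolation between the end values of each edge.\<close>

lemma H1_rel_interpolation:
  assumes "c \<in> vertex_vecs (verts G)"
  shows "\<exists>u w. H1_rel G len u w c"
proof -
  let ?s = "\<lambda>e. (c $ head G e - c $ tail G e) / len e"
  have "H1_rel G len (\<chi> e. if e \<in> arcs G then trunc_L2 (len e) (\<lambda>x. c $ tail G e + ?s e * x) else 0)
    (\<chi> e. if e \<in> arcs G then trunc_L2 (len e) (\<lambda>_. ?s e) else 0) c"
  proof (rule H1_rel_smooth[OF len_pos[OF network]])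
    show "((\<lambda>x. c $ tail G e + ?s e * x) has_real_derivative ?s e) (at x)" for e x
      using DERIV_add[OF DERIV_const DERIV_cmult[OF DERIV_ident], of "c $ tail G e" "?s e" x] by simp
    show "c $ tail G e + ?s e * len e = c $ head G e" if "e \<in> arcs G" for e
      using len_pos[OF network that] by simp
  qed (use assms in auto)
  then show ?thesis by blast
qed

lemma H1_rel_test_fun:
  assumes e: "e \<in> arcs G" and \<phi>: "\<phi> \<in> test_funs 0 (len e)"
  shows "\<exists>u w. H1_rel G len u w 0 \<and> (\<forall>k\<in>L2_net G len. k \<bullet> u = (k $ e) \<bullet> trunc_L2 (len e) \<phi>)"
proof -
  note sm = test_fun_smooth[OF \<phi>]
  let ?k = "\<lambda>e'. if e' = e then \<phi> else (\<lambda>_. 0)" and ?k' = "\<lambda>e'. if e' = e then deriv \<phi> else (\<lambda>_. 0)"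
  let ?u = "\<chi> e'. if e' \<in> arcs G then trunc_L2 (len e') (?k e') else 0"
  have "H1_rel G len ?u (\<chi> e'. if e' \<in> arcs G then trunc_L2 (len e') (?k' e') else 0) 0"
    using smooth_fun_has_derivative[OF sm] smooth_fun_continuous_on[OF smooth_fun_deriv[OF sm]] test_fun_vanishes[OF \<phi>]
    by (intro H1_rel_smooth[OF len_pos[OF network]]) (auto simp: vertex_vecs_def)
  moreover have "k \<bullet> ?u = (k $ e) \<bullet> trunc_L2 (len e) \<phi>" for k
  proof -
    have "trunc_L2 L (\<lambda>_. 0) = 0" for L by (simp add: trunc_L2_def zero_L2_def)
    then have "(k $ e') \<bullet> (?u $ e') = (if e' = e then (k $ e) \<bullet> trunc_L2 (len e) \<phi> else 0)" for e'
      using e by simp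
    then show ?thesis unfolding inner_vec_def by simp
  qed
  ultimately show ?thesis by blast
qed

text \<open>Bumps on single edges already determine \<open>k\<close> by the fundamental lemma. This
  is density of H1_0 in the orthogonality form that the skew block expects.\<close>

lemma H1_0_dense:
  assumes k: "k \<in> L2_net G len" and orth: "\<And>u w. H1_rel G len u w 0 \<Longrightarrow> k \<bullet> u = 0"
  shows "k = 0"
proof -
  have "k $ e = 0" for e
  proof (cases "e \<in> arcs G")
    case True
    show ?thesis
    proof (rule test_orthogonal_imp_zero)
      show "(k $ e) \<bullet> trunc_L2 (len e) \<phi> = 0" if "\<phi> \<in> test_funs 0 (len e)" for \<phi>
        using H1_rel_test_fun[OF True that] k orth by metis
      show "AE x in lebesgue. x \<notin> {0..len e} \<longrightarrow> rep_L2 (k $ e) x = 0" using k True by (auto simp: L2_net_def)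
    qed
  next
    case False
    then show ?thesis using k by (auto simp: L2_net_def)
  qed
  then show ?thesis by (simp add: vec_eq_iff)
qed

lemma H1_rel_sum:
  assumes "finite S" "\<And>v. v \<in> S \<Longrightarrow> H1_rel G len (u v) (w v) (c v)"
  shows "H1_rel G len (\<Sum>v\<in>S. u v) (\<Sum>v\<in>S. w v) (\<Sum>v\<in>S. c v)"
  using assms by (induction rule: finite_induct) (auto intro: H1_rel_zero[OF network] H1_rel_add[OF network])

text \<open>Linear combinations of interpolated unit vectors. Linearity and boundedness in the
  vertex data let the lift commute with time derivatives and time integrals.\<close>

lemma H1_lift_exists:
  obtains lift dlift :: "real^'v \<Rightarrow> L2^'e" where "bounded_linear lift" "bounded_linear dlift"
    "\<And>c. c \<in> vertex_vecs (verts G) \<Longrightarrow> H1_rel G len (lift c) (dlift c) c"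
proof -
  have "\<exists>u w. v \<in> verts G \<longrightarrow> H1_rel G len u w (axis v 1)" for v
    using H1_rel_interpolation[of "axis v 1"] by (auto simp: vertex_vecs_def axis_def)
  then obtain \<psi> \<psi>' where \<psi>: "\<And>v. v \<in> verts G \<Longrightarrow> H1_rel G len (\<psi> v) (\<psi>' v) (axis v 1)" by metis
  show ?thesis
  proof
    show "bounded_linear (\<lambda>c. \<Sum>v\<in>verts G. (c $ v) *\<^sub>R \<psi> v)" "bounded_linear (\<lambda>c. \<Sum>v\<in>verts G. (c $ v) *\<^sub>R \<psi>' v)"
      by (intro bounded_linear_sum bounded_linear_compose[OF bounded_linear_scaleR_left] bounded_linear_vec_nth)+
    fix c assume c: "c \<in> vertex_vecs (verts G)"
    have "H1_rel G len (\<Sum>v\<in>verts G. (c $ v) *\<^sub>R \<psi> v) (\<Sum>v\<in>verts G. (c $ v) *\<^sub>R \<psi>' v) (\<Sum>v\<in>verts G. (c $ v) *\<^sub>R axis v 1)"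
      using \<psi> by (intro H1_rel_sum H1_rel_scale[OF network]) auto
    moreover have "(\<Sum>v\<in>verts G. (c $ v) *\<^sub>R axis v 1) = c"
    proof (rule vec_eq_iff[THEN iffD2, rule_format])
      fix v
      have "(\<Sum>x\<in>verts G. c $ x * (if v = x then 1 else 0)) = (if v \<in> verts G then c $ v else 0)"
        by (simp add: if_distrib[of "\<lambda>y. _ * y"] cong: if_cong)
      then show "(\<Sum>v\<in>verts G. (c $ v) *\<^sub>R axis v 1) $ v = c $ v"
        using c by (auto simp: axis_def vertex_vecs_def)
    qed
    ultimately show "H1_rel G len (\<Sum>v\<in>verts G. (c $ v) *\<^sub>R \<psi> v) (\<Sum>v\<in>verts G. (c $ v) *\<^sub>R \<psi>' v) c" by simp
  qed
qed

lemma subspace_H1_graph: "subspace (H1_graph G len S)"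
proof (rule subspaceI)
  show "0 \<in> H1_graph G len S" using H1_rel_zero[OF network] by (auto simp: H1_graph_def zero_prod_def intro!: exI[of _ 0])
  fix x y and r :: real assume x: "x \<in> H1_graph G len S"
  then obtain u w c where xc: "x = (u, w)" "H1_rel G len u w c" "\<forall>v\<in>S. c $ v = 0" by (auto simp: H1_graph_def)
  show "r *\<^sub>R x \<in> H1_graph G len S"
    using H1_rel_scale[OF network xc(2), of r] xc by (auto simp: H1_graph_def intro!: exI[of _ "r *\<^sub>R c"])
  assume "y \<in> H1_graph G len S"
  then obtain u' w' c' where yc: "y = (u', w')" "H1_rel G len u' w' c'" "\<forall>v\<in>S. c' $ v = 0" by (auto simp: H1_graph_def)
  show "x + y \<in> H1_graph G len S"
    using H1_rel_add[OF network xc(2) yc(2)] xc yc by (auto simp: H1_graph_def intro!: exI[of _ "c + c'"])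
qed

lemma closed_H1_graph: "closed (H1_graph G len S)"
  unfolding closed_sequential_limits
proof (intro allI impI, elim conjE)
  fix x l assume x: "\<forall>n. x n \<in> H1_graph G len S" and lim: "x \<longlonglongrightarrow> l"
  then obtain c where c: "\<And>n. H1_rel G len (fst (x n)) (snd (x n)) (c n)" "\<And>n v. v \<in> S \<Longrightarrow> c n $ v = 0"
    unfolding H1_graph_def case_prod_beta mem_Collect_eq by metis
  obtain c' where c': "H1_rel G len (fst l) (snd l) c'" "c \<longlonglongrightarrow> c'"
    using H1_rel_limit[OF network c(1) tendsto_fst[OF lim] tendsto_snd[OF lim]] by blast
  have "c' $ v = 0" if "v \<in> S" for v
    using tendsto_vec_nth[OF c'(2), of v] c(2)[OF that] LIMSEQ_unique[of "\<lambda>_. 0 :: real"] by auto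
  with c'(1) show "l \<in> H1_graph G len S" by (auto simp: H1_graph_def case_prod_beta)
qed

text \<open>Vertex evaluation is bounded on the closed graph by the trace inequality, so Riesz
  representation in the product space yields one vector for \<open>u\<close> and one for
  \<open>w\<close>. The latter is the building block of \<open>Z\<close>.\<close>

lemma vertex_evaluation_representation:
  obtains z \<zeta> :: "'v \<Rightarrow> L2^'e" where "\<And>v. \<zeta> v \<in> L2_net G len"
    "\<And>u w c v. H1_rel G len u w c \<Longrightarrow> c $ v = z v \<bullet> u + \<zeta> v \<bullet> w"
proof -
  obtain C where C: "C \<ge> 0" "\<And>u w c v. H1_rel G len u w c \<Longrightarrow> \<bar>c $ v\<bar> \<le> C * (norm u + norm w)"
    by (rule vertex_values_bound[OF network]) blast
  have "\<exists>z. \<forall>x\<in>H1_graph G len {}. vertex_values G len (fst x) $ v = z \<bullet> x" for v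
  proof (rule riesz_on_subspace[OF subspace_H1_graph closed_H1_graph])
    fix x y and r :: real assume x: "x \<in> H1_graph G len {}"
    then obtain u w c where xc: "x = (u, w)" "H1_rel G len u w c" by (auto simp: H1_graph_def)
    show "vertex_values G len (fst (r *\<^sub>R x)) $ v = r * (vertex_values G len (fst x) $ v)"
      using vertex_values_eq[OF network H1_rel_scale[OF network xc(2), of r]] vertex_values_eq[OF network xc(2)]
      by (simp add: xc(1))
    have "\<bar>c $ v\<bar> \<le> C * (norm u + norm w)" by (rule C(2)[OF xc(2)])
    also have "\<dots> \<le> C * (norm x + norm x)"
      using C(1) norm_fst_le[of u w] norm_snd_le[of w u] unfolding xc(1) by (intro mult_left_mono add_mono)
    finally show "\<bar>vertex_values G len (fst x) $ v\<bar> \<le> (2 * C) * norm x"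
      using vertex_values_eq[OF network xc(2)] by (simp add: xc(1))
    assume "y \<in> H1_graph G len {}"
    then obtain u' w' c' where yc: "y = (u', w')" "H1_rel G len u' w' c'" by (auto simp: H1_graph_def)
    show "vertex_values G len (fst (x + y)) $ v = vertex_values G len (fst x) $ v + vertex_values G len (fst y) $ v"
      using vertex_values_eq[OF network H1_rel_add[OF network xc(2) yc(2)]] vertex_values_eq[OF network xc(2)]
        vertex_values_eq[OF network yc(2)] by (simp add: xc(1) yc(1))
  qed
  then obtain Z where Z: "\<And>v x. x \<in> H1_graph G len {} \<Longrightarrow> vertex_values G len (fst x) $ v = Z v \<bullet> x" by metis
  show ?thesis
  proof
    \<comment> \<open>Projecting keeps the formula, since \<open>w\<close> is a network function,
      and puts the vector in \<open>L2_net\<close>, where \<open>m\<close> has to stay.\<close>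
    show "net_proj G len (snd (Z v)) \<in> L2_net G len" for v by (rule net_proj_mem)
    fix u w c v assume R: "H1_rel G len u w c"
    then have "(u, w) \<in> H1_graph G len {}" by (auto simp: H1_graph_def)
    from Z[OF this, of v] have "c $ v = fst (Z v) \<bullet> u + snd (Z v) \<bullet> w"
      using vertex_values_eq[OF network R] by (simp add: inner_prod_def)
    moreover have "net_proj G len w = w" using R by (simp add: H1_rel_def L2_net_iff[symmetric])
    ultimately show "c $ v = fst (Z v) \<bullet> u + net_proj G len (snd (Z v)) \<bullet> w"
      using net_proj_self_adjoint[of G len "snd (Z v)" w] by simp
  qed
qed

end

section \<open>Classical solutions\<close>

lemma time_deriv_eq:
  assumes "T > 0" "t \<in> {0..T}" "(f has_vector_derivative f') (at t within {0..T})"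
  shows "time_deriv T f t = f'"
  unfolding time_deriv_def using vector_derivative_within_cbox[of 0 T t f f'] assms by simp

lemma C1_timeI:
  assumes T: "T > 0" and X: "\<And>t. t \<in> {0..T} \<Longrightarrow> f t \<in> X"
    and f': "\<And>t. t \<in> {0..T} \<Longrightarrow> (f has_vector_derivative f' t) (at t within {0..T})" "continuous_on {0..T} f'"
  shows "f \<in> C1_time T X"
  unfolding C1_time_def
proof (intro CollectI conjI ballI)
  show "continuous_on {0..T} (time_deriv T f)"
    using f'(2) by (rule continuous_on_eq) (rule time_deriv_eq[OF T _ f'(1), symmetric])
qed (use X f'(1) in \<open>auto intro: differentiableI_vector\<close>)

lemma C1_time_has_vector_derivative:
  assumes "f \<in> C1_time T X" "t \<in> {0..T}"
  shows "(f has_vector_derivative time_deriv T f t) (at t within {0..T})"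
  using assms unfolding C1_time_def time_deriv_def by (simp add: vector_derivative_works[symmetric])

context
  fixes G :: "('v::finite, 'e::finite) pre_digraph" and len :: "'e \<Rightarrow> real" and VD VN :: "'v set"
  assumes network: "network G len VD VN"
begin

lemma eval_op_eq:
  assumes "H1_rel G len q w c"
  shows "eval_op G len S q = (\<chi> v. if v \<in> S then c $ v else 0)"
  unfolding eval_op_def vertex_values_eq[OF network assms] ..

lemma eval_adj_eq: "H1_rel G len q w c \<Longrightarrow> eval_adj G len S y q = (\<Sum>v\<in>S. y $ v * c $ v)"
  by (simp add: eval_adj_def eval_op_eq inner_vec_def if_distrib[of "\<lambda>x. _ * x"] sum.If_cases cong: if_cong)

lemma K_adj_eq: "H1_rel G len q w c \<Longrightarrow> K_adj G len m q = w \<bullet> m"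
  by (simp add: K_adj_def K_op_def edge_deriv_eq[OF network])

lemma K_op_eq: "H1_rel G len q w c \<Longrightarrow> K_op G len q m = w \<bullet> m"
  by (simp add: K_op_def edge_deriv_eq[OF network])

lemma H1_0_net_iff: "q \<in> H1_0_net G len VD \<longleftrightarrow> (\<exists>w c. H1_rel G len q w c \<and> (\<forall>v\<in>VD. c $ v = 0))"
proof
  assume "q \<in> H1_0_net G len VD"
  then obtain w c where R: "H1_rel G len q w c" and "eval_op G len VD q = 0"
    by (auto simp: H1_0_net_def H1_net_iff[OF network])
  then show "\<exists>w c. H1_rel G len q w c \<and> (\<forall>v\<in>VD. c $ v = 0)"
    unfolding eval_op_eq[OF R] vec_eq_iff by (intro exI[of _ w] exI[of _ c]) (simp split: if_splits)
next
  assume "\<exists>w c. H1_rel G len q w c \<and> (\<forall>v\<in>VD. c $ v = 0)"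
  then obtain w c where R: "H1_rel G len q w c" "\<forall>v\<in>VD. c $ v = 0" by blast
  then show "q \<in> H1_0_net G len VD"
    unfolding H1_0_net_def by (auto simp: H1_net_iff[OF network] eval_op_eq[OF R(1)] vec_eq_iff)
qed

lemma VD_subset: "VD \<subseteq> verts G" and VD_VN: "VD \<inter> VN = {}"
  using network by (auto simp: network_def)

lemma sum_axis: "(\<Sum>v\<in>S. y v *\<^sub>R axis v 1) $ v = (if v \<in> S then y v else (0::real))"
  for S :: "'v set"
proof -
  have "(\<Sum>x\<in>S. y x * (if v = x then 1 else 0)) = (if v \<in> S then y v else 0)"
    by (simp add: if_distrib[of "\<lambda>y. _ * y"] cong: if_cong)
  then show ?thesis by (simp add: axis_def)
qed

lemma classical_solution_unique:
  assumes a: "net_coefficient G len 0 a_max a" and d_min: "0 < d_min" and d: "net_coefficient G len d_min d_max d"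
    and T: "T > 0" and \<epsilon>: "\<epsilon> > 0"
    and sol: "classical_solution G len VD VN a d \<epsilon> T f g h r p0 m0 p m l"
    and sol': "classical_solution G len VD VN a d \<epsilon> T f g h r p0 m0 p' m' l'"
    and t: "t \<in> {0..T}"
  shows "p t = p' t \<and> m t = m' t \<and> l t = l' t"
proof -
  obtain a' Ka where a': "bounded_coeff Ka a'" "\<And>e x. 0 \<le> a' e x" "\<And>u. u \<in> L2_net G len \<Longrightarrow> coeff_mult a u = coeff_mult a' u"
    by (rule net_coefficient_clean[OF a]) auto
  obtain d' Kd where d': "bounded_coeff Kd d'" "\<And>e x. 0 \<le> d' e x" "\<And>u. u \<in> L2_net G len \<Longrightarrow> coeff_mult d u = coeff_mult d' u"
    using d_min by (auto intro: net_coefficient_clean[OF d])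
  note linA = linear_simps[OF bounded_linear_coeff_mult[OF a'(1)]]
  note linD = linear_simps[OF bounded_linear_coeff_mult[OF d'(1)]]
  have mem: "p s \<in> L2_net G len" "m s \<in> L2_net G len" "p s \<in> H1_net G len"
    "p' s \<in> L2_net G len" "m' s \<in> L2_net G len" "p' s \<in> H1_net G len" if "s \<in> {0..T}" for s
    using sol sol' that by (auto simp: classical_solution_def C1_time_def C0_time_H1_def)
  have eq1: "time_deriv T p s \<bullet> q + coeff_mult a' (p s) \<bullet> q - w \<bullet> m s + (\<Sum>v\<in>VD. l s $ v * c $ v) = g s \<bullet> q - (\<Sum>v\<in>VN. r s $ v * c $ v)"
      "time_deriv T p' s \<bullet> q + coeff_mult a' (p' s) \<bullet> q - w \<bullet> m' s + (\<Sum>v\<in>VD. l' s $ v * c $ v) = g s \<bullet> q - (\<Sum>v\<in>VN. r s $ v * c $ v)"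
    if s: "s \<in> {0..T}" and R: "H1_rel G len q w c" for s q w c
  proof -
    have q: "q \<in> H1_net G len" using R by (auto simp: H1_net_iff[OF network])
    have "time_deriv T p s \<bullet> q + coeff_mult a (p s) \<bullet> q - K_adj G len (m s) q + eval_adj G len VD (l s) q = g s \<bullet> q - eval_adj G len VN (r s) q"
      "time_deriv T p' s \<bullet> q + coeff_mult a (p' s) \<bullet> q - K_adj G len (m' s) q + eval_adj G len VD (l' s) q = g s \<bullet> q - eval_adj G len VN (r s) q"
      using sol sol' s q unfolding classical_solution_def by blast+
    then show "time_deriv T p s \<bullet> q + coeff_mult a' (p s) \<bullet> q - w \<bullet> m s + (\<Sum>v\<in>VD. l s $ v * c $ v) = g s \<bullet> q - (\<Sum>v\<in>VN. r s $ v * c $ v)"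
      "time_deriv T p' s \<bullet> q + coeff_mult a' (p' s) \<bullet> q - w \<bullet> m' s + (\<Sum>v\<in>VD. l' s $ v * c $ v) = g s \<bullet> q - (\<Sum>v\<in>VN. r s $ v * c $ v)"
      by (simp_all add: a'(3)[OF mem(1)[OF s]] a'(3)[OF mem(4)[OF s]] K_adj_eq[OF R] eval_adj_eq[OF R])
  qed
  \<comment> \<open>The squared norm of \<delta> is the energy with weight \<epsilon> on the second
    component; in its derivative the coupling terms of the two equations cancel.\<close>
  define \<delta> where "\<delta> s = (p s - p' s, sqrt \<epsilon> *\<^sub>R (m s - m' s))" for s
  define \<delta>' where "\<delta>' s = (time_deriv T p s - time_deriv T p' s, sqrt \<epsilon> *\<^sub>R (time_deriv T m s - time_deriv T m' s))" for s
  have "norm (\<delta> t) \<le> norm (\<delta> 0) + 0 * t" if t: "t \<in> {0..T}" for t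
  proof (rule norm_le_initial_plus_linear[OF _ _ order_refl t])
    fix s assume s: "s \<in> {0..T}"
    have "(p has_vector_derivative time_deriv T p s) (at s within {0..T})" "(p' has_vector_derivative time_deriv T p' s) (at s within {0..T})"
      "(m has_vector_derivative time_deriv T m s) (at s within {0..T})" "(m' has_vector_derivative time_deriv T m' s) (at s within {0..T})"
      using sol sol' s by (auto simp: classical_solution_def intro!: C1_time_has_vector_derivative)
    then show "(\<delta> has_vector_derivative \<delta>' s) (at s within {0..T})"
      unfolding \<delta>_def[abs_def] \<delta>'_def
      by (intro has_vector_derivative_Pair has_vector_derivative_diff
          bounded_linear.has_vector_derivative[OF bounded_linear_scaleR_right])
    obtain w c w' c' where R: "H1_rel G len (p s) w c" "H1_rel G len (p' s) w' c'"
      using mem[OF s] by (auto simp: H1_net_iff[OF network])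
    have "eval_op G len VD (p s) = eval_op G len VD (p' s)"
      using sol sol' s by (simp add: classical_solution_def)
    \<comment> \<open>Equal boundary data put the difference in H1_0, so the multipliers drop out
      when it is the test function.\<close>
    then have c0: "(c - c') $ v = 0" if "v \<in> VD" for v
      using that by (auto simp: eval_op_eq[OF R(1)] eval_op_eq[OF R(2)] vec_eq_iff split: if_splits)
    let ?q = "p s - p' s" and ?w = "m s - m' s"
    note Rd = H1_rel_diff[OF network R]
    have "(time_deriv T p s - time_deriv T p' s) \<bullet> ?q + coeff_mult a' ?q \<bullet> ?q - (w - w') \<bullet> ?w = 0"
      using eq1[OF s Rd] c0 by (simp add: inner_diff_left inner_diff_right linA)
    moreover have "\<epsilon> * ((time_deriv T m s - time_deriv T m' s) \<bullet> ?w) + (w - w') \<bullet> ?w + coeff_mult d' ?w \<bullet> ?w = 0"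
    proof -
      have "?w \<in> L2_net G len" using mem[OF s] by (intro subspace_diff[OF subspace_L2_net])
      then have "\<epsilon> * (time_deriv T m s \<bullet> ?w) + K_op G len (p s) ?w + coeff_mult d (m s) \<bullet> ?w = f s \<bullet> ?w"
        "\<epsilon> * (time_deriv T m' s \<bullet> ?w) + K_op G len (p' s) ?w + coeff_mult d (m' s) \<bullet> ?w = f s \<bullet> ?w"
        using sol sol' s unfolding classical_solution_def by blast+
      then show ?thesis
        by (simp add: K_op_eq[OF R(1)] K_op_eq[OF R(2)] d'(3)[OF mem(2)[OF s]] d'(3)[OF mem(5)[OF s]] linD inner_diff_left
            right_diff_distrib)
    qed
    moreover have "0 \<le> coeff_mult a' ?q \<bullet> ?q" "0 \<le> coeff_mult d' ?w \<bullet> ?w"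
      using coeff_mult_nonneg[OF a'(1,2), of ?q] coeff_mult_nonneg[OF d'(1,2), of ?w] by (simp_all add: inner_commute)
    moreover have "\<delta> s \<bullet> \<delta>' s = (time_deriv T p s - time_deriv T p' s) \<bullet> ?q + \<epsilon> * ((time_deriv T m s - time_deriv T m' s) \<bullet> ?w)"
      using \<epsilon> by (simp add: \<delta>_def \<delta>'_def inner_commute mult.assoc[symmetric])
    ultimately show "\<delta> s \<bullet> \<delta>' s \<le> 0 * norm (\<delta> s)" by simp
  qed
  moreover have "\<delta> 0 = 0" using sol sol' by (simp add: \<delta>_def classical_solution_def zero_prod_def)
  ultimately have "\<delta> s = 0" if "s \<in> {0..T}" for s using that by force
  then have pm: "p s = p' s" "m s = m' s" if "s \<in> {0..T}" for s
    using that \<epsilon> by (auto simp: \<delta>_def zero_prod_def)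
  have "(p' has_vector_derivative time_deriv T p' t) (at t within {0..T})"
    using sol' t by (auto simp: classical_solution_def intro: C1_time_has_vector_derivative)
  then have "(p has_vector_derivative time_deriv T p' t) (at t within {0..T})"
    by (rule has_vector_derivative_transform[OF t pm(1), rotated])
  then have dp: "time_deriv T p t = time_deriv T p' t" by (rule time_deriv_eq[OF T t])
  \<comment> \<open>Once \<open>p\<close> and \<open>m\<close> agree, a test function whose only
    nonzero vertex value is at \<open>v\<close> isolates this component of the multiplier.\<close>
  have "l t $ v = l' t $ v" for v
  proof (cases "v \<in> VD")
    case True
    then have "axis v 1 \<in> vertex_vecs (verts G)" using VD_subset by (auto simp: vertex_vecs_def axis_def)
    then obtain q w where "H1_rel G len q w (axis v 1)" using H1_rel_interpolation[OF network] by blast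
    from eq1[OF t this] have "(\<Sum>x\<in>VD. l t $ x * axis v 1 $ x) = (\<Sum>x\<in>VD. l' t $ x * axis v 1 $ x)"
      by (simp add: pm[OF t] dp)
    moreover have "(\<Sum>x\<in>VD. y $ x * axis v 1 $ x) = y $ v" for y :: "real^'v"
      using True by (simp add: axis_def if_distrib[of "\<lambda>x. _ * x"] cong: if_cong)
    ultimately show ?thesis by simp
  next
    case False
    then show ?thesis using sol sol' t by (auto simp: classical_solution_def C0_time_def vertex_vecs_def)
  qed
  then have "l t = l' t" by (simp add: vec_eq_iff)
  with pm[OF t] show ?thesis by simp
qed

lemma classical_solution_exists:
  assumes a: "net_coefficient G len 0 a_max a" and d_min: "0 < d_min" and d: "net_coefficient G len d_min d_max d"
    and T: "T > 0" and \<epsilon>: "\<epsilon> > 0"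
    and f: "f \<in> H1_time T (L2_net G len)" and g: "g \<in> H1_time T (L2_net G len)"
    and h: "h \<in> H2_time T (vertex_vecs VD)" and r: "r \<in> H2_time T (vertex_vecs VN)"
    and p0: "p0 \<in> H1_net G len" "eval_op G len VD p0 = h 0" and m0: "m0 \<in> L2_net G len"
    and compat: "\<exists>m_star\<in>L2_net G len. \<forall>q\<in>H1_0_net G len VD.
           m_star \<bullet> q = K_adj G len m0 q - eval_adj G len VN (r 0) q"
  shows "\<exists>p m l. classical_solution G len VD VN a d \<epsilon> T f g h r p0 m0 p m l"
proof -
  let ?P = "net_proj G len"
  note P = bounded_linear_net_proj[of G len] and P_adj = net_proj_self_adjoint[of G len]
  define \<sigma> where "\<sigma> = sqrt \<epsilon>"
  have \<sigma>: "\<sigma> > 0" "\<sigma> * \<sigma> = \<epsilon>" using \<epsilon> by (auto simp: \<sigma>_def)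
  obtain a' Ka where a': "bounded_coeff Ka a'" "\<And>e x. 0 \<le> a' e x" "\<And>u. u \<in> L2_net G len \<Longrightarrow> coeff_mult a u = coeff_mult a' u"
    "\<And>u. coeff_mult a' (?P u) = coeff_mult a' u"
    by (rule net_coefficient_clean[OF a]) auto
  obtain d' Kd where d': "bounded_coeff Kd d'" "\<And>e x. 0 \<le> d' e x" "\<And>u. u \<in> L2_net G len \<Longrightarrow> coeff_mult d u = coeff_mult d' u"
    "\<And>u. coeff_mult d' (?P u) = coeff_mult d' u"
    by (rule net_coefficient_clean[OF d]) (use d_min in auto)
  define M1 where "M1 = coeff_mult a'"
  define Md where "Md = coeff_mult d'"
  \<comment> \<open>The unknown is \<sigma> times the shifted \<open>m\<close>: one factor 1 /
    \<sigma> comes from undoing this scaling, the other from dividing the second equation by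
    \<sigma>.\<close>
  define M2 where "M2 u = (1 / \<epsilon>) *\<^sub>R Md u" for u
  have M1: "bounded_linear M1" "\<And>u. 0 \<le> u \<bullet> M1 u" "\<And>u. M1 (?P u) = M1 u"
    unfolding M1_def using a' by (auto intro: bounded_linear_coeff_mult coeff_mult_nonneg)
  have Md: "bounded_linear Md" "\<And>u. 0 \<le> u \<bullet> Md u" "\<And>u. Md (?P u) = Md u"
    unfolding Md_def using d' by (auto intro: bounded_linear_coeff_mult coeff_mult_nonneg)
  have M2: "bounded_linear M2" "\<And>u. 0 \<le> u \<bullet> M2 u"
    unfolding M2_def using Md \<epsilon> by (auto intro: bounded_linear_compose[OF bounded_linear_scaleR_right])
  obtain lift dlift :: "real^'v \<Rightarrow> L2^'e" where lift: "bounded_linear lift" "bounded_linear dlift"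
    "\<And>c. c \<in> vertex_vecs (verts G) \<Longrightarrow> H1_rel G len (lift c) (dlift c) c"
    by (rule H1_lift_exists[OF network]) blast
  obtain z \<zeta> :: "'v \<Rightarrow> L2^'e" where z: "\<And>v. \<zeta> v \<in> L2_net G len"
    "\<And>u w c v. H1_rel G len u w c \<Longrightarrow> c $ v = z v \<bullet> u + \<zeta> v \<bullet> w"
    by (rule vertex_evaluation_representation[OF network]) blast
  \<comment> \<open>By \<open>Z_eq\<close> below, \<open>\<C>\<^sup>* r\<close> at \<open>q\<close>
    equals \<open>\<Phi> r \<bullet> q + Z r \<bullet> w\<close>, with \<open>w\<close> the edge
    derivative of \<open>q\<close>. The part with \<open>w\<close> is absorbed by \<open>m\<close>,
    the other is an L2 source.\<close>
  define \<Phi> where "\<Phi> y = (\<Sum>v\<in>VN. (y $ v) *\<^sub>R z v)" for y :: "real^'v"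
  define Z where "Z y = (\<Sum>v\<in>VN. (y $ v) *\<^sub>R \<zeta> v)" for y :: "real^'v"
  have \<Phi>Z: "bounded_linear \<Phi>" "bounded_linear Z"
    unfolding \<Phi>_def Z_def
    by (intro bounded_linear_sum bounded_linear_compose[OF bounded_linear_scaleR_left] bounded_linear_vec_nth)+
  have Z_mem: "Z y \<in> L2_net G len" for y
    unfolding Z_def by (intro subspace_sum[OF subspace_L2_net] subspace_scale[OF subspace_L2_net] z)
  have Z_eq: "(\<Sum>v\<in>VN. y $ v * c $ v) = \<Phi> y \<bullet> q + Z y \<bullet> w" if "H1_rel G len q w c" for y q w c
    unfolding \<Phi>_def Z_def inner_sum_left inner_scaleR_left sum.distrib[symmetric] distrib_left[symmetric]
    using z(2)[OF that] by simp
  obtain h' where h': "continuous_on {0..T} h'" "has_integrable_derivative T h'"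
    "\<And>t. t \<in> {0..T} \<Longrightarrow> (h has_vector_derivative h' t) (at t within {0..T})"
    "has_integrable_derivative T h" "continuous_on {0..T} h" "\<And>t. t \<in> {0..T} \<Longrightarrow> h t \<in> vertex_vecs VD"
    by (rule H2_time_derivative[OF h]) blast
  obtain r' where r': "continuous_on {0..T} r'" "has_integrable_derivative T r'"
    "\<And>t. t \<in> {0..T} \<Longrightarrow> (r has_vector_derivative r' t) (at t within {0..T})"
    "has_integrable_derivative T r" "continuous_on {0..T} r"
    by (rule H2_time_derivative[OF r]) blast
  have fg: "has_integrable_derivative T f" "has_integrable_derivative T g" "continuous_on {0..T} f" "continuous_on {0..T} g"
    using f g by (auto simp: H1_time_has_integrable_derivative) (auto simp: H1_time_def)
  have h_verts: "h t \<in> vertex_vecs (verts G)" if "t \<in> {0..T}" for t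
    using h'(6)[OF that] VD_subset by (auto simp: vertex_vecs_def)
  have t0: "0 \<in> {0..T}" using T by simp

  \<comment> \<open>Off the network \<open>q\<close> is arbitrary and does not influence
    \<open>q'\<close>, so the domain is dense in all of \<open>L2^'e\<close>. On the network
    \<open>q'\<close> is the edge derivative divided by \<sigma>.\<close>
  define V where "V = {x. (?P (fst x), \<sigma> *\<^sub>R snd x) \<in> H1_graph G len VD}"
  have V_iff: "(q, q') \<in> V \<longleftrightarrow> (\<exists>c. H1_rel G len (?P q) (\<sigma> *\<^sub>R q') c \<and> (\<forall>v\<in>VD. c $ v = 0))" for q q'
    by (simp add: V_def H1_graph_def)
  have V_I: "(q, (1 / \<sigma>) *\<^sub>R w) \<in> V" if R: "H1_rel G len q w c" and "\<forall>v\<in>VD. c $ v = 0" for q w c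
  proof -
    have "?P q = q" using R by (simp add: H1_rel_def L2_net_iff)
    then show ?thesis unfolding V_iff using that \<sigma>(1) by auto
  qed
  have V: "subspace V" "closed V"
  proof -
    have lin: "bounded_linear (\<lambda>x. (?P (fst x), \<sigma> *\<^sub>R snd x))"
      by (intro bounded_linear_Pair bounded_linear_compose[OF P] bounded_linear_fst bounded_linear_snd
          bounded_linear_compose[OF bounded_linear_scaleR_right])
    have V_eq: "V = (\<lambda>x. (?P (fst x), \<sigma> *\<^sub>R snd x)) -` H1_graph G len VD" by (auto simp: V_def)
    show "subspace V"
      unfolding V_eq by (rule linear_subspace_vimage[OF bounded_linear.linear[OF lin] subspace_H1_graph[OF network]])
    show "closed V"
      unfolding V_eq by (rule continuous_closed_vimage[OF closed_H1_graph[OF network]])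
        (rule linear_continuous_at[OF lin])
  qed
  have V_single: "y = 0" if y: "(0, y) \<in> V" for y
  proof -
    obtain c where "H1_rel G len 0 (\<sigma> *\<^sub>R y) c"
      using y unfolding V_iff linear_0[OF bounded_linear.linear[OF P]] by blast
    from edge_deriv_eq[OF network this] edge_deriv_eq[OF network H1_rel_zero[OF network]] show ?thesis using \<sigma> by simp
  qed
  have V_dense: "k = 0" if orth: "\<And>q q'. (q, q') \<in> V \<Longrightarrow> k \<bullet> q = 0" for k
  proof -
    have PP: "?P (?P k) = ?P k" using net_proj_mem L2_net_iff by blast
    \<comment> \<open>Off-network vectors belong to the domain with image zero, so \<open>k\<close>
      has no off-network part.\<close>
    have "(k - ?P k, 0) \<in> V"
      unfolding V_iff using H1_rel_zero[OF network] by (auto simp: linear_simps[OF P] PP intro!: exI[of _ 0])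
    from orth[OF this] have "(k - ?P k) \<bullet> (k - ?P k) = - (?P k \<bullet> (k - ?P k))" by (simp add: inner_diff_left)
    also have "\<dots> = 0" unfolding P_adj by (simp add: linear_simps[OF P] PP)
    finally have "?P k = k" by simp
    then have "k \<in> L2_net G len" by (simp add: L2_net_iff)
    then show ?thesis by (rule H1_0_dense[OF network]) (use orth[OF V_I] in auto)
  qed

  \<comment> \<open>The sources that remain when \<open>lift h\<close> is subtracted from
    \<open>p\<close> and \<open>Z r\<close> from \<open>m\<close>, the second equation being divided
    by \<sigma>.\<close>
  define F1 where "F1 t = g t - lift (h' t) - M1 (lift (h t)) - \<Phi> (r t)" for t
  define F2 where "F2 t = (1 / \<sigma>) *\<^sub>R (f t - dlift (h t) - \<epsilon> *\<^sub>R Z (r' t) - Md (Z (r t)))" for t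
  have F1: "has_integrable_derivative T F1"
    unfolding F1_def
    by (intro has_integrable_derivative_diff fg has_integrable_derivative_bounded_linear[OF lift(1)]
        has_integrable_derivative_bounded_linear[OF \<Phi>Z(1)] has_integrable_derivative_bounded_linear[OF M1(1)] h' r')
  have F2: "has_integrable_derivative T F2"
    unfolding F2_def
    by (intro has_integrable_derivative_bounded_linear[OF bounded_linear_scaleR_right] has_integrable_derivative_diff fg
        has_integrable_derivative_bounded_linear[OF lift(2)] has_integrable_derivative_bounded_linear[OF \<Phi>Z(2)]
        has_integrable_derivative_bounded_linear[OF Md(1)] h' r')
  have cont_F2: "continuous_on {0..T} F2"
    unfolding F2_def
    by (intro continuous_on_scaleR continuous_on_const continuous_on_diff fg bounded_linear.continuous_on[OF lift(2)]
        bounded_linear.continuous_on[OF \<Phi>Z(2)] bounded_linear.continuous_on[OF Md(1)] h' r')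

  obtain wp cp where Rp: "H1_rel G len p0 wp cp" using p0 by (auto simp: H1_net_iff[OF network])
  have cp: "(cp - h 0) $ v = 0" if "v \<in> VD" for v
    using p0(2) that unfolding eval_op_eq[OF Rp] vec_eq_iff by (metis (mono_tags) vec_lambda_beta vector_minus_component right_minus_eq)
  have init_p: "(p0 - lift (h 0), (1 / \<sigma>) *\<^sub>R (wp - dlift (h 0))) \<in> V"
    by (rule V_I[OF H1_rel_diff[OF network Rp lift(3)[OF h_verts[OF t0]]]]) (use cp in simp)
  obtain m_star where m_star: "\<And>q. q \<in> H1_0_net G len VD \<Longrightarrow> m_star \<bullet> q = K_adj G len m0 q - eval_adj G len VN (r 0) q"
    using compat by blast
  \<comment> \<open>\<open>\<Phi> (r 0)\<close> restores the part of the nodal term that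
    \<open>Z\<close> does not carry. The projection is there because the pairing runs over ambient
    \<open>q\<close>, while \<open>m_star\<close> is tested only with \<open>?P q\<close>.\<close>
  have init_n: "(\<sigma> *\<^sub>R (m0 - Z (r 0)), ?P (m_star + \<Phi> (r 0))) \<in> adjoint_graph V"
    unfolding adjoint_graph_def
  proof (clarify)
    fix q q' assume "(q, q') \<in> V"
    then obtain c where R: "H1_rel G len (?P q) (\<sigma> *\<^sub>R q') c" "\<forall>v\<in>VD. c $ v = 0" by (auto simp: V_iff)
    then have "?P q \<in> H1_0_net G len VD" by (auto simp: H1_0_net_iff)
    from m_star[OF this] have "m_star \<bullet> ?P q = (\<sigma> *\<^sub>R q') \<bullet> m0 - (\<Phi> (r 0) \<bullet> ?P q + Z (r 0) \<bullet> (\<sigma> *\<^sub>R q'))"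
      unfolding K_adj_eq[OF R(1)] eval_adj_eq[OF R(1)] Z_eq[OF R(1)] .
    then show "?P (m_star + \<Phi> (r 0)) \<bullet> q = (\<sigma> *\<^sub>R (m0 - Z (r 0))) \<bullet> q'"
      unfolding P_adj by (simp add: inner_add_left inner_diff_left inner_commute[of q'] algebra_simps)
  qed
  obtain \<pi> \<nu> \<pi>' \<nu>' where init: "\<pi> 0 = p0 - lift (h 0)" "\<nu> 0 = \<sigma> *\<^sub>R (m0 - Z (r 0))"
    and cont: "continuous_on {0..T} \<pi>'" "continuous_on {0..T} \<nu>'"
    and sol: "\<forall>t\<in>{0..T}. (\<pi> has_vector_derivative \<pi>' t) (at t within {0..T}) \<and>
       (\<nu> has_vector_derivative \<nu>' t) (at t within {0..T}) \<and>
       (\<exists>q k. (\<pi> t, q) \<in> V \<and> (\<nu> t, k) \<in> adjoint_graph V \<and>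
          \<pi>' t = k - M1 (\<pi> t) + F1 t \<and> \<nu>' t = - q - M2 (\<nu> t) + F2 t)"
    using skew_system_solution[OF V V_single V_dense M1(1,2) M2 _ F1 F2 init_p init_n] T by auto

  define p where "p t = ?P (\<pi> t) + lift (h t)" for t
  define p' where "p' t = ?P (\<pi>' t) + lift (h' t)" for t
  define m where "m t = (1 / \<sigma>) *\<^sub>R ?P (\<nu> t) + Z (r t)" for t
  define m' where "m' t = (1 / \<sigma>) *\<^sub>R ?P (\<nu>' t) + Z (r' t)" for t
  \<comment> \<open>The edge derivative of \<open>p\<close>, solved from the second evolution
    equation. All its terms are continuous in time, which yields continuity of \<open>p\<close> in
    the H1 norm.\<close>
  define W where "W t = \<sigma> *\<^sub>R (F2 t - \<nu>' t - M2 (\<nu> t)) + dlift (h t)" for t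
  \<comment> \<open>The term with \<open>r\<close> is absent because the lifted unit vectors of
    \<open>VD\<close> vanish on \<open>VN\<close>.\<close>
  define \<Lambda> where "\<Lambda> t c = (g t - p' t - M1 (p t)) \<bullet> lift c + m t \<bullet> dlift c" for t c
  define l where "l t = (\<Sum>v\<in>VD. \<Lambda> t (axis v 1) *\<^sub>R axis v (1::real))" for t
  have dp: "(p has_vector_derivative p' t) (at t within {0..T})" if "t \<in> {0..T}" for t
    unfolding p_def[abs_def] p'_def
    by (intro has_vector_derivative_add bounded_linear.has_vector_derivative[OF P]
        bounded_linear.has_vector_derivative[OF lift(1)] h'(3)[OF that]) (use sol that in blast)
  have dm: "(m has_vector_derivative m' t) (at t within {0..T})" if "t \<in> {0..T}" for t
    unfolding m_def[abs_def] m'_def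
    by (intro has_vector_derivative_add bounded_linear.has_vector_derivative[OF P]
        bounded_linear.has_vector_derivative[OF bounded_linear_scaleR_right]
        bounded_linear.has_vector_derivative[OF \<Phi>Z(2)] r'(3)[OF that]) (use sol that in blast)
  have cont_p': "continuous_on {0..T} p'" and cont_m': "continuous_on {0..T} m'"
    unfolding p'_def m'_def
    by (intro continuous_on_add continuous_on_scaleR continuous_on_const bounded_linear.continuous_on[OF P]
        bounded_linear.continuous_on[OF lift(1)] bounded_linear.continuous_on[OF \<Phi>Z(2)] cont h' r')+
  have cont_p: "continuous_on {0..T} p" and cont_m: "continuous_on {0..T} m"
    using continuous_on_vector_derivative[of "{0..T}" p p'] continuous_on_vector_derivative[of "{0..T}" m m'] dp dm by auto
  have cont_\<nu>: "continuous_on {0..T} \<nu>"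
    using continuous_on_vector_derivative[of "{0..T}" \<nu> \<nu>'] sol by blast
  have cont_W: "continuous_on {0..T} W"
    unfolding W_def
    by (intro continuous_on_add continuous_on_scaleR continuous_on_const continuous_on_diff cont cont_F2 cont_\<nu>
        bounded_linear.continuous_on[OF lift(2)] bounded_linear.continuous_on[OF M2(1)] h')
  have Rel: "\<exists>c. H1_rel G len (p t) (W t) c \<and> (\<forall>v\<in>VD. c $ v = h t $ v)" if t: "t \<in> {0..T}" for t
  proof -
    obtain q k where "(\<pi> t, q) \<in> V" and q: "\<nu>' t = - q - M2 (\<nu> t) + F2 t" using sol t by blast
    then obtain c where c: "H1_rel G len (?P (\<pi> t)) (\<sigma> *\<^sub>R q) c" "\<forall>v\<in>VD. c $ v = 0" by (auto simp: V_iff)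
    have "H1_rel G len (p t) (W t) (c + h t)"
      using H1_rel_add[OF network c(1) lift(3)[OF h_verts[OF t]]] by (simp add: p_def W_def q)
    then show ?thesis using c(2) by (intro exI[of _ "c + h t"]) simp
  qed
  have p_mem: "p t \<in> L2_net G len" if "t \<in> {0..T}" for t using Rel[OF that] by (auto simp: H1_rel_def)
  have m_mem: "m t \<in> L2_net G len" for t
    unfolding m_def by (intro subspace_add[OF subspace_L2_net] subspace_scale[OF subspace_L2_net] net_proj_mem Z_mem)
  have eq_H1_0: "p' t \<bullet> q + M1 (p t) \<bullet> q - w \<bullet> m t = g t \<bullet> q - (\<Sum>v\<in>VN. r t $ v * c $ v)"
    if t: "t \<in> {0..T}" and R: "H1_rel G len q w c" and c: "\<forall>v\<in>VD. c $ v = 0" for t q w c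
  proof -
    have Pq: "?P q = q" "?P w = w" using R by (auto simp: H1_rel_def L2_net_iff)
    obtain k where k: "(\<nu> t, k) \<in> adjoint_graph V" "\<pi>' t = k - M1 (\<pi> t) + F1 t" using sol t by blast
    have "k \<bullet> q = (1 / \<sigma>) * (\<nu> t \<bullet> w)" using adjoint_graphD[OF k(1) V_I[OF R c]] by simp
    moreover have "w \<bullet> m t = (1 / \<sigma>) * (\<nu> t \<bullet> w) + Z (r t) \<bullet> w"
      using P_adj[of "\<nu> t" w] by (simp add: m_def inner_add_right inner_commute[of w] Pq)
    moreover have "p' t \<bullet> q = \<pi>' t \<bullet> q + lift (h' t) \<bullet> q"
      using P_adj[of "\<pi>' t" q] by (simp add: p'_def inner_add_left Pq)
    moreover have "M1 (p t) = M1 (\<pi> t) + M1 (lift (h t))" by (simp add: p_def linear_simps[OF M1(1)] M1(3))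
    ultimately show ?thesis
      using Z_eq[OF R, of "r t"] by (simp add: k(2) F1_def inner_add_left inner_diff_left)
  qed
  have eq_H1: "p' t \<bullet> q + M1 (p t) \<bullet> q - w \<bullet> m t + (\<Sum>v\<in>VD. l t $ v * c $ v) = g t \<bullet> q - (\<Sum>v\<in>VN. r t $ v * c $ v)"
    if t: "t \<in> {0..T}" and R: "H1_rel G len q w c" for t q w c
  proof -
    \<comment> \<open>\<open>b\<close> keeps the values of \<open>q\<close> on \<open>VD\<close>
      only: \<open>q - lift b\<close> is in H1_0 and has the values of \<open>q\<close> on
      \<open>VN\<close>, so the sum with \<open>r\<close> is unchanged.\<close>
    define b where "b = (\<Sum>v\<in>VD. (c $ v) *\<^sub>R axis v (1::real))"
    have b: "b $ v = (if v \<in> VD then c $ v else 0)" for v unfolding b_def by (rule sum_axis)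
    have "b \<in> vertex_vecs (verts G)" using VD_subset by (auto simp: vertex_vecs_def b)
    note R0 = H1_rel_diff[OF network R lift(3)[OF this]]
    have "(\<Sum>v\<in>VN. r t $ v * (c - b) $ v) = (\<Sum>v\<in>VN. r t $ v * c $ v)"
      using VD_VN by (intro sum.cong) (auto simp: b)
    with eq_H1_0[OF t R0] have "p' t \<bullet> (q - lift b) + M1 (p t) \<bullet> (q - lift b) - (w - dlift b) \<bullet> m t
        = g t \<bullet> (q - lift b) - (\<Sum>v\<in>VN. r t $ v * c $ v)" by (simp add: b)
    moreover have "(\<Sum>v\<in>VD. l t $ v * c $ v) = \<Lambda> t b"
    proof -
      have "linear (\<Lambda> t)"
        unfolding \<Lambda>_def
        by (rule linearI) (simp_all add: linear_simps[OF lift(1)] linear_simps[OF lift(2)] inner_add_right algebra_simps)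
      then have "\<Lambda> t b = (\<Sum>v\<in>VD. c $ v * \<Lambda> t (axis v 1))"
        unfolding b_def by (simp add: linear_sum linear_cmul)
      moreover have "l t $ v = \<Lambda> t (axis v 1)" if "v \<in> VD" for v unfolding l_def sum_axis using that by simp
      ultimately show ?thesis by (simp add: mult.commute)
    qed
    ultimately show ?thesis
      by (simp add: \<Lambda>_def inner_diff_left inner_diff_right inner_commute[of "m t"])
  qed
  have eq_L2: "\<epsilon> *\<^sub>R m' t \<bullet> w + W t \<bullet> w + Md (m t) \<bullet> w = f t \<bullet> w" if w: "w \<in> L2_net G len" for t w
  proof -
    have Pw: "?P w = w" using w by (simp add: L2_net_iff)
    have \<epsilon>\<sigma>: "\<epsilon> * x / \<sigma> = \<sigma> * x" "\<sigma> * x / \<epsilon> = x / \<sigma>" for x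
      using \<sigma>(1) by (simp_all add: \<sigma>(2)[symmetric])
    have "\<epsilon> *\<^sub>R m' t \<bullet> w = \<sigma> * (\<nu>' t \<bullet> w) + \<epsilon> * (Z (r' t) \<bullet> w)"
      using P_adj[of "\<nu>' t" w] by (simp add: m'_def inner_add_left distrib_left Pw \<epsilon>\<sigma>)
    moreover have "W t \<bullet> w = \<sigma> * (F2 t \<bullet> w) - \<sigma> * (\<nu>' t \<bullet> w) - (1 / \<sigma>) * (Md (\<nu> t) \<bullet> w) + dlift (h t) \<bullet> w"
      by (simp add: W_def M2_def inner_add_left inner_diff_left right_diff_distrib \<epsilon>\<sigma>)
    moreover have "\<sigma> * (F2 t \<bullet> w) = f t \<bullet> w - dlift (h t) \<bullet> w - \<epsilon> * (Z (r' t) \<bullet> w) - Md (Z (r t)) \<bullet> w"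
      using \<sigma> by (simp add: F2_def inner_diff_left)
    moreover have "Md (m t) \<bullet> w = (1 / \<sigma>) * (Md (\<nu> t) \<bullet> w) + Md (Z (r t)) \<bullet> w"
      by (simp add: m_def linear_simps[OF Md(1)] Md(3) inner_add_left)
    ultimately show ?thesis by linarith
  qed
  have "classical_solution G len VD VN a d \<epsilon> T f g h r p0 m0 p m l"
    unfolding classical_solution_def
  proof (intro conjI ballI)
    show "p \<in> C1_time T (L2_net G len)" by (rule C1_timeI[OF T p_mem dp cont_p'])
    show "m \<in> C1_time T (L2_net G len)" by (rule C1_timeI[OF T m_mem dm cont_m'])
    show "p \<in> C0_time_H1 T G len"
      unfolding C0_time_H1_def
    proof (intro CollectI conjI ballI)
      show "p t \<in> H1_net G len" if "t \<in> {0..T}" for t using Rel[OF that] by (auto simp: H1_net_iff[OF network])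
      fix t assume t: "t \<in> {0..T}"
      have norm_eq: "H1_norm G len (p s - p t) = sqrt ((norm (p s - p t))\<^sup>2 + (norm (W s - W t))\<^sup>2)" if s: "s \<in> {0..T}" for s
      proof -
        obtain c c' where "H1_rel G len (p s) (W s) c" "H1_rel G len (p t) (W t) c'" using Rel[OF s] Rel[OF t] by blast
        from edge_deriv_eq[OF network H1_rel_diff[OF network this]] show ?thesis by (simp add: H1_norm_def)
      qed
      have "((\<lambda>s. sqrt ((norm (p s - p t))\<^sup>2 + (norm (W s - W t))\<^sup>2)) \<longlongrightarrow> sqrt ((norm (p t - p t))\<^sup>2 + (norm (W t - W t))\<^sup>2)) (at t within {0..T})"
        using cont_p cont_W t unfolding continuous_on_def by (intro tendsto_intros) auto
      then have "((\<lambda>s. sqrt ((norm (p s - p t))\<^sup>2 + (norm (W s - W t))\<^sup>2)) \<longlongrightarrow> 0) (at t within {0..T})" by simp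
      then show "((\<lambda>s. H1_norm G len (p s - p t)) \<longlongrightarrow> 0) (at t within {0..T})"
        by (rule Lim_transform_eventually) (auto simp: eventually_at_filter norm_eq)
    qed
    have "continuous_on {0..T} l"
      unfolding l_def \<Lambda>_def
      by (intro continuous_on_sum continuous_on_scaleR continuous_on_const continuous_on_add continuous_on_inner
          continuous_on_diff fg cont_p' bounded_linear.continuous_on[OF M1(1)] cont_p cont_m)
    moreover have "l t $ v = 0" if "v \<notin> VD" for t v unfolding l_def sum_axis using that by simp
    ultimately show "l \<in> C0_time T (vertex_vecs VD)" by (simp add: C0_time_def vertex_vecs_def)
    have "?P (p0 - lift (h 0)) = p0 - lift (h 0)"
    proof -
      have "p0 - lift (h 0) \<in> L2_net G len"
        using Rp lift(3)[OF h_verts[OF t0]] by (intro subspace_diff[OF subspace_L2_net]) (auto simp: H1_rel_def)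
      then show ?thesis by (simp add: L2_net_iff)
    qed
    then show "p 0 = p0" by (simp add: p_def init)
    have "m0 - Z (r 0) \<in> L2_net G len" by (intro subspace_diff[OF subspace_L2_net] m0 Z_mem)
    then have "?P (m0 - Z (r 0)) = m0 - Z (r 0)" by (simp only: L2_net_iff)
    then show "m 0 = m0" using \<sigma> linear_simps(5)[OF P] by (simp add: m_def init)
    fix t assume t: "t \<in> {0..T}"
    obtain c where R: "H1_rel G len (p t) (W t) c" "\<forall>v\<in>VD. c $ v = h t $ v" using Rel[OF t] by blast
    show "eval_op G len VD (p t) = h t"
      using R(2) h'(6)[OF t] by (auto simp: eval_op_eq[OF R(1)] vec_eq_iff vertex_vecs_def)
    show "\<epsilon> * (time_deriv T m t \<bullet> w) + K_op G len (p t) w + coeff_mult d (m t) \<bullet> w = f t \<bullet> w" if "w \<in> L2_net G len" for w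
      using eq_L2[OF that, of t] by (simp add: K_op_eq[OF R(1)] time_deriv_eq[OF T t dm[OF t]] d'(3)[OF m_mem] Md_def)
    show "time_deriv T p t \<bullet> q + coeff_mult a (p t) \<bullet> q - K_adj G len (m t) q + eval_adj G len VD (l t) q
        = g t \<bullet> q - eval_adj G len VN (r t) q" if q: "q \<in> H1_net G len" for q
    proof -
      obtain w c where Rq: "H1_rel G len q w c" using q by (auto simp: H1_net_iff[OF network])
      show ?thesis
        using eq_H1[OF t Rq]
        by (simp add: K_adj_eq[OF Rq] eval_adj_eq[OF Rq] time_deriv_eq[OF T t dp[OF t]] a'(3)[OF p_mem[OF t]] M1_def)
    qed
  qed
  then show ?thesis by blast
qed

end

theorem lemma3p9:
  fixes G :: "('v::finite, 'e::finite) pre_digraph" and len :: "'e \<Rightarrow> real"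
    and VD VN :: "'v set"
    and a d :: "'e \<Rightarrow> real \<Rightarrow> real" and a_max d_min d_max :: real
    and T \<epsilon> :: real
    and f g :: "real \<Rightarrow> L2^'e" and h r :: "real \<Rightarrow> real^'v"
    and p0 m0 :: "L2^'e"
  assumes "network G len VD VN"
    and "net_coefficient G len 0 a_max a"
    and "0 < d_min" and "net_coefficient G len d_min d_max d"
    and "T > 0" and "\<epsilon> > 0"
    and "f \<in> H1_time T (L2_net G len)" and "g \<in> H1_time T (L2_net G len)"
    and "h \<in> H2_time T (vertex_vecs VD)" and "r \<in> H2_time T (vertex_vecs VN)"
    and "p0 \<in> H1_net G len" and "eval_op G len VD p0 = h 0"
    and "m0 \<in> L2_net G len"
    and "\<exists>m_star\<in>L2_net G len. \<forall>q\<in>H1_0_net G len VD.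
           m_star \<bullet> q = K_adj G len m0 q - eval_adj G len VN (r 0) q"
  shows "(\<exists>p m l. classical_solution G len VD VN a d \<epsilon> T f g h r p0 m0 p m l) \<and>
    (\<forall>p m l p' m' l'.
       classical_solution G len VD VN a d \<epsilon> T f g h r p0 m0 p m l \<longrightarrow>
       classical_solution G len VD VN a d \<epsilon> T f g h r p0 m0 p' m' l' \<longrightarrow>
       (\<forall>t\<in>{0..T}. p t = p' t \<and> m t = m' t \<and> l t = l' t))"
  using classical_solution_exists[OF assms(1-14)]
    classical_solution_unique[OF assms(1-6)]
  by blast

end
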